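(* Let $p\ge5$ be a prime. Suppose that $\phi\in HJ^{\delta}_{k,m}(\Gamma^J(\mathcal{O}),\mathbb{Z}_{(p)})$ and $\psi\in HJ^{\delta'}_{k',m'}(\Gamma^J(\mathcal{O}),\mathbb{Z}_{(p)})$ (with $\delta,\delta'\in\{+,-\}$) are such that $0\not\equiv\phi\equiv\psi\pmod p$. Then $m=m'$ and $k\equiv k'\pmod{p-1}$. Moreover, if $m$ is fixed and $(\phi_k)_k$ is a finite family of Hermitian Jacobi forms (indexed by their weights $k$) with $\phi_k\in HJ^{\delta_k}_{k,m}(\Gamma^J(\mathcal{O}),\mathbb{Z}_{(p)})$, $\delta_k\in\{+,-\}$, and $\sum_k\phi_k\equiv0\pmod p$, then for each $a\in\mathbb{Z}/(p-1)\mathbb{Z}$ we have $$\sum_{k\in a+(p-1)\mathbb{Z}}\phi_k\equiv0\pmod p.$$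
   Context: Notation: $\mathcal{O}=\mathbb{Z}[i]$, $\mathcal{O}^{\#}=\frac{i}{2}\mathcal{O}$, $\mathcal{O}^{\times}=\{1,-1,i,-i\}$, $N(r)=r\overline{r}$, $e(z)=e^{2\pi iz}$, $\mathcal{H}$ the complex upper half-plane, $\mathbb{Z}_{(p)}$ the localization of $\mathbb{Z}$ at the prime $p$. For integers $k$ and $m\ge0$ and $\delta\in\{+,-\}$, a Hermitian Jacobi form of weight $k$, index $m$ and parity $\delta$ is a holomorphic function $\phi:\mathcal{H}\times\mathbb{C}^2\to\mathbb{C}$ such that: (1) for all $\begin{pmatrix}a&b\\c&d\end{pmatrix}\in SL_2(\mathbb{Z})$ and $\epsilon\in\mathcal{O}^{\times}$, $\sigma(\epsilon)\epsilon^{-k}(c\tau+d)^{-k}e^{-2\pi imcz_1z_2/(c\tau+d)}\,\phi\left(\frac{a\tau+b}{c\tau+d},\frac{\epsilon z_1}{c\tau+d},\frac{\overline{\epsilon}z_2}{c\tau+d}\right)=\phi(\tau,z_1,z_2)$, where $\sigma(\epsilon)=1$ if $\delta=+$ and $\sigma(\epsilon)=\epsilon^2$ if $\delta=-$; (2) for all $\lambda,\mu\in\mathcal{O}$, $e^{2\pi im(\lambda\overline{\lambda}\tau+\overline{\lambda}z_1+\lambda z_2)}\,\phi(\tau,z_1+\lambda\tau+\mu,z_2+\overline{\lambda}\tau+\overline{\mu})=\phi(\tau,z_1,z_2)$; (3) $\phi=\sum_{0\le n\in\mathbb{Z},\,r\in\mathcal{O}^{\#},\,N(r)\le mn}c(\phi;n,r)q^n\zeta_1^r\zeta_2^{\overline{r}}$,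 where $q=e(\tau)$ and $\zeta_j^s=e(sz_j)$. $HJ^{\delta}_{k,m}(\Gamma^J(\mathcal{O}),\mathbb{Z}_{(p)})$ is the set of such forms with all $c(\phi;n,r)\in\mathbb{Z}_{(p)}$. A congruence mod $p$ between such series means congruence modulo $p\mathbb{Z}_{(p)}$ of all corresponding Fourier coefficients. *)

theory Defs
  imports "HOL-Analysis.Analysis" "HOL-Number_Theory.Cong"
begin

definition upper_half_plane :: "complex set" where
  "upper_half_plane = {\<tau>. Im \<tau> > 0}"

definition gauss_ints :: "complex set" where
  "gauss_ints = {of_int a + \<i> * of_int b |a b :: int. True}"

definition gauss_dual :: "complex set" where
  "gauss_dual = (\<lambda>z. \<i> / 2 * z) ` gauss_ints"

definition gauss_units :: "complex set" where
  "gauss_units = {1, -1, \<i>, -\<i>}"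

definition e2pi :: "complex \<Rightarrow> complex" where
  "e2pi z = exp (2 * of_real pi * \<i> * z)"

text \<open>The localization of the integers at \<open>p\<close>, as a subring of the complex numbers;
  the condition on \<open>b\<close> entails \<open>b \<noteq> 0\<close>.\<close>

definition Z_loc :: "nat \<Rightarrow> complex set" where
  "Z_loc p = {of_int a / of_int b |a b :: int. \<not> int p dvd b}"

datatype parity = Plus | Minus

fun parity_char :: "parity \<Rightarrow> complex \<Rightarrow> complex" where
  "parity_char Plus \<epsilon> = 1"
| "parity_char Minus \<epsilon> = \<epsilon>\<^sup>2"

text \<open>Functions on the product of the upper half-plane with two copies of the complex plane are
  total functions on triples \<open>(\<tau>, z\<^sub>1, z\<^sub>2)\<close>; their values outside that domain never
  matter. Holomorphy in several variables means Frechet differentiability with a complex-linear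
  derivative at every point of the (open) domain.\<close>

definition holomorphic3 :: "(complex \<times> complex \<times> complex \<Rightarrow> complex) \<Rightarrow> bool" where
  "holomorphic3 \<phi> \<longleftrightarrow>
     (\<forall>x \<in> upper_half_plane \<times> UNIV \<times> UNIV. \<exists>A B C.
        (\<phi> has_derivative (\<lambda>(h, h1, h2). A * h + B * h1 + C * h2)) (at x))"

text \<open>Expansion of \<open>\<phi>\<close> with coefficients \<open>c n r\<close> for \<open>n \<ge> 0\<close> and \<open>r\<close> in the dual lattice;
  unordered summation is absolute convergence here. Requiring \<open>c\<close> to vanish off the dual lattice
  makes \<open>c\<close> unique as a function on all of \<open>complex\<close>. The index does not
  enter, so the notion also applies to sums of forms of different weights and lets one compare
  forms of different indices.\<close>

definition fourier_expansion ::
    "(complex \<times> complex \<times> complex \<Rightarrow> complex) \<Rightarrow> (nat \<Rightarrow> complex \<Rightarrow> complex) \<Rightarrow> bool" where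
  "fourier_expansion \<phi> c \<longleftrightarrow>
     (\<forall>n r. r \<notin> gauss_dual \<longrightarrow> c n r = 0) \<and>
     (\<forall>\<tau> \<in> upper_half_plane. \<forall>z1 z2.
        ((\<lambda>(n, r). c n r * e2pi \<tau> ^ n * e2pi (r * z1) * e2pi (cnj r * z2))
           has_sum \<phi> (\<tau>, z1, z2)) (UNIV \<times> gauss_dual))"

definition fourier_coeff ::
    "(complex \<times> complex \<times> complex \<Rightarrow> complex) \<Rightarrow> nat \<Rightarrow> complex \<Rightarrow> complex" where
  "fourier_coeff \<phi> = (THE c. fourier_expansion \<phi> c)"

definition hermitian_jacobi_form ::
    "parity \<Rightarrow> int \<Rightarrow> nat \<Rightarrow> (complex \<times> complex \<times> complex \<Rightarrow> complex) \<Rightarrow> bool" where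
  "hermitian_jacobi_form \<delta> k m \<phi> \<longleftrightarrow>
     holomorphic3 \<phi> \<and>
     (\<forall>(a::int) (b::int) (c::int) (d::int). a * d - b * c = 1 \<longrightarrow>
        (\<forall>\<epsilon> \<in> gauss_units. \<forall>\<tau> \<in> upper_half_plane. \<forall>z1 z2.
           parity_char \<delta> \<epsilon> * \<epsilon> powi (-k) * (of_int c * \<tau> + of_int d) powi (-k)
             * exp (- (2 * of_real pi * \<i> * of_nat m * of_int c * z1 * z2 / (of_int c * \<tau> + of_int d)))
             * \<phi> ((of_int a * \<tau> + of_int b) / (of_int c * \<tau> + of_int d),
                   \<epsilon> * z1 / (of_int c * \<tau> + of_int d),
                   cnj \<epsilon> * z2 / (of_int c * \<tau> + of_int d))
           = \<phi> (\<tau>, z1, z2))) \<and>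
     (\<forall>l \<in> gauss_ints. \<forall>\<mu> \<in> gauss_ints. \<forall>\<tau> \<in> upper_half_plane. \<forall>z1 z2.
        exp (2 * of_real pi * \<i> * of_nat m * (l * cnj l * \<tau> + cnj l * z1 + l * z2))
          * \<phi> (\<tau>, z1 + l * \<tau> + \<mu>, z2 + cnj l * \<tau> + cnj \<mu>)
        = \<phi> (\<tau>, z1, z2)) \<and>
     (\<exists>c. fourier_expansion \<phi> c \<and>
        (\<forall>n r. c n r \<noteq> 0 \<longrightarrow> (cmod r)\<^sup>2 \<le> real m * real n))"

definition HJ_loc ::
    "nat \<Rightarrow> parity \<Rightarrow> int \<Rightarrow> nat \<Rightarrow> (complex \<times> complex \<times> complex \<Rightarrow> complex) set" where
  "HJ_loc p \<delta> k m =
     {\<phi>. hermitian_jacobi_form \<delta> k m \<phi> \<and>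
         (\<forall>n. \<forall>r \<in> gauss_dual. fourier_coeff \<phi> n r \<in> Z_loc p)}"

definition fourier_cong ::
    "nat \<Rightarrow> (complex \<times> complex \<times> complex \<Rightarrow> complex)
       \<Rightarrow> (complex \<times> complex \<times> complex \<Rightarrow> complex) \<Rightarrow> bool" where
  "fourier_cong p \<phi> \<psi> \<longleftrightarrow>
     (\<forall>n. \<forall>r \<in> gauss_dual.
        fourier_coeff \<phi> n r - fourier_coeff \<psi> n r \<in> (\<lambda>x. of_nat p * x) ` Z_loc p)"

end

theory Submission
  imports Defs "HOL-Complex_Analysis.Complex_Analysis" "HOL-Number_Theory.Number_Theory"
begin

text \<open>
  Let \<open>f\<^sub>k\<close> be forms with \<open>\<Sum>\<^sub>k f\<^sub>k \<equiv> 0\<close> modulo \<open>p\<close>. The Hecke operator \<open>V\<^sub>l\<close> for a prime \<open>l\<close> has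
  coefficients \<open>c(l n, r) + l\<^sup>k\<^sup>-\<^sup>1 c(n/l, r/l)\<close>, so \<open>\<Sum>\<^sub>k V\<^sub>l f\<^sub>k\<close> is congruent to the dilation by \<open>l\<close> of the twisted sum
  \<open>\<Sum>\<^sub>k l\<^sup>k\<^sup>-\<^sup>1 f\<^sub>k\<close>. Restricted to the \<open>N\<close>-torsion points, all \<open>V\<^sub>l f\<^sub>k\<close> (with \<open>k\<close> fixed and \<open>l\<close> arbitrary) lie in one space of
  vector-valued modular forms of weight \<open>k\<close>, which is finite-dimensional by a Sturm type bound; hence their reductions
  modulo \<open>p\<close> have only finitely many orders of vanishing. As the order of a dilation is a multiple of \<open>l\<close>, the twisted
  sum vanishes modulo \<open>p\<close> (apart from constants) for all large \<open>l\<close>. By the Chinese remainder theorem it follows that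
  \<open>\<Sum>\<^sub>k t\<^sup>k f\<^sub>k \<equiv> 0\<close> for every \<open>t\<close> prime to \<open>p\<close>, and summing over \<open>t\<close> with suitable powers isolates the
  classes of \<open>k\<close> modulo \<open>p - 1\<close>.

  Constants matter only in index \<open>0\<close>. They are removed by multiplying the family by a modular form that is not constant
  modulo \<open>p\<close>, obtained as a Rankin--Cohen bracket. The equality of the indices follows from the
  translation invariance of the coefficients and the shape of their support.
\<close>


text \<open>The obstacle is that V_l multiplies the index by l, so its images for different l lie in
  no common space of Jacobi forms. On torsion points indexed modulo N^2 the normalised functions
  obey transformation laws in which the index no longer occurs, and the Sturm bound depends on k and
  N only. N is chosen once for all residues of t modulo p, so large that a twisted sum that is
  nonzero modulo p remains so on the torsion points.

  A dimension bound over the complex numbers suffices modulo p: the torsion coefficients are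
  rational, so a linear relation can be taken with integers not all divisible by p, and it survives
  reduction. The first positive order of a dilated sum that is nonzero modulo p lies between l and J
  l with J fixed; primes growing faster than by the factor J give as many distinct orders as
  desired.

  Degree 0 is out of reach, since dilation does not move it. In positive index, translation carries
  the constant coefficient to degree m. In index 0 the nonconstant form is built from a member of
  the family with nonzero weight and nonzero constant term.\<close>

lemma e2pi_0 [simp]: "e2pi 0 = 1"
  by (simp add: e2pi_def)

lemma e2pi_add: "e2pi (a + b) = e2pi a * e2pi b"
  by (simp add: e2pi_def distrib_left exp_add)

lemma e2pi_nonzero [simp]: "e2pi z \<noteq> 0"
  by (simp add: e2pi_def)

lemma e2pi_minus: "e2pi (- a) = inverse (e2pi a)"
  by (simp add: e2pi_def exp_minus)

lemma e2pi_power: "e2pi a ^ n = e2pi (of_nat n * a)"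
  by (simp add: e2pi_def exp_of_nat_mult [symmetric] algebra_simps)

lemma e2pi_of_int [simp]: "e2pi (of_int n) = 1"
  using exp_integer_2pi[of "of_int n"] by (simp add: e2pi_def mult_ac)

lemma e2pi_add_of_int [simp]: "e2pi (z + of_int n) = e2pi z"
  by (simp add: e2pi_add)

lemma norm_e2pi: "norm (e2pi z) = exp (- (2 * pi * Im z))"
  by (simp add: e2pi_def)

lemma e2pi_eq_1_iff: "e2pi (of_real x) = 1 \<longleftrightarrow> x \<in> \<int>"
proof
  assume "e2pi (of_real x) = 1"
  then obtain n :: int where "2 * pi * x = of_int (2 * n) * pi"
    by (auto simp: e2pi_def exp_eq_1)
  hence "x = of_int n" by (simp add: field_simps)
  thus "x \<in> \<int>" by simp
next
  assume "x \<in> \<int>"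
  then obtain n where "x = of_int n" by (auto elim: Ints_cases)
  thus "e2pi (of_real x) = 1" by simp
qed

section \<open>Character sums and Fourier inversion\<close>

lemma sum_e2pi_roots:
  fixes t :: int
  assumes "L > 0"
  shows "(\<Sum>s<L. e2pi (of_int t * of_nat s / of_nat L)) = (if int L dvd t then of_nat L else 0)"
proof -
  define z where "z = e2pi (of_real (real_of_int t / real L))"
  have zs: "e2pi (of_int t * of_nat s / of_nat L) = z ^ s" for s
    by (simp add: z_def e2pi_power mult.commute)
  have z1: "z = 1 \<longleftrightarrow> int L dvd t"
  proof -
    have "z = 1 \<longleftrightarrow> real_of_int t / real L \<in> \<int>"
      unfolding z_def by (rule e2pi_eq_1_iff)
    also have "\<dots> \<longleftrightarrow> int L dvd t"
    proof
      assume "real_of_int t / real L \<in> \<int>"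
      then obtain n where "real_of_int t / real L = of_int n" by (auto elim: Ints_cases)
      hence "real_of_int t = of_int (int L * n)" using assms by (simp add: field_simps)
      hence "t = int L * n" by (simp only: of_int_eq_iff)
      thus "int L dvd t" by simp
    next
      assume "int L dvd t"
      then obtain n where "t = int L * n" by (elim dvdE)
      thus "real_of_int t / real L \<in> \<int>" using assms by simp
    qed
    finally show ?thesis .
  qed
  have "z ^ L = e2pi (of_int t)"
    using assms by (simp add: z_def e2pi_power)
  hence zL: "z ^ L = 1" by simp
  show ?thesis
  proof (cases "int L dvd t")
    case True
    hence "z = 1" using z1 by simp
    thus ?thesis using True by (simp add: zs)
  next
    case False
    hence "z \<noteq> 1" using z1 by simp
    hence "(\<Sum>s<L. z ^ s) = 0"
      using zL by (simp add: sum_gp_strict)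
    thus ?thesis using False by (simp add: zs)
  qed
qed

text \<open>Finite Fourier inversion on Z / L. It later recovers the rational torsion coefficients
  from the q-expansions at all torsion points.\<close>

lemma character_sum_eq_0_imp:
  fixes h :: "nat \<Rightarrow> complex"
  assumes L: "L > 0" and z: "\<And>B. B < L \<Longrightarrow> (\<Sum>s<L. h s * e2pi (of_nat s * of_nat B / of_nat L)) = 0"
    and s: "s < L"
  shows "h s = 0"
proof -
  have "0 = (\<Sum>B<L. e2pi (- (of_nat s * of_nat B / of_nat L)) *
              (\<Sum>u<L. h u * e2pi (of_nat u * of_nat B / of_nat L)))"
    using z by simp
  also have "\<dots> = (\<Sum>B<L. \<Sum>u<L. h u * e2pi (of_int (int u - int s) * of_nat B / of_nat L))"
    by (intro sum.cong refl)
       (simp add: sum_distrib_left algebra_simps diff_divide_distrib e2pi_add[symmetric])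
  also have "\<dots> = (\<Sum>u<L. h u * (\<Sum>B<L. e2pi (of_int (int u - int s) * of_nat B / of_nat L)))"
    by (subst sum.swap) (simp add: sum_distrib_left)
  also have "\<dots> = (\<Sum>u<L. h u * (if int L dvd int u - int s then of_nat L else 0))"
    by (simp only: sum_e2pi_roots[OF L])
  also have "\<dots> = (\<Sum>u<L. if u = s then h s * of_nat L else 0)"
  proof (intro sum.cong refl)
    fix u assume u: "u \<in> {..<L}"
    have "u = s" if "int L dvd int u - int s"
      using that u s zdvd_imp_le[of "int L" "\<bar>int u - int s\<bar>"] by (cases "u = s") auto
    thus "h u * (if int L dvd int u - int s then of_nat L else 0) =
          (if u = s then h s * of_nat L else 0)" by auto
  qed
  also have "\<dots> = h s * of_nat L" using s by simp
  finally show ?thesis using L by simp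
qed

lemma abs_summable_tail:
  fixes f :: "'i \<Rightarrow> real"
  assumes "f summable_on I" "e > 0"
  shows "\<exists>F. finite F \<and> F \<subseteq> I \<and> infsum f (I - F) < e"
proof -
  have "((\<lambda>F. sum f F) \<longlongrightarrow> infsum f I) (finite_subsets_at_top I)"
    using assms(1) by (simp add: infsum_tendsto)
  hence "eventually (\<lambda>F. dist (sum f F) (infsum f I) < e) (finite_subsets_at_top I)"
    using assms(2) tendstoD by blast
  then obtain F where F: "finite F" "F \<subseteq> I" "dist (sum f F) (infsum f I) < e"
    unfolding eventually_finite_subsets_at_top by blast
  have "infsum f (I - F) = infsum f I - infsum f F"
    using F assms(1) by (intro infsum_Diff) (auto intro: summable_on_finite)
  hence "infsum f (I - F) < e"
    using F by (simp add: dist_real_def abs_if split: if_splits)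
  thus ?thesis using F by blast
qed

lemma has_sum_finite_sum:
  fixes f :: "'j \<Rightarrow> 'i \<Rightarrow> 'a :: topological_comm_monoid_add"
  assumes "\<And>j. j \<in> J \<Longrightarrow> (f j has_sum S j) I"
  shows "((\<lambda>i. \<Sum>j\<in>J. f j i) has_sum (\<Sum>j\<in>J. S j)) I"
  using assms by (induction J rule: infinite_finite_induct) (auto intro: has_sum_add)

text \<open>Averaging over the \<open>Q\<close>-th roots of unity isolates the terms with \<open>\<kappa> i\<close> in a residue class
  modulo \<open>Q\<close>; for large \<open>Q\<close> those with \<open>\<kappa> i \<noteq> v\<close> lie in the tail of the sum.\<close>

lemma has_sum_character_fiber:
  fixes a :: "'i \<Rightarrow> complex" and \<kappa> :: "'i \<Rightarrow> int"
  assumes "\<And>\<beta>::real. ((\<lambda>i. a i * e2pi (of_int (\<kappa> i) * of_real \<beta>)) has_sum 0) I"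
  shows "(a has_sum 0) {i \<in> I. \<kappa> i = v}"
proof -
  have a0: "(a has_sum 0) I" using assms[of 0] by simp
  hence an: "(\<lambda>i. norm (a i)) summable_on I"
    using has_sum_imp_summable summable_on_iff_abs_summable_on_complex by blast
  define V where "V = {i \<in> I. \<kappa> i = v}"
  have VI: "V \<subseteq> I" by (auto simp: V_def)
  have asub: "a summable_on J" if "J \<subseteq> I" for J
    using a0 that has_sum_imp_summable summable_on_subset_banach by blast
  have cls: "(a has_sum 0) {i \<in> I. int Q dvd \<kappa> i - v}" if Q: "Q > 0" for Q :: nat
  proof -
    have "((\<lambda>i. \<Sum>s<Q. e2pi (- (of_int v * of_nat s / of_nat Q)) *
             (a i * e2pi (of_int (\<kappa> i) * of_real (real s / real Q)))) has_sum (\<Sum>s<Q. e2pi (- (of_int v * of_nat s / of_nat Q)) * 0)) I"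
      by (intro has_sum_finite_sum has_sum_cmult_right assms)
    moreover have "(\<Sum>s<Q. e2pi (- (of_int v * of_nat s / of_nat Q)) *
             (a i * e2pi (of_int (\<kappa> i) * of_real (real s / real Q)))) =
         a i * of_nat Q * (if int Q dvd \<kappa> i - v then 1 else 0)" for i
    proof -
      have "(\<Sum>s<Q. e2pi (- (of_int v * of_nat s / of_nat Q)) *
             (a i * e2pi (of_int (\<kappa> i) * of_real (real s / real Q)))) =
            (\<Sum>s<Q. a i * e2pi (of_int (\<kappa> i - v) * of_nat s / of_nat Q))"
        by (intro sum.cong refl)
           (simp add: algebra_simps diff_divide_distrib e2pi_add[symmetric])
      also have "\<dots> = a i * (\<Sum>s<Q. e2pi (of_int (\<kappa> i - v) * of_nat s / of_nat Q))"
        by (simp add: sum_distrib_left)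
      finally show ?thesis using sum_e2pi_roots[OF Q, of "\<kappa> i - v"] by simp
    qed
    ultimately have "((\<lambda>i. a i * of_nat Q * (if int Q dvd \<kappa> i - v then 1 else 0)) has_sum 0) I"
      by simp
    hence "((\<lambda>i. inverse (of_nat Q) * (a i * of_nat Q * (if int Q dvd \<kappa> i - v then 1 else 0))) has_sum inverse (of_nat Q) * 0) I"
      by (rule has_sum_cmult_right)
    moreover have "inverse (of_nat Q) * (a i * of_nat Q * (if int Q dvd \<kappa> i - v then 1 else 0)) =
                   (if int Q dvd \<kappa> i - v then a i else 0)" for i
      using Q by simp
    ultimately have "((\<lambda>i. if int Q dvd \<kappa> i - v then a i else 0) has_sum 0) I"
      by simp
    also have "?this \<longleftrightarrow> ?thesis"
      by (rule has_sum_cong_neutral) auto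
    finally show ?thesis .
  qed
  have "norm (infsum a V) \<le> e" if e: "e > 0" for e
  proof -
    obtain F where F: "finite F" "F \<subseteq> I" and Fe: "infsum (\<lambda>i. norm (a i)) (I - F) < e"
      using abs_summable_tail[OF an e] by blast
    \<comment> \<open>This modulus exceeds every |\<open>\<kappa> i\<close> - v| with i in F, so an
      i in F satisfying the congruence has \<open>\<kappa> i = v\<close>.\<close>
    define Q where "Q = nat (\<Sum>i\<in>F. \<bar>\<kappa> i - v\<bar>) + 1"
    have Q: "Q > 0" by (simp add: Q_def)
    define W where "W = {i \<in> I. int Q dvd \<kappa> i - v} - V"
    have WF: "W \<subseteq> I - F"
    proof
      fix i assume i: "i \<in> W"
      have "i \<notin> F"
      proof
        assume "i \<in> F"
        hence "\<bar>\<kappa> i - v\<bar> \<le> (\<Sum>i\<in>F. \<bar>\<kappa> i - v\<bar>)"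
          using F by (intro member_le_sum) auto
        hence "\<bar>\<kappa> i - v\<bar> < int Q" by (simp add: Q_def)
        moreover have "int Q dvd \<bar>\<kappa> i - v\<bar>" "\<kappa> i \<noteq> v" using i by (auto simp: W_def V_def)
        ultimately show False using zdvd_not_zless[of "\<bar>\<kappa> i - v\<bar>" "int Q"] by auto
      qed
      thus "i \<in> I - F" using i by (auto simp: W_def)
    qed
    have U: "V \<union> W = {i \<in> I. int Q dvd \<kappa> i - v}" by (auto simp: V_def W_def)
    have "infsum a (V \<union> W) = infsum a V + infsum a W"
      using VI WF by (intro infsum_Un_disjoint asub) (auto simp: W_def)
    hence "infsum a V = - infsum a W"
      using cls[OF Q] U by (simp add: infsumI add_eq_0_iff2)
    hence "norm (infsum a V) = norm (infsum a W)" by simp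
    also have "\<dots> \<le> infsum (\<lambda>i. norm (a i)) W"
      using WF by (intro norm_infsum_bound summable_on_subset_banach[OF an]) auto
    also have "\<dots> \<le> infsum (\<lambda>i. norm (a i)) (I - F)"
      using WF by (intro infsum_mono_neutral summable_on_subset_banach[OF an]) auto
    finally show ?thesis using Fe by simp
  qed
  hence "norm (infsum a V) \<le> 0" by (rule field_le_epsilon[of _ 0, simplified])
  hence "infsum a V = 0" by simp
  with asub[OF VI] show ?thesis unfolding V_def by (metis has_sum_infsum)
qed

section \<open>Jacobi forms and Hecke operators\<close>

text \<open>Gaussian integers enter through the real inner product: for r = (x - i y) / 2 the number
  r w + cnj (r w) equals \<open>gi x y \<bullet> w\<close>, so the characters of the dual lattice
  become \<open>e2pi\<close> of real inner products.\<close>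

definition gi :: "int \<Rightarrow> int \<Rightarrow> complex" where
  "gi x y = Complex (of_int x) (of_int y)"

lemma gi_simps [simp]: "Re (gi x y) = of_int x" "Im (gi x y) = of_int y"
  by (simp_all add: gi_def)

lemma gi_add: "gi (x + x') (y + y') = gi x y + gi x' y'"
  and gi_minus: "gi (- x) (- y) = - gi x y"
  and gi_mult: "gi (n * x) (n * y) = of_int n * gi x y"
  and gi_0: "gi 0 0 = 0"
  by (simp_all add: complex_eq_iff)

lemma inner_gi: "gi x y \<bullet> gi u v = of_int (x * u + y * v)"
  by (simp add: inner_complex_def)

lemma inner_of_int_mult_left: "(of_int n * \<alpha>) \<bullet> \<beta> = of_int n * (\<alpha> \<bullet> (\<beta>::complex))"
  by (simp add: inner_complex_def algebra_simps)

lemma inner_of_int_mult_right: "\<alpha> \<bullet> (of_int n * \<beta>) = of_int n * (\<alpha> \<bullet> (\<beta>::complex))"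
  by (simp add: inner_complex_def algebra_simps)

lemma inner_of_nat_mult_left: "(of_nat n * \<alpha>) \<bullet> \<beta> = of_nat n * (\<alpha> \<bullet> (\<beta>::complex))"
  by (simp add: inner_complex_def algebra_simps)

lemma inner_of_nat_mult_right: "\<alpha> \<bullet> (of_nat n * \<beta>) = of_nat n * (\<alpha> \<bullet> (\<beta>::complex))"
  by (simp add: inner_complex_def algebra_simps)

lemma inner_div_of_nat_left: "(\<alpha> / of_nat n) \<bullet> \<beta> = (\<alpha> \<bullet> (\<beta>::complex)) / of_nat n"
  by (simp add: inner_complex_def add_divide_distrib)

lemma inner_div_of_nat_right: "\<alpha> \<bullet> (\<beta> / of_nat n) = (\<alpha> \<bullet> (\<beta>::complex)) / of_nat n"
  by (simp add: inner_complex_def add_divide_distrib)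

lemmas inner_mult_simps =
  inner_of_int_mult_left inner_of_int_mult_right inner_of_nat_mult_left inner_of_nat_mult_right
  inner_div_of_nat_left inner_div_of_nat_right

type_synonym jcoeffs = "nat \<Rightarrow> int \<Rightarrow> int \<Rightarrow> complex"
type_synonym jfunction = "complex \<Rightarrow> complex \<Rightarrow> complex \<Rightarrow> complex"

text \<open>A Jacobi form \<open>\<phi>\<close> of index \<open>M\<close> is encoded by the functions
  \<open>f \<alpha> \<beta> \<tau> = e (M (\<bar>\<alpha>\<bar>\<^sup>2 \<tau> + Re (cnj \<alpha> \<beta>))) \<phi>(\<tau>, \<alpha> \<tau> + \<beta>, cnj \<alpha> \<tau> + cnj \<beta>)\<close> with \<open>\<alpha>, \<beta>\<close> complex;
  this normalisation removes all cocycles from the modular transformation law. The point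
  \<open>(x - \<i> y) / 2\<close> of the dual lattice is encoded by the pair of integers \<open>(x, y)\<close>.\<close>

definition jexp :: "nat \<Rightarrow> nat \<Rightarrow> int \<Rightarrow> int \<Rightarrow> jfunction" where
  "jexp M n x y \<alpha> \<beta> \<tau> = of_real (of_nat n + of_nat M * (\<alpha> \<bullet> \<alpha>) + gi x y \<bullet> \<alpha>) * \<tau>
     + of_real (gi x y \<bullet> \<beta> + of_nat M * (\<alpha> \<bullet> \<beta>))"

lemma Im_minus_inverse_pos: "Im (- 1 / \<tau>) > 0" if "Im \<tau> > 0"
proof -
  have "Im (- 1 / \<tau>) = Im \<tau> / ((Re \<tau>)\<^sup>2 + (Im \<tau>)\<^sup>2)" by (simp add: Im_divide)
  thus ?thesis using that by (simp add: add_nonneg_pos)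
qed

definition jsum ::
  "nat \<Rightarrow> jcoeffs \<Rightarrow> jfunction \<Rightarrow> bool" where
  "jsum M c f \<longleftrightarrow> (\<forall>\<alpha> \<beta> \<tau>. Im \<tau> > 0 \<longrightarrow>
     ((\<lambda>(n, x, y). c n x y * e2pi (jexp M n x y \<alpha> \<beta> \<tau>)) has_sum f \<alpha> \<beta> \<tau>) UNIV)"

text \<open>The norm of r = (x - i y) / 2 is (x^2 + y^2) / 4, whence the factor 4.\<close>

definition jsupp :: "nat \<Rightarrow> jcoeffs \<Rightarrow> bool" where
  "jsupp M c \<longleftrightarrow> (\<forall>n x y. c n x y \<noteq> 0 \<longrightarrow> x\<^sup>2 + y\<^sup>2 \<le> 4 * int M * int n)"

abbreviation automorphy_factor :: "int \<Rightarrow> int \<Rightarrow> complex \<Rightarrow> complex" where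
  "automorphy_factor c d \<tau> \<equiv> of_int c * \<tau> + of_int d"

abbreviation moebius :: "int \<Rightarrow> int \<Rightarrow> int \<Rightarrow> int \<Rightarrow> complex \<Rightarrow> complex" where
  "moebius a b c d \<tau> \<equiv> (of_int a * \<tau> + of_int b) / (of_int c * \<tau> + of_int d)"

text \<open>The pair (\<alpha>, \<beta>) is a row vector multiplied from the right by the matrix.
  The new pair (\<alpha>', \<beta>') is the one for which \<alpha>' \<tau> + \<beta>' equals the
  automorphy factor times \<alpha> g + \<beta>, where g is the image of \<tau>.\<close>

definition jmod :: "int \<Rightarrow> jfunction \<Rightarrow> bool" where
  "jmod k f \<longleftrightarrow> (\<forall>(a::int) b c d. a * d - b * c = 1 \<longrightarrow> (\<forall>\<alpha> \<beta> \<tau>. Im \<tau> > 0 \<longrightarrow>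
     f \<alpha> \<beta> (moebius a b c d \<tau>) =
     automorphy_factor c d \<tau> powi k * f (of_int a * \<alpha> + of_int c * \<beta>) (of_int b * \<alpha> + of_int d * \<beta>) \<tau>))"

text \<open>The case of the matrix (0, -1; 1, 0). Together with the shift to \<tau> + 1, which can
  be read off from the expansion, it covers generators of the modular group; this is the form in
  which modularity is passed on to Hecke images.\<close>

definition jinv :: "int \<Rightarrow> jfunction \<Rightarrow> bool" where
  "jinv k f \<longleftrightarrow> (\<forall>\<alpha> \<beta> \<tau>. Im \<tau> > 0 \<longrightarrow> f \<alpha> \<beta> (- 1 / \<tau>) = \<tau> powi k * f \<beta> (- \<alpha>) \<tau>)"

lemma jsumD:
  assumes "jsum M c f" "Im \<tau> > 0"
  shows "((\<lambda>(n, x, y). c n x y * e2pi (jexp M n x y \<alpha> \<beta> \<tau>)) has_sum f \<alpha> \<beta> \<tau>) UNIV"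
  using assms unfolding jsum_def by blast

lemma jsum_eqI:
  assumes "jsum M c f" "Im \<tau> > 0" "Im \<tau>' > 0"
    and "\<And>n x y. e2pi (jexp M n x y \<alpha> \<beta> \<tau>) = u * e2pi (jexp M n x y \<alpha>' \<beta>' \<tau>')"
  shows "f \<alpha> \<beta> \<tau> = u * f \<alpha>' \<beta>' \<tau>'"
proof -
  have "((\<lambda>i. u * (case i of (n, x, y) \<Rightarrow> c n x y * e2pi (jexp M n x y \<alpha>' \<beta>' \<tau>'))) has_sum u * f \<alpha>' \<beta>' \<tau>') UNIV"
    by (intro has_sum_cmult_right jsumD[OF assms(1,3)])
  also have "(\<lambda>i. u * (case i of (n, x, y) \<Rightarrow> c n x y * e2pi (jexp M n x y \<alpha>' \<beta>' \<tau>'))) =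
             (\<lambda>(n, x, y). c n x y * e2pi (jexp M n x y \<alpha> \<beta> \<tau>))"
    using assms(4) by (auto simp: fun_eq_iff)
  finally show ?thesis
    using has_sum_unique jsumD[OF assms(1,2), of \<alpha> \<beta>] by blast
qed

lemma jsum_translate_right:
  assumes "jsum M c f" "Im \<tau> > 0"
  shows "f \<alpha> (\<beta> + gi u v) \<tau> = e2pi (of_real (of_nat M * (\<alpha> \<bullet> gi u v))) * f \<alpha> \<beta> \<tau>"
proof (rule jsum_eqI[OF assms assms(2)])
  fix n x y
  have "jexp M n x y \<alpha> (\<beta> + gi u v) \<tau> =
        of_real (of_nat M * (\<alpha> \<bullet> gi u v)) + jexp M n x y \<alpha> \<beta> \<tau> + of_int (x * u + y * v)"
    unfolding jexp_def inner_add_right inner_gi by (simp add: algebra_simps)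
  thus "e2pi (jexp M n x y \<alpha> (\<beta> + gi u v) \<tau>) =
        e2pi (of_real (of_nat M * (\<alpha> \<bullet> gi u v))) * e2pi (jexp M n x y \<alpha> \<beta> \<tau>)"
    by (simp only: e2pi_add e2pi_of_int mult_1_right)
qed

text \<open>Conjugation by the inversion turns a translation of \<beta>, which is visible term by
  term in the expansion, into a translation of \<alpha>.\<close>

lemma jsum_translate_left:
  assumes "jsum M c f" "jinv k f" "Im \<tau> > 0"
  shows "f (\<alpha> + gi u v) \<beta> \<tau> = e2pi (- of_real (of_nat M * (gi u v \<bullet> \<beta>))) * f \<alpha> \<beta> \<tau>"
proof -
  define t where "t = - 1 / \<tau>"
  have t: "Im t > 0" "\<tau> = - 1 / t"
    using Im_minus_inverse_pos[OF assms(3)] by (simp_all add: t_def)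
  have "f (\<alpha> + gi u v) \<beta> \<tau> = t powi k * f \<beta> (- \<alpha> + gi (- u) (- v)) t"
    using assms(2) t unfolding jinv_def by (simp add: gi_minus)
  also have "\<dots> = e2pi (- of_real (of_nat M * (gi u v \<bullet> \<beta>))) * (t powi k * f \<beta> (- \<alpha>) t)"
    by (subst jsum_translate_right[OF assms(1) t(1)])
       (simp add: gi_minus inner_commute mult_ac)
  also have "t powi k * f \<beta> (- \<alpha>) t = f \<alpha> \<beta> \<tau>"
    using assms(2) t unfolding jinv_def by simp
  finally show ?thesis .
qed

lemma jsum_plus_1:
  assumes "jsum M c f" "Im \<tau> > 0"
  shows "f \<alpha> \<beta> (\<tau> + 1) = f \<alpha> (\<alpha> + \<beta>) \<tau>"
proof -
  have "f \<alpha> \<beta> (\<tau> + 1) = 1 * f \<alpha> (\<alpha> + \<beta>) \<tau>"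
  proof (rule jsum_eqI[OF assms(1) _ assms(2)])
    fix n x y
    have "jexp M n x y \<alpha> \<beta> (\<tau> + 1) = jexp M n x y \<alpha> (\<alpha> + \<beta>) \<tau> + of_int (int n)"
      by (simp add: jexp_def inner_add_right algebra_simps)
    thus "e2pi (jexp M n x y \<alpha> \<beta> (\<tau> + 1)) = 1 * e2pi (jexp M n x y \<alpha> (\<alpha> + \<beta>) \<tau>)"
      by (simp only: e2pi_add_of_int mult_1)
  qed (use assms in auto)
  thus ?thesis by simp
qed

lemma jmod_imp_jinv: "jmod k f \<Longrightarrow> jinv k f"
  unfolding jinv_def
proof (intro allI impI)
  fix \<alpha> \<beta> \<tau> :: complex assume f: "jmod k f" and \<tau>: "Im \<tau> > 0"
  have "f \<alpha> \<beta> ((of_int 0 * \<tau> + of_int (-1)) / (of_int 1 * \<tau> + of_int 0)) =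
     (of_int 1 * \<tau> + of_int 0) powi k * f (of_int 0 * \<alpha> + of_int 1 * \<beta>) (of_int (-1) * \<alpha> + of_int 0 * \<beta>) \<tau>"
    using f \<tau> unfolding jmod_def by (intro f[unfolded jmod_def, rule_format]) auto
  thus "f \<alpha> \<beta> (- 1 / \<tau>) = \<tau> powi k * f \<beta> (- \<alpha>) \<tau>" by simp
qed

text \<open>For prime l this is l V_l, with the representatives (l, 0; 0, 1) and (1, b; 0, l) of
  determinant l. In terms of z = \<alpha> \<tau> + \<beta> they evaluate the Jacobi form at (l
  \<tau>, l z) and at ((\<tau> + b) / l, z); the shift \<beta> - b \<alpha> keeps z fixed in the
  second case.\<close>

definition hecke ::
  "nat \<Rightarrow> int \<Rightarrow> jfunction \<Rightarrow> jfunction" where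
  "hecke l k f \<alpha> \<beta> \<tau> = of_nat l powi k * f \<alpha> (of_nat l * \<beta>) (of_nat l * \<tau>)
     + (\<Sum>b<l. f (of_nat l * \<alpha>) (\<beta> - of_nat b * \<alpha>) ((\<tau> + of_nat b) / of_nat l))"

definition hecke_coeff :: "nat \<Rightarrow> int \<Rightarrow> jcoeffs \<Rightarrow> jcoeffs" where
  "hecke_coeff l k c n x y = of_nat l * c (l * n) x y +
     (if l dvd n \<and> int l dvd x \<and> int l dvd y
      then of_nat l powi k * c (n div l) (x div int l) (y div int l) else 0)"

lemma jsupp_hecke:
  assumes "jsupp M c" "l > 0"
  shows "jsupp (l * M) (hecke_coeff l k c)"
  unfolding jsupp_def
proof (intro allI impI)
  fix n x y assume nz: "hecke_coeff l k c n x y \<noteq> 0"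
  show "x\<^sup>2 + y\<^sup>2 \<le> 4 * int (l * M) * int n"
  proof (cases "c (l * n) x y = 0")
    case False
    thus ?thesis using assms(1) unfolding jsupp_def by (fastforce simp: mult_ac)
  next
    case True
    with nz have d: "l dvd n" "int l dvd x" "int l dvd y"
      and nz': "c (n div l) (x div int l) (y div int l) \<noteq> 0"
      by (auto simp: hecke_coeff_def split: if_splits)
    from d obtain n' x' y' where e: "n = l * n'" "x = int l * x'" "y = int l * y'"
      by (auto elim!: dvdE)
    have "x'\<^sup>2 + y'\<^sup>2 \<le> 4 * int M * int n'"
      using nz' assms unfolding jsupp_def e by auto
    hence "int l ^ 2 * (x'\<^sup>2 + y'\<^sup>2) \<le> int l ^ 2 * (4 * int M * int n')"
      by (intro mult_left_mono) auto
    thus ?thesis unfolding e by (simp add: power2_eq_square algebra_simps)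
  qed
qed

lemma jsum_hecke:
  assumes f: "jsum M c f" and l: "l > 0"
  shows "jsum (l * M) (hecke_coeff l k c) (hecke l k f)"
  unfolding jsum_def
proof (intro allI impI)
  fix \<alpha> \<beta> \<tau> :: complex assume \<tau>: "Im \<tau> > 0"
  let ?S1 = "of_nat l powi k * f \<alpha> (of_nat l * \<beta>) (of_nat l * \<tau>)"
  let ?x = "\<lambda>n x y b. jexp M n x y (of_nat l * \<alpha>) (\<beta> - of_nat b * \<alpha>) ((\<tau> + of_nat b) / of_nat l)"
  let ?S2 = "\<Sum>b<l. f (of_nat l * \<alpha>) (\<beta> - of_nat b * \<alpha>) ((\<tau> + of_nat b) / of_nat l)"
  let ?d = "\<lambda>n x y. if l dvd n \<and> int l dvd x \<and> int l dvd y
      then of_nat l powi k * c (n div l) (x div int l) (y div int l) else 0"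
  define E where "E = (\<lambda>n x y. e2pi (jexp (l * M) n x y \<alpha> \<beta> \<tau>))"
  have je: "jexp M n x y \<alpha> (of_nat l * \<beta>) (of_nat l * \<tau>) =
             jexp (l * M) (l * n) (int l * x) (int l * y) \<alpha> \<beta> \<tau>" for n x y
    unfolding jexp_def gi_mult inner_mult_simps by (simp add: algebra_simps)
  have "((\<lambda>(n, x, y). of_nat l powi k * (c n x y * e2pi (jexp (l * M) (l * n) (int l * x) (int l * y) \<alpha> \<beta> \<tau>)))
          has_sum ?S1) UNIV"
    using has_sum_cmult_right[OF jsumD[OF f, of "of_nat l * \<tau>" \<alpha> "of_nat l * \<beta>"], of "of_nat l powi k"]
      \<tau> l by (simp add: case_prod_unfold je)
  also have "((\<lambda>(n, x, y). of_nat l powi k * (c n x y * e2pi (jexp (l * M) (l * n) (int l * x) (int l * y) \<alpha> \<beta> \<tau>)))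
          has_sum ?S1) UNIV \<longleftrightarrow>
     ((\<lambda>(n, x, y). of_nat l powi k * c (n div l) (x div int l) (y div int l) * E n x y) has_sum
        ?S1)
     {(n, x, y). l dvd n \<and> int l dvd x \<and> int l dvd y}"
    by (rule has_sum_reindex_bij_witness[where j = "\<lambda>(n, x, y). (l * n, int l * x, int l * y)"
        and i = "\<lambda>(n, x, y). (n div l, x div int l, y div int l)"])
       (use l in \<open>auto simp: E_def\<close>)
  also have "\<dots> \<longleftrightarrow> ((\<lambda>(n, x, y). ?d n x y * E n x y) has_sum
        ?S1) UNIV"
    by (rule has_sum_cong_neutral) (auto split: if_splits)
  finally have 1: "((\<lambda>(n, x, y). ?d n x y * E n x y) has_sum
        ?S1) UNIV" .

  \<comment> \<open>\<open>Z\<close> carries the exponent n / l. The sum over b removes the terms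
    with l not dividing n, and substituting l n for n turns \<open>Z\<close> into
    \<open>E\<close>.\<close>
  define Z where "Z = (\<lambda>n x y. e2pi (of_real (of_nat n / of_nat l + of_nat (l * M) * (\<alpha> \<bullet> \<alpha>) + gi x y \<bullet> \<alpha>) * \<tau>
     + of_real (gi x y \<bullet> \<beta> + of_nat (l * M) * (\<alpha> \<bullet> \<beta>))))"
  have "((\<lambda>i. \<Sum>b<l. case i of (n, x, y) \<Rightarrow> c n x y * e2pi (?x n x y b))
     has_sum ?S2) UNIV"
    using \<tau> l by (intro has_sum_finite_sum jsumD[OF f]) auto
  also have "(\<lambda>i. \<Sum>b<l. case i of (n, x, y) \<Rightarrow> c n x y * e2pi (?x n x y b)) =
     (\<lambda>(n, x, y). if l dvd n then of_nat l * c n x y * Z n x y else 0)"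
  proof (intro ext, clarify)
    fix n x y
    define X where "X = of_real (of_nat n / of_nat l + of_nat (l * M) * (\<alpha> \<bullet> \<alpha>) + gi x y \<bullet> \<alpha>) * \<tau>
     + of_real (gi x y \<bullet> \<beta> + of_nat (l * M) * (\<alpha> \<bullet> \<beta>))"
    have "?x n x y b =
          X + of_int (int n) * of_nat b / of_nat l" for b
      using l unfolding jexp_def inner_diff_right inner_mult_simps X_def
      by (simp add: field_simps)
    moreover have "Z n x y = e2pi X" by (simp add: Z_def X_def)
    ultimately have "(\<Sum>b<l. c n x y * e2pi (?x n x y b)) =
           c n x y * Z n x y * (\<Sum>b<l. e2pi (of_int (int n) * of_nat b / of_nat l))"
      by (simp only: e2pi_add sum_distrib_left mult.assoc)
    also have "\<dots> = (if l dvd n then of_nat l * c n x y * Z n x y else 0)"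
      using l by (simp only: sum_e2pi_roots) simp
    finally show "(\<Sum>b<l. c n x y * e2pi (?x n x y b)) =
        (if l dvd n then of_nat l * c n x y * Z n x y else 0)" .
  qed
  also have "((\<lambda>(n, x, y). if l dvd n then of_nat l * c n x y * Z n x y else 0) has_sum
      ?S2) UNIV \<longleftrightarrow>
    ((\<lambda>(n, x, y). of_nat l * c n x y * Z n x y) has_sum
      ?S2) {(n, x, y). l dvd n}"
    by (rule has_sum_cong_neutral) auto
  also have "\<dots> \<longleftrightarrow> ((\<lambda>(n, x, y). of_nat l * c (l * n) x y * E n x y) has_sum
      ?S2) UNIV"
    by (rule has_sum_reindex_bij_witness[where i = "\<lambda>(n, x, y). (l * n, x, y)"
        and j = "\<lambda>(n, x, y). (n div l, x, y)"])
       (use l in \<open>auto simp: E_def Z_def jexp_def\<close>)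
  finally have 2: "((\<lambda>(n, x, y). of_nat l * c (l * n) x y * E n x y) has_sum
      ?S2) UNIV" .
  show "((\<lambda>(n, x, y). hecke_coeff l k c n x y * e2pi (jexp (l * M) n x y \<alpha> \<beta> \<tau>))
          has_sum hecke l k f \<alpha> \<beta> \<tau>) UNIV"
    using has_sum_add[OF 1 2]
    by (simp add: hecke_def hecke_coeff_def E_def case_prod_unfold distrib_right add.commute)
qed

text \<open>Under inversion the coset of (1, b; 0, l) with 0 < b < l goes to the one with parameter
  -1/b modulo l; \<open>\<sigma>\<close> is this permutation.\<close>

lemma exists_negative_inverse_mod_prime:
  assumes l: "prime l"
  obtains \<sigma> :: "nat \<Rightarrow> nat" where "bij_betw \<sigma> {1..<l} {1..<l}"
    and "\<And>b. b \<in> {1..<l} \<Longrightarrow> int l dvd 1 + int b * int (\<sigma> b)"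
proof -
  have l1: "l > 1" using l by (rule prime_gt_1_nat)
  have "\<exists>b'\<in>{1..<l}. int l dvd 1 + int b * int b'" if b: "b \<in> {1..<l}" for b
  proof -
    have "\<not> l dvd b" using b by (auto dest: dvd_imp_le)
    hence "coprime (int b) (int l)"
      using prime_imp_coprime[OF l] by (simp add: coprime_commute)
    then obtain x where x: "[int b * x = 1] (mod int l)"
      using cong_solve_coprime_int by blast
    define b' where "b' = nat ((- x) mod int l)"
    have ib: "int b' = (- x) mod int l" using l1 by (simp add: b'_def)
    have "[1 + int b * int b' = 1 + int b * (- x)] (mod int l)"
      unfolding ib by (intro cong_add cong_mult cong_refl) (simp add: cong_def)
    also have "[1 + int b * (- x) = 1 - 1] (mod int l)"
      using cong_diff[OF cong_refl[of 1] x] by simp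
    finally have d: "int l dvd 1 + int b * int b'"
      by (simp add: cong_0_iff)
    have "b' < l" using ib l1 by (metis of_nat_less_iff pos_mod_bound of_nat_0_less_iff less_trans zero_less_one)
    moreover have "b' \<noteq> 0"
    proof
      assume "b' = 0"
      with d have "int l dvd 1" by simp
      thus False using l1 by simp
    qed
    ultimately show ?thesis using d by (intro bexI[of _ b']) auto
  qed
  then obtain \<sigma> where \<sigma>: "\<And>b. b \<in> {1..<l} \<Longrightarrow> \<sigma> b \<in> {1..<l} \<and> int l dvd 1 + int b * int (\<sigma> b)"
    by metis
  have "inj_on \<sigma> {1..<l}"
  proof (rule inj_onI)
    fix a b assume ab: "a \<in> {1..<l}" "b \<in> {1..<l}" "\<sigma> a = \<sigma> b"
    have "int l dvd (1 + int a * int (\<sigma> a)) - (1 + int b * int (\<sigma> a))"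
      using \<sigma>[OF ab(1)] \<sigma>[OF ab(2)] ab(3) by (intro dvd_diff) auto
    hence "int l dvd (int a - int b) * int (\<sigma> a)" by (simp add: algebra_simps)
    moreover have "\<not> int l dvd int (\<sigma> a)" using \<sigma>[OF ab(1)] by (auto dest: dvd_imp_le)
    ultimately have "int l dvd int a - int b"
      using l prime_dvd_mult_iff[of "int l"] by auto
    thus "a = b" using ab zdvd_imp_le[of "int l" "\<bar>int a - int b\<bar>"] by (cases "a = b") auto
  qed
  moreover have "\<sigma> ` {1..<l} \<subseteq> {1..<l}" using \<sigma> by auto
  ultimately have "bij_betw \<sigma> {1..<l} {1..<l}"
    by (simp add: bij_betw_def endo_inj_surj)
  thus ?thesis using that \<sigma> by blast
qed

text \<open>Inversion exchanges the representatives (l, 0; 0, 1) and (1, 0; 0, l) and permutes the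
  remaining (1, b; 0, l) along \<open>\<sigma>\<close>. The matrices of determinant 1 that connect b
  with \<open>\<sigma> b\<close> are not just inversions, so modularity of f under the whole group
  is used.\<close>

lemma jinv_hecke:
  assumes f: "jmod k f" and l: "prime l"
  shows "jinv k (hecke l k f)"
  unfolding jinv_def
proof (intro allI impI)
  fix \<alpha> \<beta> \<tau> :: complex assume \<tau>: "Im \<tau> > 0"
  let ?L = "\<lambda>b. f (of_nat l * \<alpha>) (\<beta> - of_nat b * \<alpha>) ((- 1 / \<tau> + of_nat b) / of_nat l)"
  let ?R = "\<lambda>b. \<tau> powi k * f (of_nat l * \<beta>) (- \<alpha> - of_nat b * \<beta>) ((\<tau> + of_nat b) / of_nat l)"
  have l0: "l > 0" using l by (simp add: prime_gt_0_nat)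
  have \<tau>0: "\<tau> \<noteq> 0" using \<tau> by auto
  have S: "f \<alpha> \<beta> (- 1 / \<tau>) = \<tau> powi k * f \<beta> (- \<alpha>) \<tau>" if "Im \<tau> > 0" for \<alpha> \<beta> \<tau>
    using jmod_imp_jinv[OF f] that unfolding jinv_def by blast
  have split: "(\<Sum>b<l. g b) = g 0 + (\<Sum>b\<in>{1..<l}. g b)" for g :: "nat \<Rightarrow> complex"
    using l0 by (simp add: lessThan_atLeast0 sum.atLeast_Suc_lessThan)
  obtain \<sigma> where \<sigma>: "bij_betw \<sigma> {1..<l} {1..<l}"
    and \<sigma>d: "\<And>b. b \<in> {1..<l} \<Longrightarrow> int l dvd 1 + int b * int (\<sigma> b)"
    using exists_negative_inverse_mod_prime[OF l] by blast
  have t1: "of_nat l powi k * f \<alpha> (of_nat l * \<beta>) (of_nat l * (- 1 / \<tau>)) =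
        \<tau> powi k * f (of_nat l * \<beta>) (- \<alpha>) (\<tau> / of_nat l)"
    using S[of "\<tau> / of_nat l" \<alpha> "of_nat l * \<beta>"] \<tau> l0
    by (simp add: power_int_divide_distrib)
  have t2: "f (of_nat l * \<alpha>) \<beta> ((- 1 / \<tau>) / of_nat l) =
        \<tau> powi k * (of_nat l powi k * f \<beta> (of_nat l * (- \<alpha>)) (of_nat l * \<tau>))"
    using S[of "of_nat l * \<tau>" "of_nat l * \<alpha>" \<beta>] \<tau> l0
    by (simp add: power_int_mult_distrib mult_ac)
  have t3: "?L b =
        ?R (\<sigma> b)"
    if b: "b \<in> {1..<l}" for b
  proof -
    obtain u where u: "1 + int b * int (\<sigma> b) = int l * u"
      using \<sigma>d[OF b] by (elim dvdE)
    define w where "w = (\<tau> + of_nat (\<sigma> b)) / of_nat l"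
    have w: "Im w > 0" using \<tau> l0 by (simp add: w_def)
    have u': "of_int u * of_nat l = (1 + of_nat b * of_nat (\<sigma> b) :: complex)"
      using arg_cong[OF u, of "of_int :: int \<Rightarrow> complex"] by (simp add: mult.commute)
    have j: "of_int (int l) * w + of_int (- int (\<sigma> b)) = \<tau>"
      using l0 by (simp add: w_def)
    have bw: "(of_int (int b) * w + of_int (- u)) / (of_int (int l) * w + of_int (- int (\<sigma> b))) =
        (- 1 / \<tau> + of_nat b) / of_nat l"
    proof -
      have "of_nat l * (of_int (int b) * w + of_int (- u)) = of_nat b * \<tau> - 1"
        using l0 u' by (simp add: w_def field_simps)
      hence x: "of_int (int b) * w + of_int (- u) = (of_nat b * \<tau> - 1) / of_nat l"
        using l0 by (simp add: field_simps)
      show ?thesis unfolding j x using l0 \<tau>0 by (simp add: field_simps)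
    qed
    \<comment> \<open>The matrix (b, -u; l, -\<open>\<sigma> b\<close>) has determinant l u - b
      \<open>\<sigma> b\<close> = 1 by the choice of u.\<close>
    have e1: "f (of_nat l * \<alpha>) (\<beta> - of_nat b * \<alpha>) ((of_int (int b) * w + of_int (- u)) / (of_int (int l) * w + of_int (- int (\<sigma> b)))) =
      (of_int (int l) * w + of_int (- int (\<sigma> b))) powi k *
        f (of_int (int b) * (of_nat l * \<alpha>) + of_int (int l) * (\<beta> - of_nat b * \<alpha>))
          (of_int (- u) * (of_nat l * \<alpha>) + of_int (- int (\<sigma> b)) * (\<beta> - of_nat b * \<alpha>)) w"
      using u w by (intro f[unfolded jmod_def, rule_format]) (auto simp: algebra_simps)
    have e2: "of_int (int b) * (of_nat l * \<alpha>) + of_int (int l) * (\<beta> - of_nat b * \<alpha>) = of_nat l * \<beta>"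
      by (simp add: algebra_simps)
    have e3: "of_int (- u) * (of_nat l * \<alpha>) + of_int (- int (\<sigma> b)) * (\<beta> - of_nat b * \<alpha>) = - \<alpha> - of_nat (\<sigma> b) * \<beta>"
    proof -
      have "of_int (- u) * (of_nat l * \<alpha>) = - ((of_int u * of_nat l) * \<alpha>)" by simp
      thus ?thesis unfolding u' by (simp add: algebra_simps)
    qed
    show ?thesis using e1 unfolding bw e2 e3 unfolding j unfolding w_def .
  qed
  have "hecke l k f \<alpha> \<beta> (- 1 / \<tau>) = of_nat l powi k * f \<alpha> (of_nat l * \<beta>) (of_nat l * (- 1 / \<tau>)) +
     (f (of_nat l * \<alpha>) \<beta> ((- 1 / \<tau>) / of_nat l) +
      (\<Sum>b\<in>{1..<l}. ?L b))"
    unfolding hecke_def split by simp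
  also have "(\<Sum>b\<in>{1..<l}. ?L b) =
     (\<Sum>b\<in>{1..<l}. ?R (\<sigma> b))"
    using t3 by (intro sum.cong) auto
  also have "\<dots> = (\<Sum>b\<in>{1..<l}. ?R b)"
    by (rule sum.reindex_bij_betw[OF \<sigma>])
  finally show "hecke l k f \<alpha> \<beta> (- 1 / \<tau>) = \<tau> powi k * hecke l k f \<beta> (- \<alpha>) \<tau>"
    unfolding t1 t2 unfolding hecke_def split by (simp add: distrib_left sum_distrib_left)
qed

section \<open>Restriction to torsion points\<close>

lemma e2pi_surj_upper_half_plane:
  assumes "w \<noteq> 0" "L > 0"
  obtains \<tau> where "e2pi (\<tau> / of_nat L) = w" "Re \<tau> \<ge> 0" "Im \<tau> = - (real L * ln (norm w) / (2 * pi))"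
proof -
  \<comment> \<open>\<open>Arg2pi\<close> has values in [0, 2 pi), so Re \<tau> is nonnegative and
    the later shift into the strip |Re| \<le> 1/2 is by a natural number.\<close>
  define \<tau> where "\<tau> = Complex (real L * Arg2pi w / (2 * pi)) (- (real L * ln (norm w) / (2 * pi)))"
  have "2 * of_real pi * \<i> * (\<tau> / of_nat L) = of_real (ln (norm w)) + \<i> * of_real (Arg2pi w)"
    using assms by (simp add: \<tau>_def complex_eq_iff)
  hence "e2pi (\<tau> / of_nat L) = of_real (norm w) * exp (\<i> * of_real (Arg2pi w))"
    using assms by (simp add: e2pi_def exp_add exp_of_real)
  also have "\<dots> = w" by (rule Arg2pi_eq[symmetric])
  finally show ?thesis
    using that[of \<tau>] Arg2pi[of w] by (simp add: \<tau>_def)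
qed

lemma powser_eq_0_imp_coeffs_0:
  fixes a :: "nat \<Rightarrow> complex"
  assumes "r > 0" "\<And>w. norm w < r \<Longrightarrow> (\<lambda>n. a n * w ^ n) sums 0"
  shows "a m = 0"
proof (cases "m = 0")
  case True
  thus ?thesis using assms(2)[of 0] assms(1) by simp
next
  case False
  show ?thesis
  proof (rule ccontr)
    assume "a m \<noteq> 0"
    show False
    proof (rule powser_0_nonzero[of r 0 a "\<lambda>_. 0" m])
      fix s :: real assume "0 < s" and s: "\<And>z. z \<in> cball (0::complex) s - {0} \<Longrightarrow> (0::complex) \<noteq> 0"
      show False using s[of "of_real s"] \<open>0 < s\<close> by simp
    qed (use assms False \<open>a m \<noteq> 0\<close> in auto)
  qed
qed

text \<open>Let \<open>C\<close> be the maximum of the quotients \<open>f u / q\<^sup>E\<close> on the horocycle \<open>Im \<tau> = 1/2\<close>. The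
  inversion maps a point of this horocycle with \<open>\<bar>Re \<tau>\<bar> \<le> 1/2\<close> to height at least \<open>1\<close>, where the
  maximum principle saves a factor \<open>exp (- \<pi> E / L)\<close>; for large \<open>E\<close> this beats the automorphy factor.\<close>

lemma vector_modular_vanishing:
  fixes f :: "'u \<Rightarrow> complex \<Rightarrow> complex" and b :: "'u \<Rightarrow> nat \<Rightarrow> complex"
  assumes fin: "finite U" and L: "L > 0"
    and series: "\<And>u \<tau>. u \<in> U \<Longrightarrow> Im \<tau> > 0 \<Longrightarrow> (\<lambda>j. b u j * e2pi (\<tau> / of_nat L) ^ j) sums f u \<tau>"
    and T: "\<And>u. u \<in> U \<Longrightarrow> \<exists>v\<in>U. \<forall>\<tau>. Im \<tau> > 0 \<longrightarrow> f u (\<tau> + 1) = f v \<tau>"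
    and S: "\<And>u. u \<in> U \<Longrightarrow> \<exists>v\<in>U. \<forall>\<tau>. Im \<tau> > 0 \<longrightarrow> f u (- 1 / \<tau>) = \<tau> powi k * f v \<tau>"
    and vanish: "\<And>u j. u \<in> U \<Longrightarrow> j < (nat \<bar>k\<bar> + 1) * L \<Longrightarrow> b u j = 0"
    and u: "u \<in> U"
  shows "b u j = 0"
proof -
  \<comment> \<open>For Im \<tau> = 1/2 the modulus of e(\<tau> / L)^E is exp (- pi (|k| + 1)),
    which is less than (1/2)^(|k| + 1), while the automorphy factor costs at most 2^|k|.\<close>
  define E where "E = (nat \<bar>k\<bar> + 1) * L"
  \<comment> \<open>The modulus of e(\<tau> / L) on the line Im \<tau> = 1/2.\<close>
  define \<rho> where "\<rho> = exp (- pi / real L)"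
  have \<rho>: "0 < \<rho>" "\<rho> < 1" using L by (auto simp: \<rho>_def)
  define h where "h = (\<lambda>u w. \<Sum>j. b u (j + E) * w ^ j)"
  have h: "(\<lambda>j. b u (j + E) * w ^ j) sums h u w" if u: "u \<in> U" and w: "norm w < 1" for u w
  proof (cases "w = 0")
    case True
    thus ?thesis by (simp add: h_def)
  next
    case False
    obtain \<tau> where \<tau>: "e2pi (\<tau> / of_nat L) = w" "Im \<tau> = - (real L * ln (norm w) / (2 * pi))"
      using e2pi_surj_upper_half_plane[OF False L] by metis
    have "Im \<tau> > 0" using w False L by (simp add: \<tau>(2) mult_less_0_iff divide_less_0_iff)
    hence "summable (\<lambda>j. b u j * w ^ j)" using series[OF u, of \<tau>] \<tau>(1) sums_summable by metis
    hence "summable (\<lambda>j. b u (j + E) * w ^ (j + E))"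
      by (subst summable_iff_shift[of "\<lambda>j. b u j * w ^ j"])
    hence "summable (\<lambda>j. inverse (w ^ E) * (b u (j + E) * w ^ (j + E)))" by (rule summable_mult)
    moreover have "inverse (w ^ E) * (b u (j + E) * w ^ (j + E)) = b u (j + E) * w ^ j" for j
      using False by (simp add: power_add)
    ultimately have "summable (\<lambda>j. b u (j + E) * w ^ j)" by simp
    thus ?thesis unfolding h_def by (rule summable_sums)
  qed
  have fh: "f u \<tau> = e2pi (\<tau> / of_nat L) ^ E * h u (e2pi (\<tau> / of_nat L))" if u: "u \<in> U" and \<tau>: "Im \<tau> > 0" for u \<tau>
  proof -
    let ?w = "e2pi (\<tau> / of_nat L)"
    have w: "norm ?w < 1" using \<tau> L by (simp add: norm_e2pi)
    have "(\<lambda>j. ?w ^ E * (b u (j + E) * ?w ^ j)) sums (?w ^ E * h u ?w)"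
      by (intro sums_mult h[OF u w])
    hence "(\<lambda>j. b u (j + E) * ?w ^ (j + E)) sums (?w ^ E * h u ?w)"
      by (simp add: power_add mult_ac)
    moreover have "(\<lambda>j. b u (j + E) * ?w ^ (j + E)) sums f u \<tau>"
      using series[OF u \<tau>] vanish[OF u] by (subst sums_zero_iff_shift) (auto simp: E_def)
    ultimately show ?thesis using sums_unique2 by blast
  qed
  have hol: "h u holomorphic_on ball 0 1" if "u \<in> U" for u
    using h[OF that] by (intro power_series_holomorphic[where a = "\<lambda>j. b u (j + E)"]) auto
  have cont: "continuous_on (cball 0 \<rho>) (h u)" if "u \<in> U" for u
    using holomorphic_on_imp_continuous_on[OF hol[OF that]] by (rule continuous_on_subset) (use \<rho> in auto)
  have "\<exists>z. norm z = \<rho> \<and> (\<forall>w. norm w = \<rho> \<longrightarrow> norm (h u w) \<le> norm (h u z))" if "u \<in> U" for u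
  proof -
    have "continuous_on (sphere 0 \<rho>) (\<lambda>w. norm (h u w))"
      by (intro continuous_on_norm continuous_on_subset[OF cont[OF that]]) auto
    moreover have "of_real \<rho> \<in> sphere (0::complex) \<rho>" using \<rho> by simp
    ultimately show ?thesis
      using continuous_attains_sup[OF compact_sphere, of 0 \<rho> "\<lambda>w. norm (h u w)"] by fastforce
  qed
  then obtain z where z: "\<And>u. u \<in> U \<Longrightarrow> norm (z u) = \<rho>"
    and zmax: "\<And>u w. u \<in> U \<Longrightarrow> norm w = \<rho> \<Longrightarrow> norm (h u w) \<le> norm (h u (z u))"
    by metis
  define C where "C = Max ((\<lambda>u. norm (h u (z u))) ` U)"
  have "C \<in> (\<lambda>u. norm (h u (z u))) ` U"
    unfolding C_def using fin u by (intro Max_in) auto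
  then obtain v where v: "v \<in> U" "norm (h v (z v)) = C" by auto
  have C0: "C \<ge> 0" using v(2) by auto
  have bound: "norm (h u w) \<le> C" if u: "u \<in> U" and w: "norm w \<le> \<rho>" for u w
  proof (rule maximum_modulus_frontier[of "h u" "cball 0 \<rho>"])
    show "h u holomorphic_on interior (cball 0 \<rho>)"
      using \<rho> by (intro holomorphic_on_subset[OF hol[OF u]]) auto
    fix y assume "y \<in> frontier (cball (0::complex) \<rho>)"
    hence "norm y = \<rho>" using \<rho> by (simp add: frontier_cball)
    thus "norm (h u y) \<le> C"
      using zmax[OF u, of y] fin u unfolding C_def
      by (intro order.trans[OF _ Max_ge[of _ "norm (h u (z u))"]]) auto
  qed (use cont[OF u] w in auto)
  have Tn: "\<exists>v\<in>U. \<forall>\<tau>. Im \<tau> > 0 \<longrightarrow> f u (\<tau> + of_nat n) = f v \<tau>" if "u \<in> U" for u n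
  proof (induction n)
    case (Suc n)
    then obtain v where v: "v \<in> U" "\<And>\<tau>. Im \<tau> > 0 \<Longrightarrow> f u (\<tau> + of_nat n) = f v \<tau>" by blast
    obtain v' where v': "v' \<in> U" "\<And>\<tau>. Im \<tau> > 0 \<Longrightarrow> f v (\<tau> + 1) = f v' \<tau>" using T[OF v(1)] by blast
    have "f u (\<tau> + of_nat (Suc n)) = f v' \<tau>" if "Im \<tau> > 0" for \<tau>
      using v(2)[of "\<tau> + 1"] v'(2)[of \<tau>] that by (simp add: add_ac)
    thus ?case using v'(1) by blast
  qed (use that in auto)
  have "C = 0"
  proof (rule ccontr)
    assume "C \<noteq> 0"
    have zv: "z v \<noteq> 0" using z[OF v(1)] \<rho> by auto
    obtain \<tau> where \<tau>: "e2pi (\<tau> / of_nat L) = z v" "Re \<tau> \<ge> 0" "Im \<tau> = - (real L * ln (norm (z v)) / (2 * pi))"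
      using e2pi_surj_upper_half_plane[OF zv L] by metis
    have Im\<tau>: "Im \<tau> = 1 / 2" using \<tau>(3) L unfolding z[OF v(1)] \<rho>_def by (simp add: field_simps)
    \<comment> \<open>Integer translations carry components to components, so the point where the
      maximum is attained may be moved to |Re| \<le> 1/2 at the price of changing the
      component.\<close>
    define n where "n = nat \<lfloor>Re \<tau> + 1 / 2\<rfloor>"
    define \<tau>0 where "\<tau>0 = \<tau> - of_nat n"
    have "real n = of_int \<lfloor>Re \<tau> + 1 / 2\<rfloor>" using \<tau>(2) by (simp add: n_def)
    hence "Re \<tau>0 = Re \<tau> - of_int \<lfloor>Re \<tau> + 1 / 2\<rfloor>" by (simp add: \<tau>0_def)
    hence Re0: "\<bar>Re \<tau>0\<bar> \<le> 1 / 2"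
      using floor_correct[of "Re \<tau> + 1 / 2"] unfolding abs_le_iff by linarith
    have Im0: "Im \<tau>0 = 1 / 2" by (simp add: \<tau>0_def Im\<tau>)
    have n0: "(norm \<tau>0)\<^sup>2 \<le> 1 / 2" "(norm \<tau>0)\<^sup>2 \<ge> 1 / 4"
      using power_mono[OF Re0, of 2] unfolding cmod_power2 Im0 by (simp_all add: power_divide)
    have \<tau>0: "\<tau>0 \<noteq> 0" using Im0 by auto
    \<comment> \<open>Since 1/4 \<le> |\<tau>0|^2 \<le> 1/2 and Im \<tau>0 = 1/2, the inverted point
      has height at least 1 and modulus between 1 and 2.\<close>
    define \<tau>1 where "\<tau>1 = - 1 / \<tau>0"
    have \<tau>01: "\<tau>0 = - 1 / \<tau>1" by (simp add: \<tau>1_def)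
    have "Im \<tau>1 = Im \<tau>0 / (norm \<tau>0)\<^sup>2" by (simp add: \<tau>1_def Im_divide cmod_power2)
    hence Im1: "Im \<tau>1 \<ge> 1" using n0 \<tau>0 by (simp add: Im0 le_divide_eq)
    have n1: "1 \<le> norm \<tau>1" "norm \<tau>1 \<le> 2"
    proof -
      have "norm \<tau>0 \<le> 1" using n0(1) power2_le_imp_le[of "norm \<tau>0" 1] by simp
      moreover have "1 / 2 \<le> norm \<tau>0"
        using n0(2) by (intro power2_le_imp_le[of "1/2" "norm \<tau>0"]) (auto simp: power2_eq_square)
      ultimately show "1 \<le> norm \<tau>1" "norm \<tau>1 \<le> 2" using \<tau>0 by (auto simp: \<tau>1_def norm_divide field_simps)
    qed
    have powk: "norm (\<tau>1 powi k) \<le> 2 ^ nat \<bar>k\<bar>"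
    proof (cases "k \<ge> 0")
      case True
      thus ?thesis using n1 by (auto simp: power_int_def norm_power power_mono)
    next
      case False
      have "inverse (norm \<tau>1) ^ nat (- k) \<le> 1" using n1 by (intro power_le_one) (auto simp: inverse_le_1_iff)
      also have "1 \<le> (2::real) ^ nat \<bar>k\<bar>" by simp
      finally show ?thesis using False by (simp add: power_int_def norm_power norm_inverse)
    qed
    obtain v1 where v1: "v1 \<in> U" "f v \<tau> = f v1 \<tau>0"
    proof -
      obtain v' where v': "v' \<in> U" "\<And>t. Im t > 0 \<Longrightarrow> f v (t + of_nat n) = f v' t"
        using Tn[OF v(1)] by blast
      show ?thesis using that[OF v'(1)] v'(2)[of \<tau>0] Im0 by (simp add: \<tau>0_def)
    qed
    obtain v2 where v2: "v2 \<in> U" "f v1 \<tau>0 = \<tau>1 powi k * f v2 \<tau>1"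
      using S[OF v1(1)] Im1 unfolding \<tau>01 by force
    define w1 where "w1 = e2pi (\<tau>1 / of_nat L)"
    have w1: "norm w1 \<le> \<rho> ^ 2"
      using Im1 L by (simp add: w1_def norm_e2pi \<rho>_def exp_double[symmetric] divide_right_mono)
    have "\<rho> * \<rho> \<le> \<rho> * 1" using \<rho> by (intro mult_left_mono) auto
    hence w1': "norm w1 \<le> \<rho>" using w1 by (simp add: power2_eq_square)
    have "\<rho> ^ E * C = norm (f v \<tau>)"
      using fh[OF v(1), of \<tau>] Im\<tau> \<tau>(1) v(2) z[OF v(1)] by (simp add: norm_mult norm_power)
    also have "\<dots> = norm (\<tau>1 powi k) * (norm w1 ^ E * norm (h v2 w1))"
      using v1 v2 fh[OF v2(1), of \<tau>1] Im1 by (simp add: norm_mult norm_power w1_def)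
    also have "\<dots> \<le> 2 ^ nat \<bar>k\<bar> * ((\<rho> ^ 2) ^ E * C)"
      using bound[OF v2(1) w1'] w1 powk by (intro mult_mono power_mono) auto
    also have "\<dots> = \<rho> ^ E * C * (2 ^ nat \<bar>k\<bar> * \<rho> ^ E)"
      by (simp add: power_mult_distrib power2_eq_square)
    finally have "1 \<le> 2 ^ nat \<bar>k\<bar> * \<rho> ^ E"
      using \<open>C \<noteq> 0\<close> C0 \<rho> by (simp add: mult_le_cancel_left1)
    moreover have "\<rho> ^ E = exp (- pi) ^ (nat \<bar>k\<bar> + 1)"
    proof -
      have "\<rho> ^ L = exp (- pi)" using L by (simp add: \<rho>_def exp_of_nat_mult[symmetric])
      thus ?thesis unfolding E_def by (simp add: power_mult[symmetric] mult.commute[of _ L])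
        (metis mult.commute power_mult power_Suc power_add)
    qed
    moreover have "exp (- pi) < 1 / 2"
    proof -
      have "2 < exp pi" using exp_ge_add_one_self[of pi] pi_gt3 by linarith
      thus ?thesis by (simp add: exp_minus field_simps)
    qed
    hence "exp (- pi) ^ (nat \<bar>k\<bar> + 1) < (1 / 2) ^ (nat \<bar>k\<bar> + 1)"
      by (intro power_strict_mono) auto
    ultimately have "1 < 2 ^ nat \<bar>k\<bar> * (1 / 2 :: real) ^ (nat \<bar>k\<bar> + 1)"
      by (smt (verit) mult_left_mono mult_strict_left_mono zero_less_power)
    thus False by (simp add: power_one_over)
  qed
  have h0: "h u w = 0" if "norm w < \<rho>" for w
    using bound[OF u, of w] that \<open>C = 0\<close> by simp
  have "b u (j' + E) = 0" for j'
  proof (rule powser_eq_0_imp_coeffs_0[of \<rho> "\<lambda>j. b u (j + E)"])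
    fix w :: complex assume "norm w < \<rho>"
    thus "(\<lambda>j. b u (j + E) * w ^ j) sums 0" using h[OF u, of w] h0[of w] \<rho> by simp
  qed (use \<rho> in auto)
  from this[of "j - E"] show ?thesis
    using vanish[OF u, of j] by (cases "j < E") (auto simp: E_def)
qed

section \<open>Expansions at torsion points\<close>

lemma has_sum_fibers:
  fixes a :: "'i \<Rightarrow> 'a :: {real_normed_field, banach}"
  assumes "((\<lambda>i. a i * w ^ J i) has_sum S) I" "\<And>j. finite {i \<in> I. J i = j}"
  shows "((\<lambda>j. (\<Sum>i\<in>{i \<in> I. J i = j}. a i) * w ^ j) has_sum S) UNIV"
proof (rule has_sum_SigmaD)
  have "bij_betw snd (Sigma UNIV (\<lambda>j. {i \<in> I. J i = j})) I"
    by (rule bij_betw_byWitness[where f' = "\<lambda>i. (J i, i)"]) auto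
  from has_sum_reindex_bij_betw[OF this, of "\<lambda>i. a i * w ^ J i" S] assms(1)
  show "((\<lambda>x. a (snd x) * w ^ J (snd x)) has_sum S) (Sigma UNIV (\<lambda>j. {i \<in> I. J i = j}))"
    by simp
  fix j :: nat
  have "(\<Sum>i\<in>{i \<in> I. J i = j}. a i * w ^ J i) = (\<Sum>i\<in>{i \<in> I. J i = j}. a i) * w ^ j"
    unfolding sum_distrib_right by (intro sum.cong) auto
  thus "((\<lambda>i. a (snd (j, i)) * w ^ J (snd (j, i))) has_sum (\<Sum>i\<in>{i \<in> I. J i = j}. a i) * w ^ j) {i \<in> I. J i = j}"
    using assms(2) by (intro has_sum_finiteI) auto
qed

definition torsion_exp :: "nat \<Rightarrow> nat \<Rightarrow> int \<Rightarrow> int \<Rightarrow> nat \<Rightarrow> int \<Rightarrow> int \<Rightarrow> int" where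
  "torsion_exp N M a1 a2 n x y = int (N\<^sup>2) * int n + int M * (a1\<^sup>2 + a2\<^sup>2) + int N * (x * a1 + y * a2)"

definition jcone :: "nat \<Rightarrow> (nat \<times> int \<times> int) set" where
  "jcone M = {(n, x, y). x\<^sup>2 + y\<^sup>2 \<le> 4 * int M * int n}"

definition jfiber :: "nat \<Rightarrow> nat \<Rightarrow> int \<Rightarrow> int \<Rightarrow> nat \<Rightarrow> (nat \<times> int \<times> int) set" where
  "jfiber N M a1 a2 j = {(n, x, y). (n, x, y) \<in> jcone M \<and> torsion_exp N M a1 a2 n x y = int j}"

text \<open>At the torsion point \<open>\<alpha> = a / N\<close>, \<open>\<beta> = b / N\<close> the term \<open>(n, x, y)\<close> contributes
  \<open>exp (2 \<pi> \<i> (j \<tau> + s \<bullet> b) / N\<^sup>2)\<close>, where \<open>j\<close> is \<open>torsion_exp\<close> and \<open>s = N (x, y) + M a\<close>. Sorting by the class of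
  \<open>s\<close> modulo \<open>N\<^sup>2\<close> keeps the coefficients rational.\<close>

definition tcoeff_set :: "nat \<Rightarrow> nat \<Rightarrow> int \<Rightarrow> int \<Rightarrow> int \<Rightarrow> int \<Rightarrow> nat \<Rightarrow> (nat \<times> int \<times> int) set" where
  "tcoeff_set N M a1 a2 s1 s2 j = {(n, x, y). (n, x, y) \<in> jfiber N M a1 a2 j \<and>
     int (N\<^sup>2) dvd int N * x + int M * a1 - s1 \<and> int (N\<^sup>2) dvd int N * y + int M * a2 - s2}"

definition tcoeff ::
  "nat \<Rightarrow> nat \<Rightarrow> jcoeffs \<Rightarrow> int \<Rightarrow> int \<Rightarrow> int \<Rightarrow> int \<Rightarrow> nat \<Rightarrow> complex" where
  "tcoeff N M c a1 a2 s1 s2 j = (\<Sum>(n, x, y)\<in>tcoeff_set N M a1 a2 s1 s2 j. c n x y)"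

text \<open>Completing the square: 4 M times \<open>torsion_exp\<close> equals |N (x, y) + 2 M a|^2
  + N^2 (4 M n - x^2 - y^2), and the last term is nonnegative on the cone.\<close>

lemma torsion_exp_square_bound:
  assumes "(n, x, y) \<in> jcone M"
  shows "(int N * x + 2 * int M * a1)\<^sup>2 + (int N * y + 2 * int M * a2)\<^sup>2 \<le> 4 * int M * torsion_exp N M a1 a2 n x y"
proof -
  have "(int N)\<^sup>2 * (x\<^sup>2 + y\<^sup>2) \<le> (int N)\<^sup>2 * (4 * int M * int n)"
    using assms by (intro mult_left_mono) (auto simp: jcone_def)
  thus ?thesis by (simp add: torsion_exp_def power2_eq_square algebra_simps)
qed

lemma torsion_exp_nonneg:
  assumes "(n, x, y) \<in> jcone M"
  shows "torsion_exp N M a1 a2 n x y \<ge> 0"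
proof (cases "M = 0")
  case True
  hence "x = 0" "y = 0" using assms by (auto simp: jcone_def sum_power2_le_zero_iff)
  thus ?thesis using True by (simp add: torsion_exp_def)
next
  case False
  have "0 \<le> 4 * int M * torsion_exp N M a1 a2 n x y"
    using torsion_exp_square_bound[OF assms, of N a1 a2] by (smt (verit) zero_le_power2)
  thus ?thesis using False by (simp add: zero_le_mult_iff)
qed

lemma abs_le_square_bound:
  fixes z :: int
  assumes "z\<^sup>2 \<le> K"
  shows "\<bar>z\<bar> \<le> K"
proof -
  have "\<bar>z\<bar> \<le> \<bar>z\<bar> * \<bar>z\<bar>"
    using mult_left_mono[of 1 "\<bar>z\<bar>" "\<bar>z\<bar>"] by (cases "z = 0") auto
  also have "\<dots> = z\<^sup>2" by (simp add: power2_eq_square)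
  finally show ?thesis using assms by simp
qed

text \<open>The completed square confines (x, y) to a box depending on j, and n is then determined
  by the value of \<open>torsion_exp\<close>.\<close>

lemma finite_jfiber:
  assumes N: "N > 0"
  shows "finite (jfiber N M a1 a2 j)"
proof -
  define K where "K = 4 * int M * int j + 2 * int M * (\<bar>a1\<bar> + \<bar>a2\<bar>)"
  have "jfiber N M a1 a2 j \<subseteq> (\<lambda>(x, y). (nat ((int j - int M * (a1\<^sup>2 + a2\<^sup>2) - int N * (x * a1 + y * a2)) div int (N\<^sup>2)), x, y)) ` ({-K..K} \<times> {-K..K})"
  proof (rule subsetI, clarify)
    fix n x y assume "(n, x, y) \<in> jfiber N M a1 a2 j"
    hence c: "(n, x, y) \<in> jcone M" and e: "torsion_exp N M a1 a2 n x y = int j"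
      by (auto simp: jfiber_def)
    have b: "(int N * x + 2 * int M * a1)\<^sup>2 + (int N * y + 2 * int M * a2)\<^sup>2 \<le> 4 * int M * int j"
      using torsion_exp_square_bound[OF c, of N a1 a2] e by simp
    have aux: "\<bar>u\<bar> \<le> K" if u: "(int N * u + 2 * int M * a)\<^sup>2 \<le> 4 * int M * int j" and a: "\<bar>a\<bar> \<le> \<bar>a1\<bar> + \<bar>a2\<bar>" for u a
    proof -
      have "\<bar>u\<bar> \<le> int N * \<bar>u\<bar>" using N by (simp add: mult_le_cancel_right1)
      also have "\<dots> = \<bar>int N * u\<bar>" by (simp add: abs_mult)
      also have "\<dots> \<le> \<bar>int N * u + 2 * int M * a\<bar> + \<bar>2 * int M * a\<bar>" by linarith
      also have "\<dots> \<le> 4 * int M * int j + 2 * int M * \<bar>a\<bar>"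
        using abs_le_square_bound[OF u] by (simp add: abs_mult)
      also have "\<dots> \<le> K" unfolding K_def using a by (intro add_left_mono mult_left_mono) auto
      finally show ?thesis .
    qed
    have "\<bar>x\<bar> \<le> K" using b by (intro aux[of x a1]) (auto intro: order.trans[rotated])
    moreover have "\<bar>y\<bar> \<le> K" using b by (intro aux[of y a2]) (auto intro: order.trans[rotated])
    moreover have "n = nat ((int j - int M * (a1\<^sup>2 + a2\<^sup>2) - int N * (x * a1 + y * a2)) div int (N\<^sup>2))"
      using e[symmetric] N by (simp add: torsion_exp_def)
    ultimately show "(n, x, y) \<in> (\<lambda>(x, y). (nat ((int j - int M * (a1\<^sup>2 + a2\<^sup>2) - int N * (x * a1 + y * a2)) div int (N\<^sup>2)), x, y)) ` ({-K..K} \<times> {-K..K})"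
      by (intro image_eqI[of _ _ "(x, y)"]) auto
  qed
  thus ?thesis by (rule finite_subset) auto
qed

lemma finite_tcoeff_set: "N > 0 \<Longrightarrow> finite (tcoeff_set N M a1 a2 s1 s2 j)"
  by (rule finite_subset[OF _ finite_jfiber[of N M a1 a2 j]]) (auto simp: tcoeff_set_def)

lemma e2pi_cong_mod:
  assumes "int L dvd s - s'" "L > 0"
  shows "e2pi (of_int s * of_int b / of_nat L) = e2pi (of_int s' * of_int b / of_nat L)"
proof -
  obtain q where "s - s' = int L * q" using assms(1) by (elim dvdE)
  hence "s = s' + int L * q" by simp
  hence "of_int s * of_int b / of_nat L = of_int s' * of_int b / of_nat L + (of_int (q * b) :: complex)"
    using assms(2) by (simp add: field_simps)
  thus ?thesis by (simp only: e2pi_add_of_int)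
qed

text \<open>Sorting the terms by degree and by the class of s modulo N^2 exhibits each coefficient
  of the q-expansion in e(\<tau> / N^2) as a finite Fourier transform in b of the numbers
  \<open>tcoeff\<close>. Roots of unity occur in the characters only.\<close>

lemma jsum_torsion_series:
  assumes f: "jsum M c f" and c: "jsupp M c" and N: "N > 0" and \<tau>: "Im \<tau> > 0"
  shows "(\<lambda>j. (\<Sum>s1<N\<^sup>2. \<Sum>s2<N\<^sup>2. tcoeff N M c a1 a2 (int s1) (int s2) j *
            e2pi (of_nat s1 * of_int b1 / of_nat (N\<^sup>2)) * e2pi (of_nat s2 * of_int b2 / of_nat (N\<^sup>2))) *
          e2pi (\<tau> / of_nat (N\<^sup>2)) ^ j) sums f (gi a1 a2 / of_nat N) (gi b1 b2 / of_nat N) \<tau>"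
proof -
  define L where "L = N\<^sup>2"
  have L: "L > 0" using N by (simp add: L_def)
  define ch where "ch = (\<lambda>x y. e2pi (of_int (int N * x + int M * a1) * of_int b1 / of_nat L) *
      e2pi (of_int (int N * y + int M * a2) * of_int b2 / of_nat L))"
  define w where "w = e2pi (\<tau> / of_nat L)"
  let ?F = "f (gi a1 a2 / of_nat N) (gi b1 b2 / of_nat N) \<tau>"
  let ?ex = "\<lambda>i. case i of (n, x, y) \<Rightarrow> nat (torsion_exp N M a1 a2 n x y)"
  let ?cc = "\<lambda>i. case i of (n, x, y) \<Rightarrow> c n x y * ch x y"
  have trm: "e2pi (jexp M n x y (gi a1 a2 / of_nat N) (gi b1 b2 / of_nat N) \<tau>) =
        ch x y * w ^ nat (torsion_exp N M a1 a2 n x y)" if "(n, x, y) \<in> jcone M" for n x y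
  proof -
    have e: "of_nat (nat (torsion_exp N M a1 a2 n x y)) = (of_int (torsion_exp N M a1 a2 n x y) :: complex)"
      using torsion_exp_nonneg[OF that] by simp
    have "jexp M n x y (gi a1 a2 / of_nat N) (gi b1 b2 / of_nat N) \<tau> =
       of_int (int N * x + int M * a1) * of_int b1 / of_nat L + of_int (int N * y + int M * a2) * of_int b2 / of_nat L +
       of_int (torsion_exp N M a1 a2 n x y) * (\<tau> / of_nat L)"
      using N unfolding jexp_def inner_mult_simps inner_gi torsion_exp_def L_def
      by (simp add: field_simps power2_eq_square)
    thus ?thesis unfolding w_def ch_def e2pi_power e by (simp only: e2pi_add)
  qed
  have c0: "c n x y = 0" if "(n, x, y) \<notin> jcone M" for n x y
    using c that by (auto simp: jsupp_def jcone_def)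
  have "((\<lambda>(n, x, y). c n x y * e2pi (jexp M n x y (gi a1 a2 / of_nat N) (gi b1 b2 / of_nat N) \<tau>))
      has_sum ?F) UNIV"
    by (rule jsumD[OF f \<tau>])
  also have "?this \<longleftrightarrow> ((\<lambda>i. (?cc i) * w ^ (?ex i))
      has_sum ?F) (jcone M)"
    by (intro has_sum_cong_neutral) (auto simp: trm c0)
  finally have "((\<lambda>j. (\<Sum>i\<in>{i \<in> jcone M. (?ex i) = j}.
      ?cc i) * w ^ j)
     has_sum ?F) UNIV"
  proof (rule has_sum_fibers)
    fix j
    have "{i \<in> jcone M. (?ex i) = j} = jfiber N M a1 a2 j"
      using torsion_exp_nonneg by (force simp: jfiber_def)
    thus "finite {i \<in> jcone M. (?ex i) = j}"
      using finite_jfiber[OF N] by simp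
  qed
  moreover have "(\<Sum>i\<in>{i \<in> jcone M. (?ex i) = j}.
      ?cc i) =
      (\<Sum>s1<L. \<Sum>s2<L. tcoeff N M c a1 a2 (int s1) (int s2) j *
            e2pi (of_nat s1 * of_int b1 / of_nat L) * e2pi (of_nat s2 * of_int b2 / of_nat L))" for j
  proof -
    define key where "key = (\<lambda>(n::nat, x, y). (nat ((int N * x + int M * a1) mod int L), nat ((int N * y + int M * a2) mod int L)))"
    have e: "{i \<in> jcone M. (?ex i) = j} = jfiber N M a1 a2 j"
      using torsion_exp_nonneg by (force simp: jfiber_def)
    have "(\<Sum>i\<in>jfiber N M a1 a2 j. ?cc i) =
       (\<Sum>s\<in>{..<L} \<times> {..<L}. \<Sum>i\<in>{i \<in> jfiber N M a1 a2 j. key i = s}. ?cc i)"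
      using L finite_jfiber[OF N] by (intro sum.group[symmetric]) (auto simp: key_def nat_less_iff)
    also have "\<dots> = (\<Sum>s\<in>{..<L} \<times> {..<L}. tcoeff N M c a1 a2 (int (fst s)) (int (snd s)) j *
         e2pi (of_nat (fst s) * of_int b1 / of_nat L) * e2pi (of_nat (snd s) * of_int b2 / of_nat L))"
    proof (intro sum.cong refl)
      fix s assume "s \<in> {..<L} \<times> {..<L}"
      then obtain s1 s2 where s: "s = (s1, s2)" "s1 < L" "s2 < L" by auto
      have key_iff: "nat (t mod int L) = u \<longleftrightarrow> int L dvd t - int u" if "u < L" for t u
      proof -
        have "nat (t mod int L) = u \<longleftrightarrow> t mod int L = int u mod int L"
          using L that by (auto simp: nat_eq_iff)
        thus ?thesis by (simp add: mod_eq_dvd_iff)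
      qed
      have set: "{i \<in> jfiber N M a1 a2 j. key i = s} = tcoeff_set N M a1 a2 (int s1) (int s2) j"
        using s unfolding tcoeff_set_def L_def[symmetric] by (auto simp: key_def key_iff)
      have "(\<Sum>i\<in>tcoeff_set N M a1 a2 (int s1) (int s2) j. ?cc i) =
            (\<Sum>i\<in>tcoeff_set N M a1 a2 (int s1) (int s2) j. (case i of (n, x, y) \<Rightarrow> c n x y) *
              (e2pi (of_nat s1 * of_int b1 / of_nat L) * e2pi (of_nat s2 * of_int b2 / of_nat L)))"
      proof (intro sum.cong refl, clarify)
        fix n x y assume i: "(n, x, y) \<in> tcoeff_set N M a1 a2 (int s1) (int s2) j"
        have "ch x y = e2pi (of_int (int s1) * of_int b1 / of_nat L) * e2pi (of_int (int s2) * of_int b2 / of_nat L)"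
          unfolding ch_def using i L
          by (intro arg_cong2[of _ _ _ _ "(*)"] e2pi_cong_mod) (auto simp: tcoeff_set_def L_def)
        thus "c n x y * ch x y = c n x y * (e2pi (of_nat s1 * of_int b1 / of_nat L) * e2pi (of_nat s2 * of_int b2 / of_nat L))"
          by simp
      qed
      also have "\<dots> = tcoeff N M c a1 a2 (int s1) (int s2) j *
              (e2pi (of_nat s1 * of_int b1 / of_nat L) * e2pi (of_nat s2 * of_int b2 / of_nat L))"
        by (simp add: tcoeff_def sum_distrib_right)
      finally show "(\<Sum>i\<in>{i \<in> jfiber N M a1 a2 j. key i = s}. ?cc i) =
         tcoeff N M c a1 a2 (int (fst s)) (int (snd s)) j *
         e2pi (of_nat (fst s) * of_int b1 / of_nat L) * e2pi (of_nat (snd s) * of_int b2 / of_nat L)"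
        unfolding set by (simp add: s)
    qed
    also have "\<dots> = (\<Sum>s1<L. \<Sum>s2<L. tcoeff N M c a1 a2 (int s1) (int s2) j *
            e2pi (of_nat s1 * of_int b1 / of_nat L) * e2pi (of_nat s2 * of_int b2 / of_nat L))"
      by (simp add: sum.cartesian_product case_prod_unfold)
    finally show ?thesis unfolding e .
  qed
  ultimately show ?thesis unfolding w_def L_def by (intro has_sum_imp_sums) simp
qed

text \<open>Changing a by N^2 u moves a / N by N u, and the cocycle of such a translation is
  \<open>e2pi\<close> of an integer multiple of M. Reduction modulo N alone would leave roots of
  unity depending on M; modulo N^2 the law is the same for every index.\<close>

lemma jsum_torsion_periodic:
  assumes f: "jsum M c f" "jinv k f" and N: "N > 0" and \<tau>: "Im \<tau> > 0"
  shows "f (gi a1 a2 / of_nat N) (gi b1 b2 / of_nat N) \<tau> =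
    f (gi (a1 mod int (N\<^sup>2)) (a2 mod int (N\<^sup>2)) / of_nat N) (gi (b1 mod int (N\<^sup>2)) (b2 mod int (N\<^sup>2)) / of_nat N) \<tau>"
proof -
  have red: "gi x y / of_nat N = gi (x mod int (N\<^sup>2)) (y mod int (N\<^sup>2)) / of_nat N +
     gi (int N * (x div int (N\<^sup>2))) (int N * (y div int (N\<^sup>2)))" for x y
  proof -
    have "real_of_int x = of_int (x mod int (N\<^sup>2)) + of_int (int (N\<^sup>2)) * of_int (x div int (N\<^sup>2))" for x
      by (simp only: of_int_add[symmetric] of_int_mult[symmetric] mod_mult_div_eq)
    from this[of x] this[of y] show ?thesis
      using N by (simp add: complex_eq_iff field_simps power2_eq_square)
  qed
  have one: "e2pi (of_real (of_nat M * ((gi x y / of_nat N) \<bullet> gi (int N * u) (int N * v)))) = 1"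
       "e2pi (- of_real (of_nat M * (gi (int N * u) (int N * v) \<bullet> (gi x y / of_nat N)))) = 1" for x y u v
  proof -
    have "of_nat M * ((gi x y / of_nat N) \<bullet> gi (int N * u) (int N * v)) = of_int (int M * (x * u + y * v))"
      using N unfolding inner_mult_simps inner_gi by (simp add: field_simps)
    hence *: "of_real (of_nat M * ((gi x y / of_nat N) \<bullet> gi (int N * u) (int N * v))) = (of_int (int M * (x * u + y * v)) :: complex)"
      by (simp only: of_real_of_int_eq)
    show "e2pi (of_real (of_nat M * ((gi x y / of_nat N) \<bullet> gi (int N * u) (int N * v)))) = 1"
      unfolding * by (rule e2pi_of_int)
    show "e2pi (- of_real (of_nat M * (gi (int N * u) (int N * v) \<bullet> (gi x y / of_nat N)))) = 1"
      unfolding inner_commute[of "gi (int N * u) (int N * v)"] * e2pi_minus e2pi_of_int by simp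
  qed
  show ?thesis
    unfolding red[of a1 a2] red[of b1 b2]
    by (subst jsum_translate_right[OF f(1) \<tau>], subst jsum_translate_left[OF f \<tau>])
       (simp only: red[of a1 a2, symmetric] one mult_1)
qed

text \<open>The components (a, b) modulo N^2 of the linear combination are carried to (a, a + b) by
  \<tau> + 1 and to (b, -a) by the inversion, so the Sturm bound applies. The indices
  \<open>M r\<close> may vary with r: this is what allows Hecke images for different primes to be
  compared.\<close>

lemma torsion_relation_extends:
  fixes x :: "'r \<Rightarrow> complex"
  assumes R: "finite R" and N: "N > 0"
    and f: "\<And>r. r \<in> R \<Longrightarrow> jsum (M r) (c r) (f r)" "\<And>r. r \<in> R \<Longrightarrow> jsupp (M r) (c r)" "\<And>r. r \<in> R \<Longrightarrow> jinv k (f r)"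
    and rel: "\<And>a1 a2 s1 s2 j. a1 < N\<^sup>2 \<Longrightarrow> a2 < N\<^sup>2 \<Longrightarrow> s1 < N\<^sup>2 \<Longrightarrow> s2 < N\<^sup>2 \<Longrightarrow> j < (nat \<bar>k\<bar> + 1) * N\<^sup>2 \<Longrightarrow>
       (\<Sum>r\<in>R. x r * tcoeff N (M r) (c r) (int a1) (int a2) (int s1) (int s2) j) = 0"
    and a: "a1 < N\<^sup>2" "a2 < N\<^sup>2" "s1 < N\<^sup>2" "s2 < N\<^sup>2"
  shows "(\<Sum>r\<in>R. x r * tcoeff N (M r) (c r) (int a1) (int a2) (int s1) (int s2) j) = 0"
proof -
  let ?g = "\<lambda>a b. gi (int a) (int b) / of_nat N"
  define L where "L = N\<^sup>2"
  have L: "L > 0" using N by (simp add: L_def)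
  define ch where "ch = (\<lambda>s b. e2pi (of_nat s * of_nat b / of_nat L))"
  define t where "t = (\<lambda>a1 a2 s1 s2 j. \<Sum>r\<in>R. x r * tcoeff N (M r) (c r) (int a1) (int a2) (int s1) (int s2) j)"
  define F where "F = (\<lambda>(a1, a2, b1, b2) \<tau>. \<Sum>r\<in>R. x r * f r (?g a1 a2) (?g b1 b2) \<tau>)"
  define B where "B = (\<lambda>(a1, a2, b1, b2) j. \<Sum>s1<L. \<Sum>s2<L. t a1 a2 s1 s2 j * ch s1 b1 * ch s2 b2)"
  define U where "U = {..<L} \<times> {..<L} \<times> {..<L} \<times> {..<L}"
  define md where "md = (\<lambda>z. nat (z mod int L))"
  have md: "md z < L" "int (md z) = z mod int L" for z using L by (auto simp: md_def nat_less_iff)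
  have per: "f r (gi a1 a2 / of_nat N) (gi b1 b2 / of_nat N) \<tau> =
      f r (?g (md a1) (md a2)) (?g (md b1) (md b2)) \<tau>"
    if "r \<in> R" "Im \<tau> > 0" for r a1 a2 b1 b2 \<tau>
    unfolding md(2) L_def by (rule jsum_torsion_periodic[OF f(1) f(3) N]) (use that in auto)
  have B0: "B u j = 0" if "u \<in> U" for u j
  proof (rule vector_modular_vanishing[of U L B F k u j])
    show "finite U" by (simp add: U_def)
    show "(\<lambda>j. B u j * e2pi (\<tau> / of_nat L) ^ j) sums F u \<tau>" if u: "u \<in> U" and \<tau>: "Im \<tau> > 0" for u \<tau>
    proof -
      obtain a1 a2 b1 b2 where u: "u = (a1, a2, b1, b2)" by (cases u)
      have "(\<lambda>j. \<Sum>r\<in>R. x r * ((\<Sum>s1<L. \<Sum>s2<L. tcoeff N (M r) (c r) (int a1) (int a2) (int s1) (int s2) j * ch s1 b1 * ch s2 b2) *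
               e2pi (\<tau> / of_nat L) ^ j)) sums F u \<tau>"
        unfolding F_def u prod.case
        using jsum_torsion_series[OF f(1,2) N \<tau>, of _ "int a1" "int a2" "int b1" "int b2"]
        by (intro sums_sum sums_mult) (simp_all add: ch_def L_def)
      moreover have "(\<Sum>r\<in>R. x r * ((\<Sum>s1<L. \<Sum>s2<L. tcoeff N (M r) (c r) (int a1) (int a2) (int s1) (int s2) j * ch s1 b1 * ch s2 b2) *
               e2pi (\<tau> / of_nat L) ^ j)) = B u j * e2pi (\<tau> / of_nat L) ^ j" for j
      proof -
        have "B u j = (\<Sum>s1<L. \<Sum>s2<L. \<Sum>r\<in>R. x r * (tcoeff N (M r) (c r) (int a1) (int a2) (int s1) (int s2) j * ch s1 b1 * ch s2 b2))"
          by (simp add: B_def u t_def sum_distrib_right mult.assoc)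
        also have "\<dots> = (\<Sum>s1<L. \<Sum>r\<in>R. \<Sum>s2<L. x r * (tcoeff N (M r) (c r) (int a1) (int a2) (int s1) (int s2) j * ch s1 b1 * ch s2 b2))"
          by (subst sum.swap) simp
        also have "\<dots> = (\<Sum>r\<in>R. \<Sum>s1<L. \<Sum>s2<L. x r * (tcoeff N (M r) (c r) (int a1) (int a2) (int s1) (int s2) j * ch s1 b1 * ch s2 b2))"
          by (rule sum.swap)
        finally show ?thesis by (simp add: sum_distrib_left sum_distrib_right mult.assoc)
      qed
      ultimately show ?thesis by simp
    qed
    show "\<exists>v\<in>U. \<forall>\<tau>. Im \<tau> > 0 \<longrightarrow> F u (\<tau> + 1) = F v \<tau>" if "u \<in> U" for u
    proof -
      obtain a1 a2 b1 b2 where u: "u = (a1, a2, b1, b2)" by (cases u)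
      have a: "md (int a1) = a1" "md (int a2) = a2" using that by (auto simp: u U_def md_def)
      have "F u (\<tau> + 1) = F (a1, a2, md (int a1 + int b1), md (int a2 + int b2)) \<tau>" if "Im \<tau> > 0" for \<tau>
        unfolding F_def u prod.case
      proof (intro sum.cong refl arg_cong[of _ _ "\<lambda>z. x _ * z"])
        fix r assume r: "r \<in> R"
        have "f r (?g a1 a2) (?g b1 b2) (\<tau> + 1) =
              f r (?g a1 a2) (gi (int a1 + int b1) (int a2 + int b2) / of_nat N) \<tau>"
          by (subst jsum_plus_1[OF f(1)[OF r] that]) (simp add: gi_add add_divide_distrib)
        also have "\<dots> = f r (?g a1 a2) (?g (md (int a1 + int b1)) (md (int a2 + int b2))) \<tau>"
          by (subst per[OF r that]) (simp only: a)
        finally show "f r (?g a1 a2) (?g b1 b2) (\<tau> + 1) =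
            f r (?g a1 a2) (?g (md (int a1 + int b1)) (md (int a2 + int b2))) \<tau>" .
      qed
      thus ?thesis using that md(1) by (intro bexI[of _ "(a1, a2, md (int a1 + int b1), md (int a2 + int b2))"]) (auto simp: u U_def)
    qed
    show "\<exists>v\<in>U. \<forall>\<tau>. Im \<tau> > 0 \<longrightarrow> F u (- 1 / \<tau>) = \<tau> powi k * F v \<tau>" if "u \<in> U" for u
    proof -
      obtain a1 a2 b1 b2 where u: "u = (a1, a2, b1, b2)" by (cases u)
      have b: "md (int b1) = b1" "md (int b2) = b2" using that by (auto simp: u U_def md_def)
      have "F u (- 1 / \<tau>) = \<tau> powi k * F (b1, b2, md (- int a1), md (- int a2)) \<tau>" if \<tau>: "Im \<tau> > 0" for \<tau>
        unfolding F_def u prod.case sum_distrib_left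
      proof (intro sum.cong refl)
        fix r assume r: "r \<in> R"
        have "f r (?g a1 a2) (?g b1 b2) (- 1 / \<tau>) =
              \<tau> powi k * f r (?g b1 b2) (gi (- int a1) (- int a2) / of_nat N) \<tau>"
          using f(3)[OF r] \<tau> unfolding jinv_def by (simp add: gi_minus)
        also have "f r (?g b1 b2) (gi (- int a1) (- int a2) / of_nat N) \<tau> =
            f r (?g b1 b2) (?g (md (- int a1)) (md (- int a2))) \<tau>"
          by (subst per[OF r \<tau>]) (simp only: b)
        finally show "x r * f r (?g a1 a2) (?g b1 b2) (- 1 / \<tau>) =
            \<tau> powi k * (x r * f r (?g b1 b2) (?g (md (- int a1)) (md (- int a2))) \<tau>)"
          by simp
      qed
      thus ?thesis using that md(1) by (intro bexI[of _ "(b1, b2, md (- int a1), md (- int a2))"]) (auto simp: u U_def)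
    qed
    show "B u j = 0" if "u \<in> U" "j < (nat \<bar>k\<bar> + 1) * L" for u j
      using that rel by (auto simp: U_def B_def t_def L_def intro!: sum.neutral)
  qed (use L that in auto)
  \<comment> \<open>Fourier inversion, in b1 here and in b2 below, returns from the values at
    torsion points to the relation between the rational coefficients.\<close>
  have "(\<Sum>s2<L. t a1 a2 s1 s2 j * ch s2 b2) = 0" if "b2 < L" for b2
  proof (rule character_sum_eq_0_imp[OF L, of "\<lambda>s1. \<Sum>s2<L. t a1 a2 s1 s2 j * ch s2 b2"])
    fix b1 assume "b1 < L"
    hence "B (a1, a2, b1, b2) j = 0" using that a by (intro B0) (auto simp: U_def L_def)
    thus "(\<Sum>s<L. (\<Sum>s2<L. t a1 a2 s s2 j * ch s2 b2) * e2pi (of_nat s * of_nat b1 / of_nat L)) = 0"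
      unfolding B_def prod.case ch_def sum_distrib_right by (simp add: mult_ac)
  qed (use a in \<open>simp add: L_def\<close>)
  hence "t a1 a2 s1 s2 j = 0"
    using a by (intro character_sum_eq_0_imp[OF L, of "\<lambda>s2. t a1 a2 s1 s2 j"]) (simp_all add: ch_def L_def)
  thus ?thesis by (simp add: t_def)
qed

section \<open>Congruences modulo a prime\<close>

definition Z_max :: "nat \<Rightarrow> complex set" where
  "Z_max p = (\<lambda>x. of_nat p * x) ` Z_loc p"

lemma Z_locI: "\<not> int p dvd b \<Longrightarrow> x * of_int b = of_int a \<Longrightarrow> x \<in> Z_loc p"
proof -
  assume b: "\<not> int p dvd b" and x: "x * of_int b = of_int a"
  hence "x = of_int a / of_int b" by (auto simp: eq_divide_eq)
  thus ?thesis using b by (auto simp: Z_loc_def)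
qed

lemma Z_locE:
  assumes "x \<in> Z_loc p"
  obtains a b where "\<not> int p dvd b" "x * of_int b = of_int a"
proof -
  from assms obtain a b where "\<not> int p dvd b" "x = of_int a / of_int b" by (auto simp: Z_loc_def)
  moreover from this have "x * of_int b = of_int a" by auto
  ultimately show ?thesis using that by blast
qed

lemma Z_loc_of_int [simp]: "prime p \<Longrightarrow> of_int a \<in> Z_loc p"
  using prime_gt_1_nat[of p] by (intro Z_locI[of p 1 _ a]) auto

lemma Z_loc_of_nat [simp]: "prime p \<Longrightarrow> of_nat a \<in> Z_loc p"
  using Z_loc_of_int[of p "int a"] by simp

lemma Z_loc_0 [simp]: "prime p \<Longrightarrow> 0 \<in> Z_loc p"
  using Z_loc_of_int[of p 0] by simp

lemma Z_loc_1 [simp]: "prime p \<Longrightarrow> 1 \<in> Z_loc p"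
  using Z_loc_of_int[of p 1] by simp

lemma not_dvd_mult_prime:
  "prime p \<Longrightarrow> \<not> int p dvd a \<Longrightarrow> \<not> int p dvd b \<Longrightarrow> \<not> int p dvd a * b"
  by (simp add: prime_dvd_mult_iff)

lemma Z_loc_mult [intro]:
  assumes p: "prime p" and "x \<in> Z_loc p" "y \<in> Z_loc p"
  shows "x * y \<in> Z_loc p"
proof -
  from assms obtain a b a' b' where "\<not> int p dvd b" "x * of_int b = of_int a"
    "\<not> int p dvd b'" "y * of_int b' = of_int a'" by (elim Z_locE) blast
  moreover from this have "(x * y) * of_int (b * b') = of_int (a * a')"
    by (metis (no_types, lifting) mult.assoc mult.left_commute of_int_mult)
  ultimately show ?thesis using not_dvd_mult_prime[OF p] Z_locI by blast
qed

lemma Z_loc_add [intro]: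
  assumes p: "prime p" and "x \<in> Z_loc p" "y \<in> Z_loc p"
  shows "x + y \<in> Z_loc p"
proof -
  from assms obtain a b a' b' where *: "\<not> int p dvd b" "x * of_int b = of_int a"
    "\<not> int p dvd b'" "y * of_int b' = of_int a'" by (elim Z_locE) blast
  have "(x + y) * of_int (b * b') = (x * of_int b) * of_int b' + (y * of_int b') * of_int b"
    by (simp add: algebra_simps)
  also have "\<dots> = of_int (a * b' + a' * b)" unfolding * by simp
  finally show ?thesis using * not_dvd_mult_prime[OF p] Z_locI by blast
qed

lemma Z_loc_minus [intro]: "prime p \<Longrightarrow> x \<in> Z_loc p \<Longrightarrow> - x \<in> Z_loc p"
  using Z_loc_mult[of p "-1" x] Z_loc_of_int[of p "-1"] by simp

lemma Z_loc_power [intro]: "prime p \<Longrightarrow> x \<in> Z_loc p \<Longrightarrow> x ^ n \<in> Z_loc p"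
  by (induction n) auto

lemma Z_loc_sum [intro]: "prime p \<Longrightarrow> (\<And>i. i \<in> A \<Longrightarrow> f i \<in> Z_loc p) \<Longrightarrow> (\<Sum>i\<in>A. f i) \<in> Z_loc p"
  by (induction A rule: infinite_finite_induct) auto

lemma Z_loc_Rats: "x \<in> Z_loc p \<Longrightarrow> x \<in> \<rat>"
  by (auto simp: Z_loc_def)

lemma Z_max_0 [simp]: "prime p \<Longrightarrow> 0 \<in> Z_max p"
  unfolding Z_max_def by (rule image_eqI[of _ _ 0]) auto

lemma Z_max_add [intro]: "prime p \<Longrightarrow> x \<in> Z_max p \<Longrightarrow> y \<in> Z_max p \<Longrightarrow> x + y \<in> Z_max p"
  by (auto simp: Z_max_def distrib_left[symmetric])

lemma Z_max_mult_left [intro]: "prime p \<Longrightarrow> x \<in> Z_loc p \<Longrightarrow> y \<in> Z_max p \<Longrightarrow> x * y \<in> Z_max p"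
  by (auto simp: Z_max_def mult.left_commute)

lemma Z_max_mult_right [intro]: "prime p \<Longrightarrow> x \<in> Z_max p \<Longrightarrow> y \<in> Z_loc p \<Longrightarrow> x * y \<in> Z_max p"
  using Z_max_mult_left[of p y x] by (simp add: mult.commute)

lemma Z_max_minus [intro]: "prime p \<Longrightarrow> x \<in> Z_max p \<Longrightarrow> - x \<in> Z_max p"
  using Z_max_mult_left[of p "-1" x] Z_loc_of_int[of p "-1"] by simp

lemma Z_max_minus_iff: "prime p \<Longrightarrow> - x \<in> Z_max p \<longleftrightarrow> x \<in> Z_max p"
  using Z_max_minus[of p x] Z_max_minus[of p "- x"] by auto

lemma Z_max_diff [intro]: "prime p \<Longrightarrow> x \<in> Z_max p \<Longrightarrow> y \<in> Z_max p \<Longrightarrow> x - y \<in> Z_max p"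
  using Z_max_add[of p x "- y"] by auto

lemma Z_max_sum [intro]: "prime p \<Longrightarrow> (\<And>i. i \<in> A \<Longrightarrow> f i \<in> Z_max p) \<Longrightarrow> (\<Sum>i\<in>A. f i) \<in> Z_max p"
  by (induction A rule: infinite_finite_induct) auto

lemma Z_max_add_cancel: "prime p \<Longrightarrow> x \<in> Z_max p \<Longrightarrow> x + y \<in> Z_max p \<longleftrightarrow> y \<in> Z_max p"
  using Z_max_diff[of p "x + y" x] by auto

lemma of_int_Z_max_iff: assumes p: "prime p" shows "of_int a \<in> Z_max p \<longleftrightarrow> int p dvd a"
proof
  assume "of_int a \<in> Z_max p"
  then obtain z where "z \<in> Z_loc p" "of_int a = of_nat p * z" by (auto simp: Z_max_def)
  then obtain u v where uv: "\<not> int p dvd v" "z * of_int v = of_int u" "of_int a = of_nat p * z"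
    by (elim Z_locE) blast
  have "(of_int (a * v) :: complex) = of_int (int p * u)"
    unfolding of_int_mult uv(3) using uv(2) by (simp add: mult.assoc)
  hence "a * v = int p * u" by (simp only: of_int_eq_iff)
  hence "int p dvd a * v" by simp
  thus "int p dvd a" using p uv(1) by (simp add: prime_dvd_mult_iff)
next
  assume "int p dvd a"
  then obtain q where "a = int p * q" by (elim dvdE)
  thus "of_int a \<in> Z_max p" using p by (auto simp: Z_max_def)
qed

lemma of_nat_Z_max_iff: "prime p \<Longrightarrow> of_nat a \<in> Z_max p \<longleftrightarrow> p dvd a"
  using of_int_Z_max_iff[of p "int a"] by simp

lemma Z_max_prime:
  assumes p: "prime p" and x: "x \<in> Z_loc p" and y: "y \<in> Z_loc p" and xy: "x * y \<in> Z_max p"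
  shows "x \<in> Z_max p \<or> y \<in> Z_max p"
proof -
  from x y obtain a b a' b' where *: "\<not> int p dvd b" "x * of_int b = of_int a"
    "\<not> int p dvd b'" "y * of_int b' = of_int a'" by (elim Z_locE) blast
  have unit: "z \<in> Z_max p" if "z * of_int v = of_int (int p * u)" "\<not> int p dvd v" for z u v
  proof -
    have "of_int v \<noteq> (0::complex)" using that(2) by auto
    hence "z = of_nat p * (of_int u / of_int v)" using that(1) by (simp add: field_simps)
    thus ?thesis using that(2) unfolding Z_max_def Z_loc_def by blast
  qed
  have "of_int (b * b') * (x * y) \<in> Z_max p"
    by (rule Z_max_mult_left[OF p Z_loc_of_int[OF p] xy])
  also have "of_int (b * b') * (x * y) = (x * of_int b) * (y * of_int b')" by (simp add: mult_ac)
  also have "\<dots> = of_int (a * a')" unfolding * by simp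
  finally have "int p dvd a * a'" by (simp only: of_int_Z_max_iff[OF p])
  hence "int p dvd a \<or> int p dvd a'" using p by (simp add: prime_dvd_mult_iff)
  thus ?thesis
  proof
    assume "int p dvd a"
    then obtain u where "a = int p * u" by (elim dvdE)
    thus ?thesis using unit[of x b u] * by simp
  next
    assume "int p dvd a'"
    then obtain u where "a' = int p * u" by (elim dvdE)
    thus ?thesis using unit[of y b' u] * by simp
  qed
qed

section \<open>Linear relations over the rationals and modulo p\<close>

lemma rational_relation:
  fixes v :: "'r \<Rightarrow> 'd \<Rightarrow> complex"
  assumes "finite D" "finite R" "card D < card R" "\<And>r d. r \<in> R \<Longrightarrow> d \<in> D \<Longrightarrow> v r d \<in> \<rat>"
  shows "\<exists>x. (\<forall>r\<in>R. x r \<in> \<rat>) \<and> (\<exists>r\<in>R. x r \<noteq> 0) \<and> (\<forall>d\<in>D. (\<Sum>r\<in>R. x r * v r d) = 0)"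
  using assms
proof (induction D arbitrary: R v rule: finite_induct)
  case empty
  hence "R \<noteq> {}" by auto
  thus ?case by (intro exI[of _ "\<lambda>_. 1"]) auto
next
  case (insert d D)
  show ?case
  proof (cases "\<forall>r\<in>R. v r d = 0")
    case True
    obtain x where "\<forall>r\<in>R. x r \<in> \<rat>" "\<exists>r\<in>R. x r \<noteq> 0" "\<forall>d\<in>D. (\<Sum>r\<in>R. x r * v r d) = 0"
      using insert.IH[of R v] insert.prems insert.hyps by auto
    thus ?thesis using True by (intro exI[of _ x]) auto
  next
    case False
    then obtain r0 where r0: "r0 \<in> R" "v r0 d \<noteq> 0" by auto
    define R' where "R' = R - {r0}"
    \<comment> \<open>The system left after eliminating the unknown r0 by means of equation
      d.\<close>
    define v' where "v' = (\<lambda>r e. v r e - v r d / v r0 d * v r0 e)"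
    have RR: "R = insert r0 R'" "r0 \<notin> R'" "finite R'" using r0 insert.prems(1) by (auto simp: R'_def)
    have "card D < card R'" using insert.prems(2) insert.hyps RR by simp
    moreover have "v' r e \<in> \<rat>" if "r \<in> R'" "e \<in> D" for r e
      unfolding v'_def using that RR(1) insert.prems(3)
      by (intro Rats_diff Rats_mult Rats_divide) auto
    ultimately obtain x where x: "\<forall>r\<in>R'. x r \<in> \<rat>" "\<exists>r\<in>R'. x r \<noteq> 0" "\<forall>d\<in>D. (\<Sum>r\<in>R'. x r * v' r d) = 0"
      using insert.IH[OF RR(3), of v'] by blast
    define x0 where "x0 = - (\<Sum>r\<in>R'. x r * v r d) / v r0 d"
    have s: "(\<Sum>r\<in>R. (x(r0 := x0)) r * v r e) = (\<Sum>r\<in>R'. x r * v' r e)" for e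
    proof -
      have "(\<Sum>r\<in>R'. (x(r0 := x0)) r * v r e) = (\<Sum>r\<in>R'. x r * v r e)"
        using RR(2) by (intro sum.cong) auto
      moreover have "(\<Sum>r\<in>R'. x r * v' r e) = (\<Sum>r\<in>R'. x r * v r e) - (\<Sum>r\<in>R'. x r * v r d) * (v r0 e / v r0 d)"
        by (simp add: v'_def right_diff_distrib sum_subtractf sum_distrib_left sum_distrib_right divide_inverse mult_ac)
      ultimately show ?thesis using RR by (simp add: x0_def)
    qed
    have "x0 \<in> \<rat>"
    proof -
      have "(\<Sum>r\<in>R'. x r * v r d) \<in> \<rat>"
        using x(1) RR(1) insert.prems(3) by (intro Rats_sum Rats_mult) auto
      thus ?thesis unfolding x0_def using r0(1) insert.prems(3) by (intro Rats_divide) auto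
    qed
    moreover have "(\<Sum>r\<in>R'. x r * v' r d) = 0" using r0(2) by (simp add: v'_def)
    ultimately have "\<forall>e\<in>insert d D. (\<Sum>r\<in>R. (x(r0 := x0)) r * v r e) = 0"
      using x(3) unfolding s by simp
    moreover have "\<forall>r\<in>R. (x(r0 := x0)) r \<in> \<rat>" using x(1) \<open>x0 \<in> \<rat>\<close> RR by simp
    moreover have "\<exists>r\<in>R. (x(r0 := x0)) r \<noteq> 0" using x(2) RR by auto
    ultimately show ?thesis by blast
  qed
qed

lemma common_denominator:
  assumes "finite R" "\<And>r. r \<in> R \<Longrightarrow> x r \<in> (\<rat> :: complex set)"
  shows "\<exists>q::int. q \<noteq> 0 \<and> (\<forall>r\<in>R. of_int q * x r \<in> \<int>)"
  using assms
proof (induction R rule: finite_induct)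
  case (insert r R)
  then obtain q where q: "q \<noteq> 0" "\<forall>r\<in>R. of_int q * x r \<in> \<int>" by auto
  obtain a b :: int where ab: "b \<noteq> 0" "x r = of_int a / of_int b"
    using insert.prems[of r] by (metis Rats_cases' insertI1 less_irrefl)
  have "of_int (q * b) * x r' \<in> \<int>" if "r' \<in> insert r R" for r'
  proof (cases "r' = r")
    case True
    hence "of_int (q * b) * x r' = of_int (q * a)" using ab by simp
    thus ?thesis by (metis Ints_of_int)
  next
    case False
    hence "of_int q * x r' \<in> \<int>" using that q(2) by simp
    hence "of_int b * (of_int q * x r') \<in> \<int>" by (rule Ints_mult[OF Ints_of_int])
    thus ?thesis by (simp add: mult_ac)
  qed
  thus ?case using q(1) ab(1) by (intro exI[of _ "q * b"]) auto
qed (auto intro: exI[of _ 1])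

text \<open>Among the nonzero integer solutions one of least total absolute value cannot be
  divisible by p throughout, since division by p would give a smaller one. Thus a dependence in
  characteristic 0 becomes a nontrivial one modulo p.\<close>

lemma primitive_integer_relation:
  fixes v :: "'r \<Rightarrow> 'd \<Rightarrow> complex"
  assumes p: "prime (p::nat)" and D: "finite D" and R: "finite R" "card D < card R"
    and v: "\<And>r d. r \<in> R \<Longrightarrow> d \<in> D \<Longrightarrow> v r d \<in> \<rat>"
  shows "\<exists>y::'r \<Rightarrow> int. (\<exists>r\<in>R. \<not> int p dvd y r) \<and> (\<forall>d\<in>D. (\<Sum>r\<in>R. of_int (y r) * v r d) = 0)"
proof -
  define P where "P = (\<lambda>y::'r \<Rightarrow> int. (\<exists>r\<in>R. y r \<noteq> 0) \<and> (\<forall>d\<in>D. (\<Sum>r\<in>R. of_int (y r) * v r d) = 0))"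
  have "\<exists>x. (\<forall>r\<in>R. x r \<in> \<rat>) \<and> (\<exists>r\<in>R. x r \<noteq> 0) \<and> (\<forall>d\<in>D. (\<Sum>r\<in>R. x r * v r d) = 0)"
    by (rule rational_relation[OF D R]) (rule v)
  then obtain x where x: "\<forall>r\<in>R. x r \<in> \<rat>" "\<exists>r\<in>R. x r \<noteq> 0" "\<forall>d\<in>D. (\<Sum>r\<in>R. x r * v r d) = 0"
    by blast
  obtain q :: int where q: "q \<noteq> 0" "\<forall>r\<in>R. of_int q * x r \<in> \<int>"
    using common_denominator[of R x] x(1) R(1) by auto
  have "\<forall>r\<in>R. \<exists>z::int. of_int q * x r = of_int z" using q(2) by (auto elim!: Ints_cases)
  then obtain y where y: "\<And>r. r \<in> R \<Longrightarrow> of_int q * x r = of_int (y r)" by metis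
  have "P y"
    unfolding P_def
  proof
    obtain r where r: "r \<in> R" "x r \<noteq> 0" using x(2) by auto
    hence "of_int (y r) \<noteq> (0::complex)" using y[OF r(1)] q(1) by (metis mult_eq_0_iff of_int_eq_0_iff)
    thus "\<exists>r\<in>R. y r \<noteq> 0" using r(1) by auto
    show "\<forall>d\<in>D. (\<Sum>r\<in>R. of_int (y r) * v r d) = 0"
    proof
      fix d assume d: "d \<in> D"
      have "(\<Sum>r\<in>R. of_int (y r) * v r d) = of_int q * (\<Sum>r\<in>R. x r * v r d)"
        unfolding sum_distrib_left using y by (intro sum.cong) (auto simp: mult.assoc[symmetric])
      thus "(\<Sum>r\<in>R. of_int (y r) * v r d) = 0" using x(3) d by simp
    qed
  qed
  then obtain y where y: "P y" and least: "\<And>z. P z \<Longrightarrow> (\<Sum>r\<in>R. nat \<bar>y r\<bar>) \<le> (\<Sum>r\<in>R. nat \<bar>z r\<bar>)"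
    using ex_has_least_nat[of P y "\<lambda>y. \<Sum>r\<in>R. nat \<bar>y r\<bar>"] by blast
  have "\<exists>r\<in>R. \<not> int p dvd y r"
  proof (rule ccontr)
    assume "\<not> ?thesis"
    hence "\<forall>r\<in>R. \<exists>z. y r = int p * z" by (auto elim: dvdE)
    then obtain z where z: "\<And>r. r \<in> R \<Longrightarrow> y r = int p * z r" by metis
    have p1: "p > 1" using p by (rule prime_gt_1_nat)
    have "P z"
      unfolding P_def
    proof
      show "\<exists>r\<in>R. z r \<noteq> 0" using y z unfolding P_def by force
      show "\<forall>d\<in>D. (\<Sum>r\<in>R. of_int (z r) * v r d) = 0"
      proof
        fix d assume d: "d \<in> D"
        have "of_nat p * (\<Sum>r\<in>R. of_int (z r) * v r d) = (\<Sum>r\<in>R. of_int (y r) * v r d)"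
          unfolding sum_distrib_left using z by (intro sum.cong) auto
        thus "(\<Sum>r\<in>R. of_int (z r) * v r d) = 0" using y d p1 unfolding P_def by auto
      qed
    qed
    obtain r where r: "r \<in> R" "z r \<noteq> 0" using \<open>P z\<close> unfolding P_def by auto
    have "(\<Sum>r\<in>R. nat \<bar>z r\<bar>) < (\<Sum>r\<in>R. nat \<bar>y r\<bar>)"
    proof (rule sum_strict_mono_ex1)
      show "\<forall>r\<in>R. nat \<bar>z r\<bar> \<le> nat \<bar>y r\<bar>"
        using z p1 by (auto simp: abs_mult mult_le_cancel_right1 intro!: nat_mono)
      show "\<exists>r\<in>R. nat \<bar>z r\<bar> < nat \<bar>y r\<bar>"
        using z[OF r(1)] r p1 by (intro bexI[of _ r]) (auto simp: abs_mult nat_less_eq_zless mult_less_cancel_right1)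
    qed (rule R)
    thus False using least[OF \<open>P z\<close>] by simp
  qed
  thus ?thesis using y unfolding P_def by blast
qed

section \<open>Uniqueness of coefficients and their translation invariance\<close>

lemma jsum_coeff_eq_0:
  assumes "\<And>\<beta> \<tau>. Im \<tau> > 0 \<Longrightarrow>
    ((\<lambda>(n, x, y). d n x y * e2pi (of_nat n * \<tau> + of_real (gi x y \<bullet> \<beta>))) has_sum 0) UNIV"
  shows "d n x y = 0"
proof -
  \<comment> \<open>On \<tau> = w + i and \<beta> = u + i v with real u, v, w, the indices n, x, y
    are the frequencies in w, u, v; they are isolated one after another. The decay coming from Im
    \<tau> = 1 is put into \<open>a\<close>.\<close>
  define a where "a = (\<lambda>(n, x::int, y::int). d n x y * e2pi (of_nat n * \<i>))"
  have s: "((\<lambda>i. a i * e2pi (of_int (fst (snd i)) * of_real u) * e2pi (of_int (snd (snd i)) * of_real v) *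
      e2pi (of_int (int (fst i)) * of_real w)) has_sum 0) UNIV" for u v w :: real
  proof -
    have "d n x y * e2pi (of_nat n * (of_real w + \<i>) + of_real (gi x y \<bullet> Complex u v)) =
      a (n, x, y) * e2pi (of_int x * of_real u) * e2pi (of_int y * of_real v) * e2pi (of_int (int n) * of_real w)" for n x y
      unfolding a_def prod.case by (simp add: inner_complex_def distrib_left e2pi_add mult_ac)
    thus ?thesis using assms[of "of_real w + \<i>" "Complex u v"] by (simp add: case_prod_unfold)
  qed
  have "((\<lambda>i. a i * e2pi (of_int (fst (snd i)) * of_real u) * e2pi (of_int (snd (snd i)) * of_real v)) has_sum 0)
      {i \<in> UNIV. int (fst i) = int n}" for u v :: real
    by (rule has_sum_character_fiber) (rule s)
  hence "((\<lambda>i. (a i * e2pi (of_int (snd (snd i)) * of_real v)) * e2pi (of_int (fst (snd i)) * of_real u)) has_sum 0)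
      {i \<in> UNIV. int (fst i) = int n}" for u v :: real
    by (simp add: mult_ac)
  hence "((\<lambda>i. a i * e2pi (of_int (snd (snd i)) * of_real v)) has_sum 0)
      {i \<in> {i \<in> UNIV. int (fst i) = int n}. fst (snd i) = x}" for v :: real
    by (rule has_sum_character_fiber)
  hence "(a has_sum 0) {i \<in> {i \<in> {i \<in> UNIV. int (fst i) = int n}. fst (snd i) = x}. snd (snd i) = y}"
    by (rule has_sum_character_fiber)
  also have "{i \<in> {i \<in> {i \<in> UNIV. int (fst i) = int n}. fst (snd i) = x}. snd (snd i) = y} = {(n, x, y)}"
    by auto
  finally have "a (n, x, y) = 0" using has_sum_unique has_sum_finite[of "{(n, x, y)}" a] by force
  thus ?thesis by (simp add: a_def)
qed

definition jform :: "int \<Rightarrow> nat \<Rightarrow> jfunction \<Rightarrow> jcoeffs \<Rightarrow> bool" where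
  "jform k M f c \<longleftrightarrow> jmod k f \<and> jsum M c f \<and> jsupp M c"

text \<open>The lattice translation acts on triples and preserves the discriminant 4 M n - x^2 -
  y^2. Nonnegativity of the new n is \<open>torsion_exp_nonneg\<close> with N = 1.\<close>

lemma jcone_translate:
  assumes "(n, x, y) \<in> jcone M"
  shows "int n + int M * L\<^sup>2 + x * L \<ge> 0" "(nat (int n + int M * L\<^sup>2 + x * L), x + 2 * int M * L, y) \<in> jcone M"
proof -
  show 1: "int n + int M * L\<^sup>2 + x * L \<ge> 0"
    using torsion_exp_nonneg[OF assms, of 1 L 0] by (simp add: torsion_exp_def)
  show "(nat (int n + int M * L\<^sup>2 + x * L), x + 2 * int M * L, y) \<in> jcone M"
    using assms 1 by (simp add: jcone_def power2_eq_square algebra_simps)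
qed

text \<open>After removal of the cocycle, the expansion at \<alpha> = L is the expansion at \<alpha>
  = 0 with the triples of the cone permuted by \<open>tr L\<close>. Both represent the same function
  of \<tau> and \<beta>, so uniqueness of coefficients applies.\<close>

lemma jform_translate:
  assumes f: "jform k M f c" and i: "(n, x, y) \<in> jcone M"
  shows "c (nat (int n + int M * L\<^sup>2 + x * L)) (x + 2 * int M * L) y = c n x y"
proof -
  have js: "jsum M c f" and jc: "jsupp M c" and ji: "jinv k f"
    using f jmod_imp_jinv by (auto simp: jform_def)
  have c0: "c n x y = 0" if "(n, x, y) \<notin> jcone M" for n x y
    using jc that by (auto simp: jsupp_def jcone_def)
  define tr where "tr = (\<lambda>L (n, x, y::int). (nat (int n + int M * L\<^sup>2 + x * L), x + 2 * int M * L, y))"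
  have tr_in: "tr L i \<in> jcone M" if "i \<in> jcone M" for L i
    using jcone_translate(2) that by (cases i) (auto simp: tr_def)
  have tr_inv: "tr (- L) (tr L i) = i" if "i \<in> jcone M" for L i
    using jcone_translate(1)[of "fst i" "fst (snd i)" "snd (snd i)" M L] that
    by (cases i) (simp add: tr_def power2_eq_square algebra_simps)
  define d where "d = (\<lambda>n x y. if (n, x, y) \<in> jcone M then (case tr (- L) (n, x, y) of (n', x', y') \<Rightarrow> c n' x' y') - c n x y else 0)"
  have "d n x y = 0" for n x y
  proof (rule jsum_coeff_eq_0)
    fix \<beta> \<tau> :: complex assume \<tau>: "Im \<tau> > 0"
    define E where "E = (\<lambda>(n, x, y). e2pi (of_nat n * \<tau> + of_real (gi x y \<bullet> \<beta>)))"
    have E0: "jexp M n x y 0 \<beta> \<tau> = of_nat n * \<tau> + of_real (gi x y \<bullet> \<beta>)" for n x y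
      by (simp add: jexp_def)
    have EL: "e2pi (of_real (of_nat M * (gi L 0 \<bullet> \<beta>))) * e2pi (jexp M n x y (gi L 0) \<beta> \<tau>) = E (tr L (n, x, y))"
      if "(n, x, y) \<in> jcone M" for n x y
    proof -
      have "(of_nat (nat (int n + int M * L\<^sup>2 + x * L)) :: complex) = of_int (int n + int M * L\<^sup>2 + x * L)"
        using jcone_translate(1)[OF that, of L] by (metis nat_0_le of_int_of_nat_eq)
      hence "of_nat (nat (int n + int M * L\<^sup>2 + x * L)) * \<tau> + of_real (gi (x + 2 * int M * L) y \<bullet> \<beta>) =
         of_real (of_nat M * (gi L 0 \<bullet> \<beta>)) + jexp M n x y (gi L 0) \<beta> \<tau>"
        by (simp add: jexp_def inner_complex_def power2_eq_square algebra_simps)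
      thus ?thesis by (simp only: E_def tr_def prod.case e2pi_add[symmetric])
    qed
    have "((\<lambda>(n, x, y). c n x y * e2pi (jexp M n x y 0 \<beta> \<tau>)) has_sum f 0 \<beta> \<tau>) UNIV"
      by (rule jsumD[OF js \<tau>])
    also have "?this \<longleftrightarrow> ((\<lambda>(n, x, y). c n x y * E (n, x, y)) has_sum f 0 \<beta> \<tau>) (jcone M)"
      by (rule has_sum_cong_neutral) (auto simp: c0 E0 E_def)
    finally have 1: "((\<lambda>(n, x, y). c n x y * E (n, x, y)) has_sum f 0 \<beta> \<tau>) (jcone M)" .
    have "((\<lambda>i. e2pi (of_real (of_nat M * (gi L 0 \<bullet> \<beta>))) * (case i of (n, x, y) \<Rightarrow> c n x y * e2pi (jexp M n x y (gi L 0) \<beta> \<tau>)))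
       has_sum e2pi (of_real (of_nat M * (gi L 0 \<bullet> \<beta>))) * f (gi L 0) \<beta> \<tau>) UNIV"
      by (intro has_sum_cmult_right jsumD[OF js \<tau>])
    also have "?this \<longleftrightarrow> ((\<lambda>i. (case i of (n, x, y) \<Rightarrow> c n x y) * E (tr L i))
       has_sum e2pi (of_real (of_nat M * (gi L 0 \<bullet> \<beta>))) * f (gi L 0) \<beta> \<tau>) (jcone M)"
      by (rule has_sum_cong_neutral) (auto simp: c0 EL[symmetric])
    also have "\<dots> \<longleftrightarrow> ((\<lambda>i. (case tr (- L) i of (n, x, y) \<Rightarrow> c n x y) * E i)
       has_sum e2pi (of_real (of_nat M * (gi L 0 \<bullet> \<beta>))) * f (gi L 0) \<beta> \<tau>) (jcone M)"
      by (rule has_sum_reindex_bij_witness[where i = "tr (- L)" and j = "tr L"])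
         (use tr_in tr_inv tr_inv[of _ "- L"] in auto)
    also have "e2pi (of_real (of_nat M * (gi L 0 \<bullet> \<beta>))) * f (gi L 0) \<beta> \<tau> = f 0 \<beta> \<tau>"
      using jsum_translate_left[OF js ji \<tau>, of 0 L 0 \<beta>] by (simp add: e2pi_minus)
    finally have 2: "((\<lambda>i. (case tr (- L) i of (n, x, y) \<Rightarrow> c n x y) * E i) has_sum f 0 \<beta> \<tau>) (jcone M)" .
    have "((\<lambda>i. (case tr (- L) i of (n, x, y) \<Rightarrow> c n x y) * E i - (case i of (n, x, y) \<Rightarrow> c n x y * E (n, x, y)))
        has_sum f 0 \<beta> \<tau> - f 0 \<beta> \<tau>) (jcone M)"
      using has_sum_add[OF 2 has_sum_uminusI[OF 1]] by simp
    also have "?this \<longleftrightarrow> ((\<lambda>(n, x, y). d n x y * E (n, x, y)) has_sum f 0 \<beta> \<tau> - f 0 \<beta> \<tau>) UNIV"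
      by (rule has_sum_cong_neutral) (auto simp: d_def left_diff_distrib split: prod.splits if_splits)
    finally show "((\<lambda>(n, x, y). d n x y * e2pi (of_nat n * \<tau> + of_real (gi x y \<bullet> \<beta>))) has_sum 0) UNIV"
      by (simp add: E_def)
  qed
  moreover obtain n' x' y' where t: "tr L (n, x, y) = (n', x', y')" by (cases "tr L (n, x, y)")
  ultimately have "d n' x' y' = 0" by blast
  thus ?thesis using tr_in[OF i, of L] tr_inv[OF i, of L] t by (auto simp: d_def tr_def)
qed

text \<open>The translate of (0, 0, 0) by L = 1. In positive index the constant coefficient thereby
  reappears in positive degree.\<close>

lemma jform_coeff_0:
  assumes "jform k M f c"
  shows "c M (2 * int M) 0 = c 0 0 0"
  using jform_translate[OF assms, of 0 0 0 1] by (simp add: jcone_def)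

lemma jsupp_coeff_0:
  assumes "jsupp M c" "c 0 x y \<noteq> 0"
  shows "x = 0 \<and> y = 0"
proof -
  have "x\<^sup>2 + y\<^sup>2 \<le> 4 * int M * int 0" using assms unfolding jsupp_def by blast
  thus ?thesis by (simp add: sum_power2_le_zero_iff)
qed

section \<open>Torsion coefficients modulo p and dilations\<close>

lemma tcoeff_in_Z_loc:
  assumes "prime p" "\<And>n x y. c n x y \<in> Z_loc p"
  shows "tcoeff N M c a1 a2 s1 s2 j \<in> Z_loc p"
  unfolding tcoeff_def using assms by (intro Z_loc_sum) auto

lemma tcoeff_cong_Z_max:
  assumes p: "prime p"
    and cd: "\<And>n x y. (n, x, y) \<in> tcoeff_set N M a1 a2 s1 s2 j \<Longrightarrow> c n x y - d n x y \<in> Z_max p"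
  shows "tcoeff N M c a1 a2 s1 s2 j \<in> Z_max p \<longleftrightarrow> tcoeff N M d a1 a2 s1 s2 j \<in> Z_max p"
proof -
  have "tcoeff N M c a1 a2 s1 s2 j - tcoeff N M d a1 a2 s1 s2 j =
        (\<Sum>(n, x, y)\<in>tcoeff_set N M a1 a2 s1 s2 j. c n x y - d n x y)"
    by (simp add: tcoeff_def sum_subtractf case_prod_unfold)
  also have "\<dots> \<in> Z_max p" using p cd by (intro Z_max_sum) auto
  finally show ?thesis using Z_max_add_cancel[OF p, of _ "tcoeff N M d a1 a2 s1 s2 j"] by force
qed

text \<open>The coefficients of the pullback of a series along (\<tau>, z1, z2) |-> (l \<tau>, l z1,
  l z2); up to a power of l this is the second part of the Hecke operator.\<close>

definition dilate :: "nat \<Rightarrow> jcoeffs \<Rightarrow> jcoeffs" where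
  "dilate l g n x y = (if l dvd n \<and> int l dvd x \<and> int l dvd y then g (n div l) (x div int l) (y div int l) else 0)"

text \<open>Dilation multiplies \<open>torsion_exp\<close> and the class s by l. As l is prime to N,
  multiplication by l is injective on classes modulo N^2, so no classes are merged.\<close>

lemma mem_tcoeff_set_dilate_iff:
  assumes l: "l > 0" "coprime l N"
    and s: "int (N\<^sup>2) dvd int l * s1 - s1'" "int (N\<^sup>2) dvd int l * s2 - s2'"
  shows "(l * n, int l * x, int l * y) \<in> tcoeff_set N (l * M) a1 a2 s1' s2' (l * j) \<longleftrightarrow>
         (n, x, y) \<in> tcoeff_set N M a1 a2 s1 s2 j"
proof -
  have "int l * (4 * int M * int n * int l - int l * (x\<^sup>2 + y\<^sup>2)) \<ge> 0 \<longleftrightarrow> x\<^sup>2 + y\<^sup>2 \<le> 4 * int M * int n"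
  proof -
    have "int l * (4 * int M * int n * int l - int l * (x\<^sup>2 + y\<^sup>2)) = int l * int l * (4 * int M * int n - (x\<^sup>2 + y\<^sup>2))"
      by (simp add: algebra_simps)
    thus ?thesis using l(1) by (simp add: zero_le_mult_iff)
  qed
  hence cone: "(l * n, int l * x, int l * y) \<in> jcone (l * M) \<longleftrightarrow> (n, x, y) \<in> jcone M"
    by (simp add: jcone_def power2_eq_square algebra_simps)
  have "torsion_exp N (l * M) a1 a2 (l * n) (int l * x) (int l * y) = int l * torsion_exp N M a1 a2 n x y"
    by (simp add: torsion_exp_def algebra_simps)
  hence exp: "torsion_exp N (l * M) a1 a2 (l * n) (int l * x) (int l * y) = int (l * j) \<longleftrightarrow> torsion_exp N M a1 a2 n x y = int j"
    using l(1) by simp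
  have cls: "int (N\<^sup>2) dvd int N * (int l * z) + int (l * M) * a - s' \<longleftrightarrow> int (N\<^sup>2) dvd int N * z + int M * a - s"
    if "int (N\<^sup>2) dvd int l * s - s'" for z a s s'
  proof -
    have e: "int N * (int l * z) + int (l * M) * a - s' = int l * (int N * z + int M * a - s) + (int l * s - s')"
      by (simp add: algebra_simps)
    have "coprime (int (N\<^sup>2)) (int l)" using l(2) by (simp add: coprime_commute)
    thus ?thesis unfolding e dvd_add_left_iff[OF that] by (rule coprime_dvd_mult_right_iff)
  qed
  show ?thesis
    unfolding tcoeff_set_def jfiber_def using cone exp cls[OF s(1)] cls[OF s(2)] by simp
qed

lemma tcoeff_dilate:
  assumes l: "l > 0" "coprime l N" and N: "N > 0"
    and s: "int (N\<^sup>2) dvd int l * s1 - s1'" "int (N\<^sup>2) dvd int l * s2 - s2'"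
  shows "tcoeff N (l * M) (dilate l g) a1 a2 s1' s2' (l * j) = tcoeff N M g a1 a2 s1 s2 j"
proof -
  define emb where "emb = (\<lambda>(n, x, y). (l * n, int l * x, int l * y))"
  have "tcoeff N M g a1 a2 s1 s2 j = (\<Sum>(n, x, y)\<in>emb ` tcoeff_set N M a1 a2 s1 s2 j. dilate l g n x y)"
    unfolding tcoeff_def using l(1)
    by (subst sum.reindex) (auto simp: emb_def inj_on_def dilate_def intro!: sum.cong)
  also have "\<dots> = tcoeff N (l * M) (dilate l g) a1 a2 s1' s2' (l * j)"
    unfolding tcoeff_def
  proof (rule sum.mono_neutral_left)
    show "finite (tcoeff_set N (l * M) a1 a2 s1' s2' (l * j))" by (rule finite_tcoeff_set[OF N])
    show "emb ` tcoeff_set N M a1 a2 s1 s2 j \<subseteq> tcoeff_set N (l * M) a1 a2 s1' s2' (l * j)"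
      using mem_tcoeff_set_dilate_iff[OF l s] by (auto simp: emb_def)
    show "\<forall>i\<in>tcoeff_set N (l * M) a1 a2 s1' s2' (l * j) - emb ` tcoeff_set N M a1 a2 s1 s2 j.
        (case i of (n, x, y) \<Rightarrow> dilate l g n x y) = 0"
    proof (clarify, rule ccontr)
      fix n x y
      assume i: "(n, x, y) \<in> tcoeff_set N (l * M) a1 a2 s1' s2' (l * j)" "(n, x, y) \<notin> emb ` tcoeff_set N M a1 a2 s1 s2 j"
        and nz: "dilate l g n x y \<noteq> 0"
      from nz have "l dvd n" "int l dvd x" "int l dvd y" by (auto simp: dilate_def split: if_splits)
      then obtain n' x' y' where e: "n = l * n'" "x = int l * x'" "y = int l * y'" by (auto elim!: dvdE)
      have "(n', x', y') \<in> tcoeff_set N M a1 a2 s1 s2 j"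
        using i(1) mem_tcoeff_set_dilate_iff[OF l s] unfolding e by blast
      hence "emb (n', x', y') \<in> emb ` tcoeff_set N M a1 a2 s1 s2 j" by (rule imageI)
      thus False using i(2) by (simp add: emb_def e)
    qed
  qed
  finally show ?thesis by simp
qed

text \<open>A nonzero coefficient comes from a triple divisible by l. Its quotient determines the
  degree j and the classes s1, s2 before dilation, and in particular l divides the degree.\<close>

lemma tcoeff_dilate_cases:
  assumes l: "l > 0" "coprime l N" and N: "N > 0"
    and nz: "tcoeff N (l * M) (dilate l g) a1 a2 s1' s2' j' \<noteq> 0"
  obtains s1 s2 j where "s1 < N\<^sup>2" "s2 < N\<^sup>2" "j' = l * j"
    "tcoeff N (l * M) (dilate l g) a1 a2 s1' s2' j' = tcoeff N M g a1 a2 (int s1) (int s2) j"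
proof -
  from nz obtain n x y where i: "(n, x, y) \<in> tcoeff_set N (l * M) a1 a2 s1' s2' j'" and d: "dilate l g n x y \<noteq> 0"
    unfolding tcoeff_def by (metis (mono_tags, lifting) case_prodE sum.neutral surj_pair prod.case)
  from d have "l dvd n" "int l dvd x" "int l dvd y" by (auto simp: dilate_def split: if_splits)
  then obtain n0 x0 y0 where e: "n = l * n0" "x = int l * x0" "y = int l * y0" by (auto elim!: dvdE)
  define L where "L = N\<^sup>2"
  have L: "L > 0" using N by (simp add: L_def)
  define j where "j = nat (torsion_exp N M a1 a2 n0 x0 y0)"
  define s1 where "s1 = nat ((int N * x0 + int M * a1) mod int L)"
  define s2 where "s2 = nat ((int N * y0 + int M * a2) mod int L)"
  have s12: "int s1 = (int N * x0 + int M * a1) mod int L" "int s2 = (int N * y0 + int M * a2) mod int L"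
    using L by (simp_all add: s1_def s2_def)
  have ex: "torsion_exp N (l * M) a1 a2 n x y = int l * torsion_exp N M a1 a2 n0 x0 y0"
    by (simp add: torsion_exp_def e algebra_simps)
  have ij: "int j' = int l * torsion_exp N M a1 a2 n0 x0 y0" using i ex by (auto simp: tcoeff_set_def jfiber_def)
  hence "torsion_exp N M a1 a2 n0 x0 y0 \<ge> 0" using l(1) by (metis of_nat_0_le_iff of_nat_0_less_iff zero_le_mult_iff not_less)
  hence "int j' = int (l * j)" using ij by (simp add: j_def)
  hence j: "j' = l * j" by (simp only: of_nat_eq_iff)
  have cl: "int L dvd int l * int s1 - s1'" "int L dvd int l * int s2 - s2'"
  proof -
    have "int L dvd int N * x + int (l * M) * a1 - s1'" "int L dvd int N * y + int (l * M) * a2 - s2'"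
      using i by (auto simp: tcoeff_set_def L_def)
    moreover have "int L dvd int l * (int N * x0 + int M * a1) - int l * int s1"
      "int L dvd int l * (int N * y0 + int M * a2) - int l * int s2"
      unfolding s12 right_diff_distrib[symmetric] by (intro dvd_mult; simp add: minus_mod_eq_mult_div)+
    ultimately have "int L dvd (int N * x + int (l * M) * a1 - s1') - (int l * (int N * x0 + int M * a1) - int l * int s1)"
      "int L dvd (int N * y + int (l * M) * a2 - s2') - (int l * (int N * y0 + int M * a2) - int l * int s2)"
      by (blast intro: dvd_diff)+
    thus "int L dvd int l * int s1 - s1'" "int L dvd int l * int s2 - s2'"
      by (simp_all add: e algebra_simps)
  qed
  show ?thesis
  proof (rule that[of s1 s2 j])
    show "s1 < N\<^sup>2" "s2 < N\<^sup>2" using L by (auto simp: s1_def s2_def nat_less_iff L_def[symmetric])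
    show "tcoeff N (l * M) (dilate l g) a1 a2 s1' s2' j' = tcoeff N M g a1 a2 (int s1) (int s2) j"
      unfolding j by (rule tcoeff_dilate[OF l N]) (use cl in \<open>simp_all only: L_def\<close>)
  qed (rule j)
qed

section \<open>Twisted families\<close>

lemma tcoeff_cmult: "tcoeff N M (\<lambda>n x y. u * c n x y) a1 a2 s1 s2 j = u * tcoeff N M c a1 a2 s1 s2 j"
  by (simp add: tcoeff_def sum_distrib_left case_prod_unfold)

lemma tcoeff_sum:
  "tcoeff N M (\<lambda>n x y. \<Sum>k\<in>K. c k n x y) a1 a2 s1 s2 j = (\<Sum>k\<in>K. tcoeff N M (c k) a1 a2 s1 s2 j)"
  unfolding tcoeff_def by (subst sum.swap) (simp add: case_prod_unfold)

locale jacobi_family =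
  fixes p m \<kappa> :: nat and K :: "int set"
    and f :: "int \<Rightarrow> jfunction"
    and c :: "int \<Rightarrow> jcoeffs"
  assumes p: "prime p" and K: "finite K"
    and form: "\<And>k. k \<in> K \<Longrightarrow> jform k m (f k) (c k)"
    and integral: "\<And>k n x y. k \<in> K \<Longrightarrow> c k n x y \<in> Z_loc p"
    and weights: "\<And>k. k \<in> K \<Longrightarrow> 0 \<le> k + int \<kappa>"
begin

text \<open>The shift by \<open>\<kappa>\<close> only serves to make the exponents of the twists natural numbers.\<close>

definition ex :: "int \<Rightarrow> nat" where "ex k = nat (k + int \<kappa>)"

definition tw :: "nat \<Rightarrow> nat \<Rightarrow> int \<Rightarrow> int \<Rightarrow> complex" where
  "tw t n x y = (\<Sum>k\<in>K. of_nat t ^ ex k * c k n x y)"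

text \<open>The constant coefficient is exempted in index 0 only, because dilation fixes degree 0
  and so gives no control over it.\<close>

definition good :: "nat \<Rightarrow> bool" where
  "good t \<longleftrightarrow> (\<forall>n x y. 0 < n \<or> 0 < m \<longrightarrow> tw t n x y \<in> Z_max p)"

lemma form_parts:
  assumes "k \<in> K"
  shows "jmod k (f k)" "jsum m (c k) (f k)" "jsupp m (c k)"
  using form[OF assms] by (auto simp: jform_def)

lemma tw_cong:
  assumes "[t = t'] (mod p)"
  shows "tw t n x y - tw t' n x y \<in> Z_max p"
proof -
  have "tw t n x y - tw t' n x y = (\<Sum>k\<in>K. of_int (int t ^ ex k - int t' ^ ex k) * c k n x y)"
    by (simp add: tw_def sum_subtractf left_diff_distrib)
  also have "\<dots> \<in> Z_max p"
  proof (intro Z_max_sum[OF p] Z_max_mult_right[OF p] integral)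
    fix k
    have "[int t ^ ex k = int t' ^ ex k] (mod int p)"
      using assms by (intro cong_pow) (simp add: cong_int_iff)
    thus "of_int (int t ^ ex k - int t' ^ ex k) \<in> Z_max p"
      unfolding of_int_Z_max_iff[OF p] by (simp add: cong_iff_dvd_diff)
  qed
  finally show ?thesis .
qed

lemma tw_Z_max_cong:
  assumes "[t = t'] (mod p)"
  shows "tw t n x y \<in> Z_max p \<longleftrightarrow> tw t' n x y \<in> Z_max p"
  using Z_max_add_cancel[OF p tw_cong[OF assms], of n x y "tw t' n x y"] by simp

lemma good_cong: "[t = t'] (mod p) \<Longrightarrow> good t \<longleftrightarrow> good t'"
  unfolding good_def using tw_Z_max_cong by blast

lemma tw_jsupp: "jsupp m (tw t)"
  unfolding jsupp_def
proof (intro allI impI)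
  fix n x y assume "tw t n x y \<noteq> 0"
  then obtain k where "k \<in> K" "c k n x y \<noteq> 0"
    unfolding tw_def by (metis (mono_tags, lifting) mult_zero_right sum.neutral)
  thus "x\<^sup>2 + y\<^sup>2 \<le> 4 * int m * int n" using form_parts(3) unfolding jsupp_def by blast
qed

text \<open>If the offending coefficient sits in degree 0, the index is positive and
  \<open>jform_coeff_0\<close> moves it to degree m.\<close>

lemma not_good:
  assumes "\<not> good t"
  obtains n x y where "0 < n" "tw t n x y \<notin> Z_max p"
proof -
  from assms obtain n x y where nxy: "0 < n \<or> 0 < m" "tw t n x y \<notin> Z_max p"
    unfolding good_def by blast
  show ?thesis
  proof (cases "0 < n")
    case True
    thus ?thesis using that nxy by blast
  next
    case False
    hence n: "n = 0" "0 < m" using nxy(1) by auto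
    have "tw t 0 x y \<noteq> 0" using nxy(2) n(1) p by auto
    hence "x = 0" "y = 0" using jsupp_coeff_0[OF tw_jsupp] by auto
    moreover have "tw t m (2 * int m) 0 = tw t 0 0 0"
      unfolding tw_def by (intro sum.cong refl) (simp add: jform_coeff_0[OF form])
    ultimately show ?thesis using that[of m "2 * int m" 0] nxy(2) n by simp
  qed
qed

text \<open>The least visible degree is the order of vanishing modulo p of the twisted sum on the
  torsion points. It depends on t modulo p only.\<close>

definition visible :: "nat \<Rightarrow> nat \<Rightarrow> nat \<Rightarrow> bool" where
  "visible N t j \<longleftrightarrow> (\<exists>a1 a2 s1 s2. a1 < N\<^sup>2 \<and> a2 < N\<^sup>2 \<and> s1 < N\<^sup>2 \<and> s2 < N\<^sup>2 \<and>
     tcoeff N m (tw t) (int a1) (int a2) (int s1) (int s2) j \<notin> Z_max p)"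

lemma visible_cong:
  assumes "[t = t'] (mod p)"
  shows "visible N t j \<longleftrightarrow> visible N t' j"
  unfolding visible_def using tcoeff_cong_Z_max[OF p tw_cong[OF assms]] by simp

text \<open>For \<open>N\<close> large compared to \<open>n\<close>, the pair \<open>(x, y)\<close> is determined by its class modulo \<open>N\<close>.\<close>

lemma not_good_imp_visible:
  assumes "\<not> good t"
  shows "\<exists>n>0. \<forall>N > 8 * m * n. visible N t (N\<^sup>2 * n)"
proof -
  obtain n x y where n: "0 < n" and nz: "tw t n x y \<notin> Z_max p"
    using not_good[OF assms] by blast
  have "tw t n x y \<noteq> 0" using nz p by auto
  hence cone: "x\<^sup>2 + y\<^sup>2 \<le> 4 * int m * int n" using tw_jsupp unfolding jsupp_def by blast
  have "visible N t (N\<^sup>2 * n)" if N: "N > 8 * m * n" for N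
  proof -
    define L where "L = N\<^sup>2"
    have N0: "N > 0" using N by simp
    have L: "L > 0" using N0 by (simp add: L_def)
    define s1 where "s1 = nat ((int N * x) mod int L)"
    define s2 where "s2 = nat ((int N * y) mod int L)"
    have si: "int s1 = (int N * x) mod int L" "int s2 = (int N * y) mod int L"
      using L by (simp_all add: s1_def s2_def)
    have dv: "int L dvd int N * u - (int N * v) mod int L \<longleftrightarrow> int N dvd u - v" for u v
    proof -
      have "int L dvd int N * u - (int N * v) mod int L \<longleftrightarrow> (int N * u) mod int L = ((int N * v) mod int L) mod int L"
        by (rule mod_eq_dvd_iff[symmetric])
      also have "\<dots> \<longleftrightarrow> int L dvd int N * u - int N * v" by (simp add: mod_eq_dvd_iff)
      also have "\<dots> \<longleftrightarrow> int N * int N dvd int N * (u - v)"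
        by (simp add: L_def power2_eq_square right_diff_distrib)
      also have "\<dots> \<longleftrightarrow> int N dvd u - v" using N0 by simp
      finally show ?thesis .
    qed
    have mem: "(n', x', y') \<in> tcoeff_set N m 0 0 (int s1) (int s2) (L * n) \<longleftrightarrow>
        x'\<^sup>2 + y'\<^sup>2 \<le> 4 * int m * int n' \<and> int L * int n' = int L * int n \<and>
        int N dvd x' - x \<and> int N dvd y' - y" for n' x' y'
      unfolding tcoeff_set_def jfiber_def jcone_def torsion_exp_def L_def[symmetric] si
      by (simp add: dv)
    \<comment> \<open>At a = 0 the degree is N^2 n, which fixes n, and the classes fix x and y
      modulo N. Two integers whose squares are at most 4 m n differ by at most 8 m n < N, so a
      single triple remains.\<close>
    have "tcoeff_set N m 0 0 (int s1) (int s2) (L * n) = {(n, x, y)}"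
    proof (intro equalityI subsetI)
      fix i assume "i \<in> {(n, x, y)}"
      thus "i \<in> tcoeff_set N m 0 0 (int s1) (int s2) (L * n)"
        using cone mem[of n x y] by simp
    next
      fix i assume i': "i \<in> tcoeff_set N m 0 0 (int s1) (int s2) (L * n)"
      obtain n' x' y' where i: "i = (n', x', y')" by (cases i)
      have cone': "x'\<^sup>2 + y'\<^sup>2 \<le> 4 * int m * int n'" and e: "int L * int n' = int L * int n"
        and d: "int N dvd x' - x" "int N dvd y' - y"
        using i' unfolding i mem by auto
      have n': "n' = n" using e L by simp
      have eq: "u' = u" if u: "u\<^sup>2 \<le> 4 * int m * int n" "u'\<^sup>2 \<le> 4 * int m * int n" "int N dvd u' - u" for u u'
      proof (rule ccontr)
        assume "u' \<noteq> u"
        hence "int N \<le> \<bar>u' - u\<bar>" using u(3) zdvd_imp_le[of "int N" "\<bar>u' - u\<bar>"] by auto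
        moreover have "\<bar>u' - u\<bar> \<le> 8 * int m * int n"
          using abs_le_square_bound[OF u(1)] abs_le_square_bound[OF u(2)] by linarith
        moreover have "8 * int m * int n < int N"
          using N by (metis of_nat_less_iff of_nat_mult of_nat_numeral)
        ultimately show False by linarith
      qed
      have cone'': "x'\<^sup>2 + y'\<^sup>2 \<le> 4 * int m * int n" using cone' n' by simp
      have "x' = x" using cone cone'' d zero_le_power2[of y] zero_le_power2[of y']
        by (intro eq; linarith?)
      moreover have "y' = y" using cone cone'' d zero_le_power2[of x] zero_le_power2[of x']
        by (intro eq; linarith?)
      ultimately show "i \<in> {(n, x, y)}" by (simp add: i n')
    qed
    hence "tcoeff N m (tw t) 0 0 (int s1) (int s2) (L * n) = tw t n x y"
      by (simp add: tcoeff_def)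
    moreover have "s1 < L" "s2 < L" using L by (auto simp: s1_def s2_def nat_less_iff)
    ultimately show ?thesis using nz L unfolding visible_def L_def[symmetric]
      by (intro exI[of _ 0] exI[of _ s1] exI[of _ s2]) simp
  qed
  thus ?thesis using n by blast
qed

section \<open>Hecke images of a twisted family\<close>

definition hk :: "nat \<Rightarrow> nat \<Rightarrow> int \<Rightarrow> jcoeffs" where
  "hk l t k n x y = (of_nat l ^ \<kappa> * of_nat t ^ ex k) * hecke_coeff l k (c k) n x y"

text \<open>The scalar l^\<kappa> turns the factor l^k of the Hecke operator into l^(k + \<kappa>),
  which merges with t^(k + \<kappa>) into the twist by t l. Being scalars for fixed k, these factors
  do not leave weight k.\<close>

lemma hk_eq:
  assumes k: "k \<in> K" and l: "l > 0"
  shows "hk l t k n x y = of_nat l ^ (\<kappa> + 1) * (of_nat t ^ ex k * c k (l * n) x y) +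
           dilate l (\<lambda>n x y. of_nat (t * l) ^ ex k * c k n x y) n x y"
proof -
  have "of_nat l ^ \<kappa> * of_nat l powi k = (of_nat l :: complex) powi (int \<kappa> + k)"
    using l by (subst power_int_add) auto
  also have "\<dots> = of_nat l powi int (ex k)" using weights[OF k] by (simp add: ex_def add.commute)
  finally have "of_nat l ^ \<kappa> * of_nat l powi k = (of_nat l :: complex) ^ ex k" by simp
  thus ?thesis
    by (simp add: hk_def hecke_coeff_def dilate_def power_mult_distrib distrib_left mult_ac)
qed

lemma hk_Z_loc:
  assumes "k \<in> K" "l > 0"
  shows "hk l t k n x y \<in> Z_loc p"
proof -
  have "dilate l (\<lambda>n x y. of_nat (t * l) ^ ex k * c k n x y) n x y \<in> Z_loc p"
    unfolding dilate_def using p integral[OF assms(1)]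
    by (auto intro!: Z_loc_mult Z_loc_power simp del: of_nat_mult)
  thus ?thesis unfolding hk_eq[OF assms] using p integral[OF assms(1)]
    by (intro Z_loc_add Z_loc_mult Z_loc_power) auto
qed

lemma sum_hk_eq:
  assumes l: "l > 0"
  shows "(\<Sum>k\<in>K. hk l t k n x y) = of_nat l ^ (\<kappa> + 1) * tw t (l * n) x y + dilate l (tw (t * l)) n x y"
proof -
  have "(\<Sum>k\<in>K. hk l t k n x y) = (\<Sum>k\<in>K. of_nat l ^ (\<kappa> + 1) * (of_nat t ^ ex k * c k (l * n) x y) +
           dilate l (\<lambda>n x y. of_nat (t * l) ^ ex k * c k n x y) n x y)"
    using hk_eq l by (intro sum.cong) auto
  also have "\<dots> = of_nat l ^ (\<kappa> + 1) * tw t (l * n) x y + dilate l (tw (t * l)) n x y"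
    by (cases "l dvd n \<and> int l dvd x \<and> int l dvd y")
       (auto simp: sum.distrib sum_distrib_left tw_def dilate_def)
  finally show ?thesis .
qed

abbreviation tcoeff_hk :: "nat \<Rightarrow> nat \<Rightarrow> nat \<Rightarrow> int \<Rightarrow> int \<Rightarrow> int \<Rightarrow> int \<Rightarrow> nat \<Rightarrow> complex" where
  "tcoeff_hk N l t \<equiv> tcoeff N (l * m) (\<lambda>n x y. \<Sum>k\<in>K. hk l t k n x y)"

abbreviation tcoeff_tw :: "nat \<Rightarrow> nat \<Rightarrow> nat \<Rightarrow> int \<Rightarrow> int \<Rightarrow> int \<Rightarrow> int \<Rightarrow> nat \<Rightarrow> complex" where
  "tcoeff_tw N l t \<equiv> tcoeff N (l * m) (dilate l (tw (t * l)))"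

text \<open>For good t the part c(l n, r) of the Hecke images sums to 0 modulo p, and only the
  dilated twist by t l remains. The condition j > 0 keeps away the exempted constant coefficient of
  index 0.\<close>

lemma tcoeff_sum_hk_Z_max_iff:
  assumes t: "good t" and l: "l > 0" and j: "j > 0"
  shows "tcoeff_hk N l t a1 a2 s1 s2 j \<in> Z_max p \<longleftrightarrow>
         tcoeff_tw N l t a1 a2 s1 s2 j \<in> Z_max p"
proof (rule tcoeff_cong_Z_max[OF p])
  fix n x y assume i: "(n, x, y) \<in> tcoeff_set N (l * m) a1 a2 s1 s2 j"
  have "0 < l * n \<or> 0 < m"
  proof (rule ccontr)
    assume "\<not> ?thesis"
    hence nm: "n = 0" "m = 0" using l by auto
    hence "x = 0" "y = 0" using i by (auto simp: tcoeff_set_def jfiber_def jcone_def sum_power2_le_zero_iff)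
    thus False using i nm j by (auto simp: tcoeff_set_def jfiber_def torsion_exp_def)
  qed
  hence "tw t (l * n) x y \<in> Z_max p" using t unfolding good_def by blast
  thus "(\<Sum>k\<in>K. hk l t k n x y) - dilate l (tw (t * l)) n x y \<in> Z_max p"
    unfolding sum_hk_eq[OF l] using p by (auto intro!: Z_max_mult_left Z_loc_mult Z_loc_power)
qed

lemma sum_hk_visible_imp:
  assumes t: "good t" and l: "l > 0" "coprime l N" and N: "N > 0" and j: "j > 0"
    and a: "a1 < N\<^sup>2" "a2 < N\<^sup>2"
    and nz: "tcoeff_hk N l t (int a1) (int a2) s1 s2 j \<notin> Z_max p"
  shows "\<exists>j0. j = l * j0 \<and> visible N (t * l) j0"
proof -
  have nz': "tcoeff_tw N l t (int a1) (int a2) s1 s2 j \<notin> Z_max p"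
    using nz tcoeff_sum_hk_Z_max_iff[OF t l(1) j] by simp
  hence "tcoeff_tw N l t (int a1) (int a2) s1 s2 j \<noteq> 0" using p by auto
  then obtain s1' s2' j0 where "s1' < N\<^sup>2" "s2' < N\<^sup>2" "j = l * j0"
    "tcoeff_tw N l t (int a1) (int a2) s1 s2 j =
     tcoeff N m (tw (t * l)) (int a1) (int a2) (int s1') (int s2') j0"
    using tcoeff_dilate_cases[OF l N] by blast
  thus ?thesis using nz' a unfolding visible_def by metis
qed

lemma visible_imp_sum_hk:
  assumes t: "good t" and l: "l > 0" "coprime l N" and N: "N > 0" and j: "j > 0"
    and vis: "visible N (t * l) j"
  shows "\<exists>a1 a2 s1 s2. a1 < N\<^sup>2 \<and> a2 < N\<^sup>2 \<and> s1 < N\<^sup>2 \<and> s2 < N\<^sup>2 \<and>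
     tcoeff_hk N l t (int a1) (int a2) (int s1) (int s2) (l * j) \<notin> Z_max p"
proof -
  obtain a1 a2 s1 s2 where a: "a1 < N\<^sup>2" "a2 < N\<^sup>2"
    and nz: "tcoeff N m (tw (t * l)) (int a1) (int a2) (int s1) (int s2) j \<notin> Z_max p"
    using vis unfolding visible_def by blast
  define L where "L = N\<^sup>2"
  have L: "L > 0" using N by (simp add: L_def)
  have d: "int L dvd int l * int s - int ((l * s) mod L)" for s
    by (simp add: zmod_int minus_mod_eq_mult_div)
  have "tcoeff_tw N l t (int a1) (int a2) (int ((l * s1) mod L)) (int ((l * s2) mod L)) (l * j) =
        tcoeff N m (tw (t * l)) (int a1) (int a2) (int s1) (int s2) j"
    by (rule tcoeff_dilate[OF l N]) (use d in \<open>simp_all only: L_def\<close>)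
  hence "tcoeff_hk N l t (int a1) (int a2) (int ((l * s1) mod L)) (int ((l * s2) mod L)) (l * j) \<notin> Z_max p"
    using nz l(1) j by (subst tcoeff_sum_hk_Z_max_iff[OF t l(1)]) auto
  moreover have "(l * s1) mod L < N\<^sup>2" "(l * s2) mod L < N\<^sup>2" using L by (simp_all add: L_def)
  ultimately show ?thesis using a by blast
qed

text \<open>If twisting by infinitely many primes \<open>l\<close> failed, the Hecke images, whose first visible degrees are
  multiples of \<open>l\<close>, would contain arbitrarily many elements with distinct first visible degrees. These are linearly
  independent modulo \<open>p\<close>, although they live in a space of bounded dimension.\<close>

lemma twist_large_primes: "\<exists>B. \<forall>l t. prime l \<and> B < l \<and> good t \<longrightarrow> good (t * l)"
proof (rule ccontr)
  assume neg: "\<not> ?thesis"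
  have "\<forall>s. \<exists>n. \<not> good s \<longrightarrow> n > 0 \<and> (\<forall>N > 8 * m * n. visible N s (N\<^sup>2 * n))"
    using not_good_imp_visible by blast
  then obtain \<nu> where \<nu>: "\<And>s. \<not> good s \<Longrightarrow> \<nu> s > 0"
    "\<And>s N. \<not> good s \<Longrightarrow> N > 8 * m * \<nu> s \<Longrightarrow> visible N s (N\<^sup>2 * \<nu> s)"
    by metis
  \<comment> \<open>Goodness and visibility depend on t modulo p only, so one level N and one bound
    J on the first positive visible degree serve all bad t.\<close>
  define N where "N = 1 + (\<Sum>s<p. 8 * m * \<nu> s)"
  define J where "J = (\<Sum>s<p. N\<^sup>2 * \<nu> s)"
  have N: "N > 0" by (simp add: N_def)
  define mj where "mj = (\<lambda>t. LEAST j. 0 < j \<and> visible N t j)"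
  have p0: "p > 0" using p by (rule prime_gt_0_nat)
  have ex_vis: "\<exists>j\<le>J. 0 < j \<and> visible N t j" if t: "\<not> good t" for t
  proof -
    define s where "s = t mod p"
    have st: "[s = t] (mod p)" by (simp add: s_def cong_def)
    have s: "s < p" "\<not> good s" using p0 t good_cong[OF st] by (auto simp: s_def)
    have "8 * m * \<nu> s \<le> (\<Sum>s<p. 8 * m * \<nu> s)"
      using s(1) by (intro member_le_sum) auto
    hence "visible N s (N\<^sup>2 * \<nu> s)" using \<nu>(2)[OF s(2), of N] by (simp add: N_def)
    moreover have "N\<^sup>2 * \<nu> s \<le> J"
      unfolding J_def using s(1) by (intro member_le_sum) auto
    ultimately show ?thesis using visible_cong[OF st] \<nu>(1)[OF s(2)] N by (intro exI[of _ "N\<^sup>2 * \<nu> s"]) auto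
  qed
  have mj: "0 < mj t" "visible N t (mj t)" "mj t \<le> J" if t: "\<not> good t" for t
  proof -
    obtain j where j: "j \<le> J" "0 < j" "visible N t j" using ex_vis[OF t] by blast
    have "0 < mj t \<and> visible N t (mj t)" unfolding mj_def by (rule LeastI[of _ j]) (use j in auto)
    thus "0 < mj t" "visible N t (mj t)" by auto
    have "mj t \<le> j" unfolding mj_def by (rule Least_le) (use j in auto)
    thus "mj t \<le> J" using j by simp
  qed
  have mj_least: "mj t \<le> j" if "0 < j" "visible N t j" for t j
    unfolding mj_def by (rule Least_le) (use that in auto)

  \<comment> \<open>A prime l > N is prime to N, as the comparison of dilated coefficients
    requires.\<close>
  define P where "P = (\<lambda>(l, t). prime l \<and> N < l \<and> good t \<and> \<not> good (t * l))"
  have step: "\<exists>z. P z \<and> B < fst z" for B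
  proof -
    from neg obtain l t where "prime l" "max B N < l" "good t" "\<not> good (t * l)" by blast
    thus ?thesis by (intro exI[of _ "(l, t)"]) (auto simp: P_def)
  qed
  \<comment> \<open>The first positive visible degree belonging to l lies in [l, J l]; the growth
    condition makes these intervals disjoint and increasing.\<close>
  have "\<exists>g. \<forall>i::nat. P (g i) \<and> J * fst (g i) < fst (g (Suc i))"
    by (rule dependent_nat_choice) (use step in blast)+
  then obtain g where g: "\<And>i. P (g i)" "\<And>i. J * fst (g i) < fst (g (Suc i))" by blast
  define l where "l = (\<lambda>i. fst (g i))"
  define t where "t = (\<lambda>i. snd (g i))"
  have lt: "prime (l i)" "N < l i" "good (t i)" "\<not> good (t i * l i)" for i
    using g(1)[of i] by (auto simp: P_def l_def t_def split: prod.splits)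
  have l0: "l i > 0" for i using prime_gt_0_nat[OF lt(1)] .
  have cop: "coprime (l i) N" for i
    using prime_imp_coprime[OF lt(1)] lt(2)[of i] N nat_dvd_not_less by blast
  define d where "d = (\<lambda>i. l i * mj (t i * l i))"
  have d0: "d i > 0" for i using l0[of i] mj(1)[OF lt(4)[of i]] by (simp add: d_def)
  have "d i < d (Suc i)" for i
  proof -
    have "d i \<le> J * l i" using mj(3)[OF lt(4)[of i]] by (simp add: d_def mult.commute)
    also have "\<dots> < l (Suc i)" using g(2)[of i] by (simp add: l_def)
    also have "\<dots> \<le> d (Suc i)" using mj(1)[OF lt(4)[of "Suc i"]] by (simp add: d_def)
    finally show ?thesis .
  qed
  hence d_mono: "strict_mono d" by (simp add: strict_mono_Suc_iff)
  define h where "h = (\<lambda>i a1 a2 s1 s2 j. tcoeff_hk N (l i) (t i) (int a1) (int a2) (int s1) (int s2) j)"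
  have h_low: "h i a1 a2 s1 s2 j \<in> Z_max p" if low: "a1 < N\<^sup>2" "a2 < N\<^sup>2" "0 < j" "j < d i" for i a1 a2 s1 s2 j
  proof (rule ccontr)
    assume "\<not> ?thesis"
    then obtain j0 where j0: "j = l i * j0" "visible N (t i * l i) j0"
      using sum_hk_visible_imp[OF lt(3) l0 cop N low(3,1,2)] unfolding h_def by blast
    hence "mj (t i * l i) \<le> j0" using low(3) by (intro mj_least) auto
    hence "d i \<le> j" unfolding d_def j0(1) by simp
    thus False using low(4) by simp
  qed
  have h_Z_loc: "h i a1 a2 s1 s2 j \<in> Z_loc p" for i a1 a2 s1 s2 j
    unfolding h_def using hk_Z_loc l0 p by (intro tcoeff_in_Z_loc) auto

  \<comment> \<open>At least the Sturm bound of every weight in K. The set D collects all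
    coefficients below it, over all weights and classes, and R has one element more than D.\<close>
  define E where "E = ((\<Sum>k\<in>K. nat \<bar>k\<bar>) + 1) * N\<^sup>2"
  define D where "D = K \<times> {..<N\<^sup>2} \<times> {..<N\<^sup>2} \<times> {..<N\<^sup>2} \<times> {..<N\<^sup>2} \<times> {..<E}"
  define R where "R = {..card D}"
  define v where "v = (\<lambda>i (k, a1, a2, s1, s2, j). tcoeff N (l i * m) (hk (l i) (t i) k) (int a1) (int a2) (int s1) (int s2) j)"
  have "\<exists>y. (\<exists>i\<in>R. \<not> int p dvd y i) \<and> (\<forall>e\<in>D. (\<Sum>i\<in>R. of_int (y i) * v i e) = 0)"
  proof (rule primitive_integer_relation[OF p])
    show "finite D" using K by (simp add: D_def)
    show "finite R" "card D < card R" by (simp_all add: R_def)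
    fix i e assume "e \<in> D"
    then obtain k a1 a2 s1 s2 j where e: "e = (k, a1, a2, s1, s2, j)" "k \<in> K"
      by (auto simp: D_def)
    show "v i e \<in> \<rat>"
      unfolding e(1) v_def prod.case
      by (intro Z_loc_Rats[of _ p] tcoeff_in_Z_loc[OF p] hk_Z_loc[OF e(2) l0])
  qed
  then obtain y where y: "\<exists>i\<in>R. \<not> int p dvd y i" "\<forall>e\<in>D. (\<Sum>i\<in>R. of_int (y i) * v i e) = 0" by blast
  \<comment> \<open>The extension beyond the bound E is made for each weight separately with common
    coefficients y, since the Sturm bound concerns a single weight; only afterwards are the weights
    added up.\<close>
  have rel: "(\<Sum>i\<in>R. of_int (y i) * v i (k, a1, a2, s1, s2, j)) = 0"
    if k: "k \<in> K" and as: "a1 < N\<^sup>2" "a2 < N\<^sup>2" "s1 < N\<^sup>2" "s2 < N\<^sup>2" for k a1 a2 s1 s2 j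
  proof -
    let ?w = "\<lambda>i a1 a2 s1 s2 j. (of_int (y i) * (of_nat (l i) ^ \<kappa> * of_nat (t i) ^ ex k)) *
          tcoeff N (l i * m) (hecke_coeff (l i) k (c k)) (int a1) (int a2) (int s1) (int s2) j"
    have v_eq: "of_int (y i) * v i (k, a1, a2, s1, s2, j) =
        ?w i a1 a2 s1 s2 j" for i a1 a2 s1 s2 j
      unfolding v_def prod.case hk_def tcoeff_cmult by simp
    have "(\<Sum>i\<in>R. ?w i a1 a2 s1 s2 j) = 0"
    proof (rule torsion_relation_extends[where f = "\<lambda>i. hecke (l i) k (f k)" and k = k])
      show "jsum (l i * m) (hecke_coeff (l i) k (c k)) (hecke (l i) k (f k))" for i
        by (rule jsum_hecke[OF form_parts(2)[OF k] l0])
      show "jsupp (l i * m) (hecke_coeff (l i) k (c k))" for i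
        by (rule jsupp_hecke[OF form_parts(3)[OF k] l0])
      show "jinv k (hecke (l i) k (f k))" for i
        by (rule jinv_hecke[OF form_parts(1)[OF k] lt(1)])
      fix a1 a2 s1 s2 j
      assume as: "a1 < N\<^sup>2" "a2 < N\<^sup>2" "s1 < N\<^sup>2" "s2 < N\<^sup>2" and j: "j < (nat \<bar>k\<bar> + 1) * N\<^sup>2"
      have "nat \<bar>k\<bar> \<le> (\<Sum>k\<in>K. nat \<bar>k\<bar>)" using k K by (intro member_le_sum) auto
      hence "(nat \<bar>k\<bar> + 1) * N\<^sup>2 \<le> E" unfolding E_def by (intro mult_right_mono) auto
      hence inD: "(k, a1, a2, s1, s2, j) \<in> D" using k as j by (auto simp: D_def)
      show "(\<Sum>i\<in>R. ?w i a1 a2 s1 s2 j) = 0"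
        unfolding v_eq[symmetric] using y(2) inD by blast
    qed (use N as in \<open>simp_all add: R_def\<close>)
    thus ?thesis by (simp add: v_eq)
  qed
  have rel_h: "(\<Sum>i\<in>R. of_int (y i) * h i a1 a2 s1 s2 j) = 0"
    if "a1 < N\<^sup>2" "a2 < N\<^sup>2" "s1 < N\<^sup>2" "s2 < N\<^sup>2" for a1 a2 s1 s2 j
  proof -
    have "(\<Sum>i\<in>R. of_int (y i) * h i a1 a2 s1 s2 j) = (\<Sum>i\<in>R. \<Sum>k\<in>K. of_int (y i) * v i (k, a1, a2, s1, s2, j))"
      by (simp add: h_def v_def tcoeff_sum sum_distrib_left)
    also have "\<dots> = (\<Sum>k\<in>K. \<Sum>i\<in>R. of_int (y i) * v i (k, a1, a2, s1, s2, j))" by (rule sum.swap)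
    also have "\<dots> = 0" using rel that by simp
    finally show ?thesis .
  qed
  \<comment> \<open>Modulo p and in degree \<open>d i0\<close>, earlier terms drop out because p
    divides \<open>y i\<close>, and later ones because their first positive visible degree is
    larger. The term of i0 alone cannot vanish.\<close>
  define i0 where "i0 = (LEAST i. i \<in> R \<and> \<not> int p dvd y i)"
  have i0: "i0 \<in> R" "\<not> int p dvd y i0"
    using y(1) LeastI_ex[of "\<lambda>i. i \<in> R \<and> \<not> int p dvd y i"] unfolding i0_def by auto
  have below: "int p dvd y i" if "i \<in> R" "i < i0" for i
    using that not_less_Least[of i "\<lambda>i. i \<in> R \<and> \<not> int p dvd y i"] unfolding i0_def by auto
  obtain a1 a2 s1 s2 where as: "a1 < N\<^sup>2" "a2 < N\<^sup>2" "s1 < N\<^sup>2" "s2 < N\<^sup>2"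
    and nz: "h i0 a1 a2 s1 s2 (d i0) \<notin> Z_max p"
    using visible_imp_sum_hk[OF lt(3) l0 cop N mj(1)[OF lt(4)] mj(2)[OF lt(4)], of i0]
    unfolding h_def d_def by blast
  let ?rest = "\<Sum>i\<in>R - {i0}. of_int (y i) * h i a1 a2 s1 s2 (d i0)"
  have rest: "?rest \<in> Z_max p"
  proof (rule Z_max_sum[OF p])
    fix i assume i: "i \<in> R - {i0}"
    show "of_int (y i) * h i a1 a2 s1 s2 (d i0) \<in> Z_max p"
    proof (cases "i < i0")
      case True
      thus ?thesis using below[of i] i of_int_Z_max_iff[OF p] h_Z_loc p by (intro Z_max_mult_right) auto
    next
      case False
      hence "d i0 < d i" using i d_mono by (auto simp: strict_mono_less)
      thus ?thesis using h_low[OF as(1,2) d0] p by (intro Z_max_mult_left) auto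
    qed
  qed
  have "(\<Sum>i\<in>R. of_int (y i) * h i a1 a2 s1 s2 (d i0)) =
      of_int (y i0) * h i0 a1 a2 s1 s2 (d i0) + ?rest"
    using i0(1) by (intro sum.remove) (auto simp: R_def)
  hence "?rest + of_int (y i0) * h i0 a1 a2 s1 s2 (d i0) = 0"
    using rel_h[OF as, of "d i0"] by (simp add: add.commute)
  hence "of_int (y i0) * h i0 a1 a2 s1 s2 (d i0) \<in> Z_max p"
    using Z_max_add_cancel[OF p rest] Z_max_0[OF p] by metis
  hence "of_int (y i0) \<in> Z_max p \<or> h i0 a1 a2 s1 s2 (d i0) \<in> Z_max p"
    using h_Z_loc p by (intro Z_max_prime) auto
  thus False using nz i0(2) of_int_Z_max_iff[OF p] by simp
qed

section \<open>All twists, and separation of the weight classes\<close>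

lemma good_all:
  assumes good1: "good 1" and t: "coprime t p"
  shows "good t"
proof -
  obtain B where B: "\<And>l t. prime l \<Longrightarrow> B < l \<Longrightarrow> good t \<Longrightarrow> good (t * l)"
    using twist_large_primes by blast
  \<comment> \<open>Starting from the twist by 1, the prime factors of n are multiplied in one at a
    time; each exceeds B, so \<open>twist_large_primes\<close> applies.\<close>
  have rough: "good n" if "n > 0" "\<And>q. prime q \<Longrightarrow> q dvd n \<Longrightarrow> B < q" for n
    using that
  proof (induction n rule: less_induct)
    case (less n)
    show ?case
    proof (cases "n = 1")
      case True
      thus ?thesis using good1 by simp
    next
      case False
      then obtain q where q: "prime q" "q dvd n" using prime_factor_nat by blast
      then obtain n' where n': "n = n' * q" by (auto elim!: dvdE simp: mult.commute)
      have "n' < n" using n' less.prems(1) prime_gt_1_nat[OF q(1)] by auto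
      moreover have "n' > 0" using n' less.prems(1) by auto
      ultimately have "good n'" using less n' by (meson dvd_mult2)
      thus ?thesis unfolding n' using B[OF q(1) less.prems(2)[OF q]] by blast
    qed
  qed
  \<comment> \<open>The congruence n = 1 modulo Q excludes all prime factors of n up to B other than
    p, and n = t modulo p excludes p itself.\<close>
  define Q where "Q = (\<Prod>q\<in>{q. prime q \<and> q \<le> B \<and> q \<noteq> p}. q)"
  have fin: "finite {q. prime q \<and> q \<le> B \<and> q \<noteq> p}" by (rule finite_subset[of _ "{..B}"]) auto
  have "coprime p Q"
    unfolding Q_def using p by (intro prod_coprime_right) (auto simp: primes_coprime)
  then obtain n where n: "[n = t] (mod p)" "[n = 1] (mod Q)"
    using binary_chinese_remainder_nat by blast
  have "B < q" if q: "prime q" "q dvd n" for q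
  proof (rule ccontr)
    assume "\<not> B < q"
    moreover have "q \<noteq> p"
    proof
      assume "q = p"
      hence "p dvd t" using q(2) n(1) cong_dvd_iff by blast
      thus False using t p by (metis coprime_common_divisor dvd_refl not_prime_unit)
    qed
    ultimately have "q dvd Q" unfolding Q_def using fin q(1) by (intro dvd_prodI) auto
    hence "[n = 1] (mod q)" using n(2) cong_dvd_modulus_nat by blast
    hence "q dvd 1" using q(2) cong_dvd_iff by blast
    thus False using q(1) by simp
  qed
  moreover have "n > 0"
  proof (rule ccontr)
    assume "\<not> n > 0"
    hence "[t = 0] (mod p)" using cong_sym[OF n(1)] by simp
    hence "p dvd t" by (simp add: cong_0_iff)
    thus False using t p by (metis coprime_common_divisor dvd_refl not_prime_unit)
  qed
  ultimately have "good n" using rough by blast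
  thus ?thesis using good_cong[OF n(1)] by simp
qed

lemma class_sum_Z_max:
  assumes sum0: "\<And>n x y. 0 < n \<or> 0 < m \<Longrightarrow> (\<Sum>k\<in>K. c k n x y) \<in> Z_max p"
    and nm: "0 < n \<or> 0 < m"
  shows "(\<Sum>k\<in>{k \<in> K. [k = a] (mod (int p - 1))}. c k n x y) \<in> Z_max p"
proof -
  have p1: "p > 1" using p by (rule prime_gt_1_nat)
  have good1: "good 1" unfolding good_def tw_def using sum0 by simp
  \<comment> \<open>With this weight t^e the total exponent e + k + \<kappa> is congruent to k - a,
    so it is divisible by p - 1 exactly for the class of a.\<close>
  define e where "e = nat ((- (a + int \<kappa>)) mod (int p - 1))"
  have ie: "int e = (- (a + int \<kappa>)) mod (int p - 1)" using p1 by (simp add: e_def)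
  \<comment> \<open>The power sum \<open>?S k\<close> is -1 modulo p on the class of a and 0 off it,
    so \<open>?S k + ?i k\<close> vanishes modulo p in both cases.\<close>
  let ?i = "\<lambda>k. if [k = a] (mod (int p - 1)) then 1 else 0"
  let ?S = "\<lambda>k. \<Sum>t\<in>{1..<p}. t ^ (e + ex k)"
  have power_sum: "of_nat (?S k) + (?i k) \<in> Z_max p"
    if k: "k \<in> K" for k
  proof -
    have "int (e + ex k) = (- (a + int \<kappa>)) mod (int p - 1) + (k + int \<kappa>)"
      using ie weights[OF k] by (simp add: ex_def)
    moreover have "[(- (a + int \<kappa>)) mod (int p - 1) + (k + int \<kappa>) = - (a + int \<kappa>) + (k + int \<kappa>)] (mod (int p - 1))"
      by (intro cong_add cong_refl) (simp add: cong_def)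
    ultimately have "[int (e + ex k) = k - a] (mod (int p - 1))" by simp
    hence "int p - 1 dvd int (e + ex k) \<longleftrightarrow> int p - 1 dvd k - a"
      by (rule cong_dvd_iff)
    hence iff: "[k = a] (mod (int p - 1)) \<longleftrightarrow> (p - 1) dvd (e + ex k)"
      using p1 by (simp add: cong_iff_dvd_diff of_nat_diff flip: int_dvd_int_iff)
    show ?thesis
    proof (cases "[k = a] (mod (int p - 1))")
      case True
      then obtain q where q: "e + ex k = (p - 1) * q" using iff by (auto elim: dvdE)
      have "[(?S k) = (\<Sum>t\<in>{1..<p}. 1)] (mod p)"
      proof (rule cong_sum)
        fix t assume "t \<in> {1..<p}"
        hence "\<not> p dvd t" by (auto dest: dvd_imp_le)
        hence "[t ^ (p - 1) = 1] (mod p)" using fermat_theorem[OF p] by blast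
        from cong_pow[OF this, of q] show "[t ^ (e + ex k) = 1] (mod p)"
          by (simp add: q power_mult)
      qed
      hence "[(?S k) + 1 = (p - 1) + 1] (mod p)"
        by (intro cong_add) auto
      hence "p dvd (?S k) + 1"
        using p1 by (simp add: cong_dvd_iff)
      hence "of_nat ((?S k) + 1) \<in> Z_max p"
        using of_nat_Z_max_iff[OF p] by blast
      thus ?thesis using True by (simp add: add.commute)
    next
      case False
      \<comment> \<open>Multiplication by g permutes the nonzero residues, so the power sum is
        congruent to g^(e + k + \<kappa>) times itself, and that factor is not 1 modulo p.\<close>
      obtain g where g: "residue_primroot p g" using p prime_primitive_root_exists[of p] p1 by auto
      have gp: "coprime g p" and og: "ord p g = p - 1"
        using g p by (auto simp: residue_primroot_def totient_prime coprime_commute)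
      define S where "S = (?S k)"
      have bij: "bij_betw (\<lambda>t. (g * t) mod p) {1..<p} {1..<p}"
      proof -
        have "inj_on (\<lambda>t. (g * t) mod p) {1..<p}"
        proof (rule inj_onI)
          fix s t assume st: "s \<in> {1..<p}" "t \<in> {1..<p}" "(g * s) mod p = (g * t) mod p"
          hence "[g * s = g * t] (mod p)" by (simp add: cong_def)
          hence "[s = t] (mod p)" using gp cong_mult_lcancel_nat by blast
          thus "s = t" using st by (simp add: cong_def)
        qed
        moreover have "(\<lambda>t. (g * t) mod p) ` {1..<p} \<subseteq> {1..<p}"
        proof (rule image_subsetI)
          fix t assume that: "t \<in> {1..<p}"
          have "\<not> p dvd g" using gp p by (metis coprime_common_divisor dvd_refl not_prime_unit)
          moreover have "\<not> p dvd t" using that by (auto dest: dvd_imp_le)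
          ultimately have "\<not> p dvd g * t" using p by (simp add: prime_dvd_mult_iff)
          thus "(g * t) mod p \<in> {1..<p}" using p1 by (auto simp: dvd_eq_mod_eq_0 Suc_le_eq)
        qed
        ultimately show ?thesis by (simp add: bij_betw_def endo_inj_surj)
      qed
      have "S = (\<Sum>t\<in>{1..<p}. ((g * t) mod p) ^ (e + ex k))"
        unfolding S_def by (rule sum.reindex_bij_betw[OF bij, symmetric])
      moreover have "[(\<Sum>t\<in>{1..<p}. ((g * t) mod p) ^ (e + ex k)) = (\<Sum>t\<in>{1..<p}. g ^ (e + ex k) * t ^ (e + ex k))] (mod p)"
      proof (rule cong_sum)
        fix t
        have "[((g * t) mod p) ^ (e + ex k) = (g * t) ^ (e + ex k)] (mod p)" by (intro cong_pow) (simp add: cong_def)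
        thus "[((g * t) mod p) ^ (e + ex k) = g ^ (e + ex k) * t ^ (e + ex k)] (mod p)" by (simp add: power_mult_distrib)
      qed
      moreover have "(\<Sum>t\<in>{1..<p}. g ^ (e + ex k) * t ^ (e + ex k)) = g ^ (e + ex k) * S"
        by (simp add: S_def sum_distrib_left)
      ultimately have "[S = g ^ (e + ex k) * S] (mod p)" by (simp only:)
      hence "[int S = int (g ^ (e + ex k) * S)] (mod int p)" by (simp only: cong_int_iff)
      hence "[int S = int (g ^ (e + ex k)) * int S] (mod int p)" by (simp only: of_nat_mult)
      hence "int p dvd int S * (1 - int (g ^ (e + ex k)))"
        by (simp add: cong_iff_dvd_diff algebra_simps)
      moreover have "\<not> int p dvd 1 - int (g ^ (e + ex k))"
      proof
        assume "int p dvd 1 - int (g ^ (e + ex k))"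
        hence "[int (g ^ (e + ex k)) = int 1] (mod int p)" by (simp add: cong_iff_dvd_diff dvd_diff_commute)
        hence "[g ^ (e + ex k) = 1] (mod p)" by (simp only: cong_int_iff)
        hence "p - 1 dvd e + ex k" using og ord_divides by metis
        thus False using False iff by simp
      qed
      ultimately have "int p dvd int S" using p by (simp add: prime_dvd_mult_iff)
      hence "of_nat S \<in> Z_max p" using of_nat_Z_max_iff[OF p] by simp
      thus ?thesis using False by (simp add: S_def)
    qed
  qed
  have "(\<Sum>t\<in>{1..<p}. of_nat (t ^ e) * tw t n x y) \<in> Z_max p"
  proof (rule Z_max_sum[OF p])
    fix t assume "t \<in> {1..<p}"
    hence "\<not> p dvd t" by (auto dest: dvd_imp_le)
    hence "coprime t p" using prime_imp_coprime[OF p] coprime_commute by blast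
    hence "tw t n x y \<in> Z_max p" using good_all[OF good1] nm unfolding good_def by blast
    thus "of_nat (t ^ e) * tw t n x y \<in> Z_max p" using p by (intro Z_max_mult_left) auto
  qed
  also have "(\<Sum>t\<in>{1..<p}. of_nat (t ^ e) * tw t n x y) = (\<Sum>k\<in>K. of_nat (?S k) * c k n x y)"
    unfolding tw_def sum_distrib_left of_nat_sum sum_distrib_right
    by (subst sum.swap) (simp add: power_add mult.assoc)
  finally have A: "(\<Sum>k\<in>K. of_nat (?S k) * c k n x y) \<in> Z_max p" .
  have "(\<Sum>k\<in>K. (of_nat (?S k) + (?i k)) * c k n x y) \<in> Z_max p"
    using power_sum integral p by (intro Z_max_sum Z_max_mult_right) auto
  also have "(\<Sum>k\<in>K. (of_nat (?S k) + (?i k)) * c k n x y) =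
      (\<Sum>k\<in>K. of_nat (?S k) * c k n x y) +
      (\<Sum>k\<in>{k \<in> K. [k = a] (mod (int p - 1))}. c k n x y)"
    unfolding distrib_right sum.distrib using K
    by (simp add: sum.inter_filter[symmetric] if_distrib[of "\<lambda>z. z * _"] cong: if_cong)
  finally show ?thesis using Z_max_add_cancel[OF p A] by blast
qed

end

section \<open>Modular forms of index zero\<close>

definition mform :: "int \<Rightarrow> (complex \<Rightarrow> complex) \<Rightarrow> (nat \<Rightarrow> complex) \<Rightarrow> bool" where
  "mform k F a \<longleftrightarrow>
     (\<forall>(A::int) B C D. A * D - B * C = 1 \<longrightarrow> (\<forall>\<tau>. Im \<tau> > 0 \<longrightarrow>
        F (moebius A B C D \<tau>) = automorphy_factor C D \<tau> powi k * F \<tau>)) \<and>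
     (\<forall>\<tau>. Im \<tau> > 0 \<longrightarrow> (\<lambda>n. a n * e2pi \<tau> ^ n) sums F \<tau>)"

lemma mformD:
  assumes "mform k F a"
  shows "A * D - B * C = 1 \<Longrightarrow> Im \<tau> > 0 \<Longrightarrow>
      F (moebius A B C D \<tau>) = automorphy_factor C D \<tau> powi k * F \<tau>"
    and "Im \<tau> > 0 \<Longrightarrow> (\<lambda>n. a n * e2pi \<tau> ^ n) sums F \<tau>"
  using assms unfolding mform_def by blast+

lemma automorphy_factor_nonzero:
  fixes A B C D :: int
  assumes "A * D - B * C = 1" "Im \<tau> > 0"
  shows "of_int C * \<tau> + of_int D \<noteq> 0"
proof
  assume z: "of_int C * \<tau> + of_int D = 0"
  hence "Im (of_int C * \<tau> + of_int D) = 0" by simp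
  hence "C = 0" using assms(2) by simp
  moreover from this have "D = 0" using z by simp
  ultimately show False using assms(1) by simp
qed

lemma moebius_Im_pos:
  fixes A B C D :: int
  assumes det: "A * D - B * C = 1" and \<tau>: "Im \<tau> > 0"
  shows "Im (moebius A B C D \<tau>) > 0"
proof -
  let ?j = "of_int C * \<tau> + of_int D"
  have j: "?j \<noteq> 0" by (rule automorphy_factor_nonzero[OF det \<tau>])
  have "Im ((of_int A * \<tau> + of_int B) / ?j) = of_int (A * D - B * C) * Im \<tau> / (cmod ?j)\<^sup>2"
    by (simp add: Im_divide cmod_power2 algebra_simps)
  also have "\<dots> > 0" using j \<tau> det by simp
  finally show ?thesis .
qed

lemma mform_abs_summable:
  assumes F: "\<And>\<tau>. Im \<tau> > 0 \<Longrightarrow> (\<lambda>n. a n * e2pi \<tau> ^ n) sums F \<tau>" and \<tau>: "Im \<tau> > 0"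
  shows "summable (\<lambda>n. norm (a n * e2pi \<tau> ^ n))"
proof (rule powser_insidea)
  show "summable (\<lambda>n. a n * e2pi (\<tau> / 2) ^ n)" using F[of "\<tau> / 2"] \<tau> sums_summable by auto
  show "norm (e2pi \<tau>) < norm (e2pi (\<tau> / 2))" using \<tau> by (simp add: norm_e2pi)
qed

lemma jform_0_imp_mform:
  assumes "jform k 0 f c"
  shows "mform k (f 0 0) (\<lambda>n. c n 0 0)"
  unfolding mform_def
proof (intro conjI allI impI)
  fix A B C D :: int and \<tau> :: complex assume "A * D - B * C = 1" "Im \<tau> > 0"
  hence "f 0 0 (moebius A B C D \<tau>) =
     automorphy_factor C D \<tau> powi k * f (of_int A * 0 + of_int C * 0) (of_int B * 0 + of_int D * 0) \<tau>"
    using assms unfolding jform_def jmod_def by blast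
  thus "f 0 0 (moebius A B C D \<tau>) = automorphy_factor C D \<tau> powi k * f 0 0 \<tau>"
    by simp
next
  fix \<tau> :: complex assume \<tau>: "Im \<tau> > 0"
  have c0: "x = 0 \<and> y = 0" if "c n x y \<noteq> 0" for n x y
  proof -
    have "x\<^sup>2 + y\<^sup>2 \<le> 4 * int 0 * int n" using assms that unfolding jform_def jsupp_def by blast
    thus ?thesis by (simp add: sum_power2_le_zero_iff)
  qed
  have c1: "c n x y = 0" if "x = 0 \<longrightarrow> y \<noteq> 0" for n x y using c0[of n x y] that by blast
  have "((\<lambda>(n, x, y). c n x y * e2pi (jexp 0 n x y 0 0 \<tau>)) has_sum f 0 0 \<tau>) UNIV"
    using assms \<tau> by (intro jsumD) (auto simp: jform_def)
  also have "?this \<longleftrightarrow> ((\<lambda>(n, x, y). c n x y * e2pi \<tau> ^ n) has_sum f 0 0 \<tau>) (range (\<lambda>n. (n, 0, 0)))"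
    by (rule has_sum_cong_neutral) (auto simp: jexp_def e2pi_power image_iff c1)
  also have "\<dots> \<longleftrightarrow> ((\<lambda>n. c n 0 0 * e2pi \<tau> ^ n) has_sum f 0 0 \<tau>) UNIV"
    by (subst has_sum_reindex) (auto simp: inj_on_def o_def)
  finally show "(\<lambda>n. c n 0 0 * e2pi \<tau> ^ n) sums f 0 0 \<tau>" by (rule has_sum_imp_sums)
qed

lemma mform_imp_jform:
  assumes F: "mform k F a"
  shows "jform k 0 (\<lambda>_ _. F) (\<lambda>n x y. if x = 0 \<and> y = 0 then a n else 0)"
  unfolding jform_def
proof (intro conjI)
  show "jmod k (\<lambda>_ _. F)" using F unfolding jmod_def mform_def by blast
  show "jsupp 0 (\<lambda>n x y. if x = 0 \<and> y = 0 then a n else 0)" by (auto simp: jsupp_def)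
  show "jsum 0 (\<lambda>n x y. if x = 0 \<and> y = 0 then a n else 0) (\<lambda>_ _. F)"
    unfolding jsum_def
  proof (intro allI impI)
    fix \<alpha> \<beta> \<tau> :: complex assume \<tau>: "Im \<tau> > 0"
    have "((\<lambda>n. a n * e2pi \<tau> ^ n) has_sum F \<tau>) UNIV"
      using mform_abs_summable[OF mformD(2)[OF F] \<tau>] mformD(2)[OF F \<tau>] by (rule norm_summable_imp_has_sum)
    also have "?this \<longleftrightarrow> ((\<lambda>(n, x, y). a n * e2pi \<tau> ^ n) has_sum F \<tau>) (range (\<lambda>n. (n, 0::int, 0::int)))"
      by (subst has_sum_reindex) (auto simp: inj_on_def o_def)
    also have "\<dots> \<longleftrightarrow> ((\<lambda>(n, x, y). (if x = 0 \<and> y = 0 then a n else 0) * e2pi (jexp 0 n x y \<alpha> \<beta> \<tau>)) has_sum F \<tau>) UNIV"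
      by (rule has_sum_cong_neutral) (auto simp: jexp_def e2pi_power gi_0)
    finally show "((\<lambda>(n, x, y). (if x = 0 \<and> y = 0 then a n else 0) * e2pi (jexp 0 n x y \<alpha> \<beta> \<tau>)) has_sum F \<tau>) UNIV" .
  qed
qed

lemma sums_cauchy_product:
  assumes F: "\<And>\<tau>. Im \<tau> > 0 \<Longrightarrow> (\<lambda>n. a n * e2pi \<tau> ^ n) sums F \<tau>"
    and G: "\<And>\<tau>. Im \<tau> > 0 \<Longrightarrow> (\<lambda>n. b n * e2pi \<tau> ^ n) sums G \<tau>" and \<tau>: "Im \<tau> > 0"
  shows "(\<lambda>n. (\<Sum>i\<le>n. a i * b (n - i)) * e2pi \<tau> ^ n) sums (F \<tau> * G \<tau>)"
proof -
  have "(\<lambda>n. \<Sum>i\<le>n. (a i * e2pi \<tau> ^ i) * (b (n - i) * e2pi \<tau> ^ (n - i))) sums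
        ((\<Sum>n. a n * e2pi \<tau> ^ n) * (\<Sum>n. b n * e2pi \<tau> ^ n))"
    by (intro Cauchy_product_sums mform_abs_summable[of a F] mform_abs_summable[of b G] F G \<tau>)
  also have "(\<lambda>n. \<Sum>i\<le>n. (a i * e2pi \<tau> ^ i) * (b (n - i) * e2pi \<tau> ^ (n - i))) =
        (\<lambda>n. (\<Sum>i\<le>n. a i * b (n - i)) * e2pi \<tau> ^ n)"
  proof
    fix n
    have e: "(a i * e2pi \<tau> ^ i) * (b (n - i) * e2pi \<tau> ^ (n - i)) = a i * b (n - i) * e2pi \<tau> ^ n" if "i \<le> n" for i
    proof -
      have "e2pi \<tau> ^ i * e2pi \<tau> ^ (n - i) = e2pi \<tau> ^ n" using that by (simp flip: power_add)
      thus ?thesis by (metis mult.assoc mult.left_commute)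
    qed
    show "(\<Sum>i\<le>n. (a i * e2pi \<tau> ^ i) * (b (n - i) * e2pi \<tau> ^ (n - i))) = (\<Sum>i\<le>n. a i * b (n - i)) * e2pi \<tau> ^ n"
      unfolding sum_distrib_right by (intro sum.cong refl e) simp
  qed
  finally show ?thesis using F[OF \<tau>] G[OF \<tau>] by (simp add: sums_iff)
qed

lemma mform_mult:
  assumes F: "mform k F a" and G: "mform l G b"
  shows "mform (k + l) (\<lambda>\<tau>. F \<tau> * G \<tau>) (\<lambda>n. \<Sum>i\<le>n. a i * b (n - i))"
  unfolding mform_def
proof (intro conjI allI impI)
  fix A B C D :: int and \<tau> :: complex assume d: "A * D - B * C = 1" "Im \<tau> > 0"
  show "F (moebius A B C D \<tau>) * G (moebius A B C D \<tau>) =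
        automorphy_factor C D \<tau> powi (k + l) * (F \<tau> * G \<tau>)"
    unfolding mformD(1)[OF F d] mformD(1)[OF G d]
    using automorphy_factor_nonzero[OF d] by (simp add: power_int_add)
qed (intro sums_cauchy_product mformD(2)[OF F] mformD(2)[OF G])

lemma mform_cmult:
  assumes "mform k F a"
  shows "mform k (\<lambda>\<tau>. u * F \<tau>) (\<lambda>n. u * a n)"
  using assms unfolding mform_def by (auto simp: mult.assoc mult.left_commute intro: sums_mult)

section \<open>The operator q d/dq and Rankin-Cohen brackets\<close>

lemma q_series_derivative:
  assumes F: "\<And>\<tau>. Im \<tau> > 0 \<Longrightarrow> (\<lambda>n. a n * e2pi \<tau> ^ n) sums F \<tau>" and \<tau>: "Im \<tau> > 0"
  defines "G \<equiv> (\<lambda>\<tau>. \<Sum>n. of_nat n * a n * e2pi \<tau> ^ n)"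
  shows "(\<lambda>n. of_nat n * a n * e2pi \<tau> ^ n) sums G \<tau>"
    and "(F has_field_derivative (2 * of_real pi * \<i>) * G \<tau>) (at \<tau>)"
proof -
  define P where "P = (\<lambda>w. \<Sum>n. a n * w ^ n)"
  have sm: "summable (\<lambda>n. a n * w ^ n)" if w: "norm w < 1" for w
  proof (cases "w = 0")
    case False
    obtain t where t: "e2pi (t / of_nat 1) = w" "Im t = - (real 1 * ln (norm w) / (2 * pi))"
      using e2pi_surj_upper_half_plane[OF False, of 1] by auto
    have "Im t > 0" using w False by (simp add: t(2) divide_less_0_iff)
    thus ?thesis using F[of t] t(1) sums_summable by auto
  qed simp
  have nw: "norm (e2pi \<tau>) < 1" using \<tau> by (simp add: norm_e2pi)
  have dP: "(P has_field_derivative (\<Sum>n. diffs a n * w ^ n)) (at w)" if "norm w < 1" for w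
    unfolding P_def by (rule termdiffs_strong'[OF sm that])
  have "summable (\<lambda>n. diffs a n * e2pi \<tau> ^ n)"
    using termdiff_converges[OF nw] sm by blast
  hence "(\<lambda>n. of_nat n * a n * e2pi \<tau> ^ (n - Suc 0)) sums (\<Sum>n. diffs a n * e2pi \<tau> ^ n)"
    by (rule diffs_equiv)
  hence "(\<lambda>n. e2pi \<tau> * (of_nat n * a n * e2pi \<tau> ^ (n - Suc 0))) sums (e2pi \<tau> * (\<Sum>n. diffs a n * e2pi \<tau> ^ n))"
    by (rule sums_mult)
  also have "(\<lambda>n. e2pi \<tau> * (of_nat n * a n * e2pi \<tau> ^ (n - Suc 0))) = (\<lambda>n. of_nat n * a n * e2pi \<tau> ^ n)"
  proof
    fix n show "e2pi \<tau> * (of_nat n * a n * e2pi \<tau> ^ (n - Suc 0)) = of_nat n * a n * e2pi \<tau> ^ n"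
      by (cases n) simp_all
  qed
  finally have s: "(\<lambda>n. of_nat n * a n * e2pi \<tau> ^ n) sums (e2pi \<tau> * (\<Sum>n. diffs a n * e2pi \<tau> ^ n))" .
  hence G: "G \<tau> = e2pi \<tau> * (\<Sum>n. diffs a n * e2pi \<tau> ^ n)" unfolding G_def by (simp add: sums_iff)
  thus "(\<lambda>n. of_nat n * a n * e2pi \<tau> ^ n) sums G \<tau>" using s by simp
  have "(e2pi has_field_derivative (2 * of_real pi * \<i>) * e2pi \<tau>) (at \<tau>)"
    unfolding e2pi_def by (auto intro!: derivative_eq_intros)
  hence "((\<lambda>\<tau>. P (e2pi \<tau>)) has_field_derivative
      (\<Sum>n. diffs a n * e2pi \<tau> ^ n) * ((2 * of_real pi * \<i>) * e2pi \<tau>)) (at \<tau>)"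
    by (rule DERIV_chain2[where f = P and g = e2pi, OF dP[OF nw]])
  also have "(\<Sum>n. diffs a n * e2pi \<tau> ^ n) * ((2 * of_real pi * \<i>) * e2pi \<tau>) = (2 * of_real pi * \<i>) * G \<tau>"
    by (simp add: G)
  finally have "((\<lambda>\<tau>. P (e2pi \<tau>)) has_field_derivative (2 * of_real pi * \<i>) * G \<tau>) (at \<tau>)" .
  moreover have "open {\<tau>. Im \<tau> > 0}" by (rule open_halfspace_Im_gt)
  ultimately show "(F has_field_derivative (2 * of_real pi * \<i>) * G \<tau>) (at \<tau>)"
    by (rule has_field_derivative_transform_within_open)
       (use \<tau> F in \<open>auto simp: P_def sums_iff\<close>)
qed

text \<open>The coefficients of k F F'' - (k + 1) F'^2 with F' = q dF/dq, which is the second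
  bracket [F, F]_2 without its factor k + 1. They are integral polynomials in those of F.\<close>

definition rc_coeff :: "int \<Rightarrow> (nat \<Rightarrow> complex) \<Rightarrow> nat \<Rightarrow> complex" where
  "rc_coeff k a n = (\<Sum>i\<le>n. (of_int k * of_nat (n - i) ^ 2 - of_int (k + 1) * of_nat i * of_nat (n - i)) * (a i * a (n - i)))"

text \<open>The bracket has no constant term, which makes it a source of modular forms that are not
  congruent to constants.\<close>

lemma mform_rankin_cohen:
  assumes F: "mform k F a"
  shows "\<exists>G. mform (2 * k + 4) G (rc_coeff k a)"
proof -
  define F1 where "F1 = (\<lambda>\<tau>. \<Sum>n. of_nat n * a n * e2pi \<tau> ^ n)"
  define F2 where "F2 = (\<lambda>\<tau>. \<Sum>n. of_nat n * (of_nat n * a n) * e2pi \<tau> ^ n)"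
  define \<delta> where "\<delta> = 2 * of_real pi * \<i>"
  have \<delta>: "\<delta> \<noteq> 0" by (simp add: \<delta>_def)
  note s0 = mformD(2)[OF F]
  have s1: "(\<lambda>n. of_nat n * a n * e2pi \<tau> ^ n) sums F1 \<tau>" and d0: "(F has_field_derivative \<delta> * F1 \<tau>) (at \<tau>)"
    if "Im \<tau> > 0" for \<tau>
    using q_series_derivative[OF s0 that] by (simp_all add: F1_def \<delta>_def)
  have s2: "(\<lambda>n. of_nat n * (of_nat n * a n) * e2pi \<tau> ^ n) sums F2 \<tau>" and d1: "(F1 has_field_derivative \<delta> * F2 \<tau>) (at \<tau>)"
    if "Im \<tau> > 0" for \<tau>
    using q_series_derivative[OF s1 that] by (simp_all add: F2_def \<delta>_def)
  define G where "G = (\<lambda>\<tau>. of_int k * (F \<tau> * F2 \<tau>) - of_int (k + 1) * (F1 \<tau> * F1 \<tau>))"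
  have H: "open {\<tau>. Im \<tau> > 0}" by (rule open_halfspace_Im_gt)
  have "mform (2 * k + 4) G (rc_coeff k a)"
    unfolding mform_def
  proof (intro conjI allI impI)
    fix \<tau> :: complex assume \<tau>: "Im \<tau> > 0"
    have "(\<lambda>n. of_int k * ((\<Sum>i\<le>n. a i * (of_nat (n - i) * (of_nat (n - i) * a (n - i)))) * e2pi \<tau> ^ n) -
        of_int (k + 1) * ((\<Sum>i\<le>n. (of_nat i * a i) * (of_nat (n - i) * a (n - i))) * e2pi \<tau> ^ n)) sums G \<tau>"
      unfolding G_def by (intro sums_diff sums_mult sums_cauchy_product s0 s1 s2 \<tau>)
    moreover have "of_int k * ((\<Sum>i\<le>n. a i * (of_nat (n - i) * (of_nat (n - i) * a (n - i)))) * e2pi \<tau> ^ n) -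
        of_int (k + 1) * ((\<Sum>i\<le>n. (of_nat i * a i) * (of_nat (n - i) * a (n - i))) * e2pi \<tau> ^ n) =
        rc_coeff k a n * e2pi \<tau> ^ n" for n
      unfolding rc_coeff_def sum_distrib_left sum_distrib_right sum_subtractf[symmetric]
      by (intro sum.cong refl) (simp add: power2_eq_square algebra_simps)
    ultimately show "(\<lambda>n. rc_coeff k a n * e2pi \<tau> ^ n) sums G \<tau>"
      by simp
  next
    fix A B C D :: int and \<tau> :: complex assume det: "A * D - B * C = 1" and \<tau>: "Im \<tau> > 0"
    define j where "j = (\<lambda>\<tau>::complex. of_int C * \<tau> + of_int D)"
    define g where "g = (\<lambda>\<tau>::complex. (of_int A * \<tau> + of_int B) / j \<tau>)"
    define J where "J = (\<lambda>\<tau>. j \<tau> powi k)"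
    \<comment> \<open>The derivative C of the automorphy factor, rescaled from d/d\<tau> to q d/dq.
      It measures the failure of F' and F'' to be modular.\<close>
    define \<epsilon> where "\<epsilon> = of_int C / \<delta>"
    have \<epsilon>: "\<delta> * \<epsilon> = of_int C" using \<delta> by (simp add: \<epsilon>_def)
    have j0: "j \<tau> \<noteq> 0" if "Im \<tau> > 0" for \<tau>
      unfolding j_def by (rule automorphy_factor_nonzero[OF det that])
    have gH: "Im (g \<tau>) > 0" if "Im \<tau> > 0" for \<tau>
      unfolding g_def j_def by (rule moebius_Im_pos[OF det that])
    have dj: "(j has_field_derivative of_int C) (at \<tau>)" for \<tau>
      unfolding j_def by (auto intro!: derivative_eq_intros)
    have dg: "(g has_field_derivative 1 / j \<tau> ^ 2) (at \<tau>)" if "Im \<tau> > 0" for \<tau>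
    proof -
      have "(g has_field_derivative (of_int A * j \<tau> - (of_int A * \<tau> + of_int B) * of_int C) / (j \<tau> * j \<tau>)) (at \<tau>)"
        unfolding g_def using j0[OF that] by (auto intro!: derivative_eq_intros dj)
      also have "of_int A * j \<tau> - (of_int A * \<tau> + of_int B) * of_int C = of_int (A * D - B * C)"
        by (simp add: j_def algebra_simps)
      finally show ?thesis using det by (simp add: power2_eq_square)
    qed
    have dJ: "(J has_field_derivative of_int k * of_int C * J \<tau> / j \<tau>) (at \<tau>)" if "Im \<tau> > 0" for \<tau>
    proof -
      have "(J has_field_derivative of_int k * j \<tau> powi (k - 1) * of_int C) (at \<tau>)"
        unfolding J_def using j0[OF that] by (auto intro!: derivative_eq_intros dj)
      thus ?thesis using j0[OF that] by (simp add: J_def power_int_diff mult_ac)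
    qed
    have t0: "F (g \<tau>) = J \<tau> * F \<tau>" if "Im \<tau> > 0" for \<tau>
      using mformD(1)[OF F det that] by (simp add: g_def j_def J_def)
    let ?Y = "\<lambda>\<tau>. (of_int k * of_int C * J \<tau> / j \<tau>) * F \<tau> + (\<delta> * F1 \<tau>) * J \<tau>"
    have t1: "F1 (g \<tau>) = J \<tau> * (j \<tau> ^ 2 * F1 \<tau> + of_int k * \<epsilon> * j \<tau> * F \<tau>)" if \<tau>: "Im \<tau> > 0" for \<tau>
    proof -
      have "((\<lambda>\<tau>. F (g \<tau>)) has_field_derivative (\<delta> * F1 (g \<tau>)) * (1 / j \<tau> ^ 2)) (at \<tau>)"
        by (rule DERIV_chain2[OF d0[OF gH[OF \<tau>]] dg[OF \<tau>]])
      moreover have "((\<lambda>\<tau>. F (g \<tau>)) has_field_derivative ?Y \<tau>) (at \<tau>)"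
        by (rule has_field_derivative_transform_within_open[OF DERIV_mult[OF dJ[OF \<tau>] d0[OF \<tau>]] H])
           (use \<tau> t0 in auto)
      ultimately have "(\<delta> * F1 (g \<tau>)) * (1 / j \<tau> ^ 2) = ?Y \<tau>"
        by (rule DERIV_unique)
      hence "\<delta> * F1 (g \<tau>) = j \<tau> ^ 2 * (?Y \<tau>)"
        using j0[OF \<tau>] by (simp add: divide_eq_eq mult.commute)
      also have "\<dots> = \<delta> * (J \<tau> * (j \<tau> ^ 2 * F1 \<tau> + of_int k * \<epsilon> * j \<tau> * F \<tau>))"
        using j0[OF \<tau>] unfolding \<epsilon>[symmetric] by (simp add: power2_eq_square field_simps)
      finally show ?thesis using \<delta> by simp
    qed
    let ?X = "(of_int k * of_int C * J \<tau> / j \<tau>) * (j \<tau> ^ 2 * F1 \<tau> + of_int k * \<epsilon> * j \<tau> * F \<tau>) +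
          (2 * j \<tau> * of_int C * F1 \<tau> + j \<tau> ^ 2 * (\<delta> * F2 \<tau>) + of_int k * \<epsilon> * (of_int C * F \<tau> + j \<tau> * (\<delta> * F1 \<tau>))) * J \<tau>"
    have t2: "F2 (g \<tau>) = J \<tau> * (j \<tau> ^ 4 * F2 \<tau> + (2 * of_int k + 2) * \<epsilon> * j \<tau> ^ 3 * F1 \<tau> + of_int k * (of_int k + 1) * \<epsilon> ^ 2 * j \<tau> ^ 2 * F \<tau>)"
    proof -
      have "((\<lambda>\<tau>. F1 (g \<tau>)) has_field_derivative (\<delta> * F2 (g \<tau>)) * (1 / j \<tau> ^ 2)) (at \<tau>)"
        by (rule DERIV_chain2[OF d1[OF gH[OF \<tau>]] dg[OF \<tau>]])
      moreover have "((\<lambda>\<tau>. F1 (g \<tau>)) has_field_derivative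
          ?X) (at \<tau>)"
      proof (rule has_field_derivative_transform_within_open[OF _ H])
        have "((\<lambda>\<tau>. j \<tau> ^ 2 * F1 \<tau> + of_int k * \<epsilon> * j \<tau> * F \<tau>) has_field_derivative
            (2 * j \<tau> * of_int C * F1 \<tau> + j \<tau> ^ 2 * (\<delta> * F2 \<tau>) + of_int k * \<epsilon> * (of_int C * F \<tau> + j \<tau> * (\<delta> * F1 \<tau>)))) (at \<tau>)"
          by (rule derivative_eq_intros dj d0[OF \<tau>] d1[OF \<tau>] refl)+ (simp add: algebra_simps)
        from DERIV_mult[OF dJ[OF \<tau>] this]
        show "((\<lambda>\<tau>. J \<tau> * (j \<tau> ^ 2 * F1 \<tau> + of_int k * \<epsilon> * j \<tau> * F \<tau>)) has_field_derivative
          ?X) (at \<tau>)" .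
      qed (use \<tau> t1 in auto)
      ultimately have "(\<delta> * F2 (g \<tau>)) * (1 / j \<tau> ^ 2) = ?X"
        by (rule DERIV_unique)
      hence "\<delta> * F2 (g \<tau>) = j \<tau> ^ 2 * (?X)"
        using j0[OF \<tau>] by (simp add: divide_eq_eq mult.commute)
      also have "\<dots> = \<delta> * (J \<tau> * (j \<tau> ^ 4 * F2 \<tau> + (2 * of_int k + 2) * \<epsilon> * j \<tau> ^ 3 * F1 \<tau> + of_int k * (of_int k + 1) * \<epsilon> ^ 2 * j \<tau> ^ 2 * F \<tau>))"
        using j0[OF \<tau>] unfolding \<epsilon>[symmetric] by (simp add: power2_eq_square power3_eq_cube power4_eq_xxxx field_simps)
      finally show ?thesis using \<delta> by simp
    qed
    \<comment> \<open>The terms with \<epsilon> and \<epsilon>^2 cancel between F F'' and F'^2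
      precisely for the weights k and k + 1 of the two products.\<close>
    have "G (g \<tau>) = J \<tau> ^ 2 * j \<tau> ^ 4 * G \<tau>"
      unfolding G_def t0[OF \<tau>] t1[OF \<tau>] t2
      by (simp add: power2_eq_square power3_eq_cube power4_eq_xxxx algebra_simps)
    also have "J \<tau> ^ 2 * j \<tau> ^ 4 = j \<tau> powi (2 * k + 4)"
    proof -
      have "j \<tau> powi (2 * k + 4) = j \<tau> powi (k + k) * j \<tau> powi 4"
        unfolding mult_2 by (rule power_int_add) (use j0[OF \<tau>] in simp)
      also have "j \<tau> powi (k + k) = J \<tau> * J \<tau>"
        unfolding J_def by (rule power_int_add) (use j0[OF \<tau>] in simp)
      finally show ?thesis by (simp add: power2_eq_square)
    qed
    finally show "G (moebius A B C D \<tau>) = automorphy_factor C D \<tau> powi (2 * k + 4) * G \<tau>"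
      by (simp add: g_def j_def)
  qed
  thus ?thesis by blast
qed

text \<open>As long as all coefficients are divisible by p they can be divided by p; the process
  stops because the numerator A of the nonzero coefficient at n0 shrinks.\<close>

lemma p_primitive_scaling:
  assumes p: "prime p" and h: "\<And>n. h n \<in> Z_loc p" and h0: "h n0 \<noteq> (0::complex)"
  shows "\<exists>u b. u \<noteq> 0 \<and> (\<forall>n. b n = u * h n) \<and> (\<forall>n. b n \<in> Z_loc p) \<and> (\<exists>n. b n \<notin> Z_max p)"
proof -
  obtain A q where "\<not> int p dvd q" "h n0 * of_int q = of_int A" using h[of n0] by (elim Z_locE)
  thus ?thesis using h h0
  proof (induction "nat \<bar>A\<bar>" arbitrary: A h rule: less_induct)
    case less
    have p1: "p > 1" using p by (rule prime_gt_1_nat)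
    have A0: "A \<noteq> 0" using less.prems(1,2,4) by auto
    show ?case
    proof (cases "\<exists>n. h n \<notin> Z_max p")
      case True
      thus ?thesis using less.prems(3) by (intro exI[of _ 1] exI[of _ h]) auto
    next
      case False
      hence "\<forall>n. \<exists>z\<in>Z_loc p. h n = of_nat p * z" by (auto simp: Z_max_def)
      then obtain h' where h': "\<And>n. h' n \<in> Z_loc p" "\<And>n. h n = of_nat p * h' n" by metis
      have "of_int q * h n0 \<in> Z_max p" using False p by auto
      hence "int p dvd A" using less.prems(2) of_int_Z_max_iff[OF p] by (metis mult.commute)
      then obtain A' where A': "A = int p * A'" by (elim dvdE)
      have eq: "h' n0 * of_int q = of_int A'"
        using less.prems(2) p1 by (simp add: h'(2) A' mult.assoc)
      have "1 * \<bar>A'\<bar> < int p * \<bar>A'\<bar>" using A0 A' p1 by (intro mult_strict_right_mono) auto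
      hence "nat \<bar>A'\<bar> < nat \<bar>A\<bar>" using A0 by (simp add: A' abs_mult)
      moreover have "h' n0 \<noteq> 0" using less.prems(4) h'(2)[of n0] by auto
      ultimately obtain u b where ub: "u \<noteq> 0" "\<forall>n. b n = u * h' n" "\<forall>n. b n \<in> Z_loc p" "\<exists>n. b n \<notin> Z_max p"
        using less.hyps[of A' h', OF _ less.prems(1) eq] h'(1) by blast
      have "b n = (u / of_nat p) * h n" for n using ub(2) p1 by (simp add: h'(2))
      thus ?thesis using ub p1 by (intro exI[of _ "u / of_nat p"] exI[of _ b]) auto
    qed
  qed
qed

text \<open>A form of nonzero weight with a 0 \<noteq> 0 is not constant. If n0 is its first
  positive degree, the bracket has the coefficient k n0^2 a(0) a(n0) \<noteq> 0 there. After
  primitive rescaling, the missing constant term forces a coefficient prime to p in positive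
  degree.\<close>

lemma nonconstant_mform_exists:
  assumes p: "prime p" and F: "mform k F a" and a: "\<And>n. a n \<in> Z_loc p" and k: "k \<noteq> 0" and a0: "a 0 \<noteq> 0"
  shows "\<exists>w G b. mform w G b \<and> (\<forall>n. b n \<in> Z_loc p) \<and> (\<exists>n>0. b n \<notin> Z_max p)"
proof -
  define h where "h = rc_coeff k a"
  obtain G where G: "mform (2 * k + 4) G h" using mform_rankin_cohen[OF F] unfolding h_def by blast
  have "\<exists>n>0. a n \<noteq> 0"
  proof (rule ccontr)
    assume "\<not> ?thesis"
    hence z: "\<And>n. n \<noteq> 0 \<Longrightarrow> a n = 0" by (metis gr0I)
    have F0: "F \<tau> = a 0" if "Im \<tau> > 0" for \<tau>
    proof -
      have "(\<lambda>n. a n * e2pi \<tau> ^ n) sums (\<Sum>n\<in>{0}. a n * e2pi \<tau> ^ n)"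
        by (rule sums_finite) (auto simp: z)
      thus ?thesis using mformD(2)[OF F that] sums_unique2 by fastforce
    qed
    \<comment> \<open>For a constant form, inversion at this point would give (2 i)^k = 1, which is
      impossible in absolute value since k \<noteq> 0.\<close>
    define t where "t = 2 * \<i>"
    have t: "Im t > 0" "Im (- 1 / t) > 0" by (simp_all add: t_def)
    have "F ((of_int 0 * t + of_int (- 1)) / (of_int 1 * t + of_int 0)) = (of_int 1 * t + of_int 0) powi k * F t"
      using t by (intro mformD(1)[OF F]) auto
    hence "a 0 = t powi k * a 0" using F0[OF t(1)] F0[OF t(2)] by simp
    hence "t powi k = 1" using a0 by simp
    hence "norm (t powi k) = 1" by simp
    moreover have "norm t = 2" by (simp add: t_def norm_mult)
    ultimately have "2 powi k = (1::real)" by (simp only: norm_power_int)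
    moreover have "2 powi k \<noteq> (1::real)"
    proof (cases "k > 0")
      case True
      hence "(1::real) < 2 ^ nat k" by (intro one_less_power) auto
      moreover have "2 powi k = (2::real) ^ nat k" using True by (simp add: power_int_def)
      ultimately show ?thesis by (metis less_irrefl)
    next
      case False
      hence "(1::real) < 2 ^ nat (- k)" using k by (intro one_less_power) auto
      moreover have "2 powi k = inverse ((2::real) ^ nat (- k))"
        using False k by (simp add: power_int_def power_one_over inverse_eq_divide)
      ultimately show ?thesis by (metis inverse_eq_1_iff less_irrefl)
    qed
    ultimately show False by simp
  qed
  define n0 where "n0 = (LEAST n. n > 0 \<and> a n \<noteq> 0)"
  have n0: "n0 > 0" "a n0 \<noteq> 0"
    using LeastI_ex[OF \<open>\<exists>n>0. a n \<noteq> 0\<close>] unfolding n0_def by auto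
  have low: "a n = 0" if "0 < n" "n < n0" for n
    using not_less_Least[of n "\<lambda>n. n > 0 \<and> a n \<noteq> 0"] that unfolding n0_def by auto
  let ?r = "\<lambda>i. (of_int k * of_nat (n0 - i) ^ 2 - of_int (k + 1) * of_nat i * of_nat (n0 - i)) * (a i * a (n0 - i))"
  have "h n0 = (\<Sum>i\<in>{0}. ?r i)"
    unfolding h_def rc_coeff_def
  proof (rule sum.mono_neutral_right)
    show "\<forall>i\<in>{..n0} - {0}. ?r i = 0"
    proof
      fix i assume "i \<in> {..n0} - {0}"
      hence "i = n0 \<or> 0 < i \<and> i < n0" by auto
      hence "i = n0 \<or> a i = 0" using low[of i] by blast
      thus "?r i = 0" by auto
    qed
  qed auto
  hence "h n0 \<noteq> 0" using n0 a0 k by simp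
  moreover have "h n \<in> Z_loc p" for n
    unfolding h_def rc_coeff_def
  proof (intro Z_loc_sum[OF p] Z_loc_mult[OF p] a)
    fix i
    show "of_int k * of_nat (n - i) ^ 2 - of_int (k + 1) * of_nat i * of_nat (n - i) \<in> Z_loc p"
      using Z_loc_of_int[OF p, of "k * int (n - i) ^ 2 - (k + 1) * int i * int (n - i)"] by simp
  qed
  ultimately obtain u b where ub: "u \<noteq> 0" "\<forall>n. b n = u * h n" "\<forall>n. b n \<in> Z_loc p" "\<exists>n. b n \<notin> Z_max p"
    using p_primitive_scaling[OF p, of h n0] by blast
  have "b = (\<lambda>n. u * h n)" using ub(2) by auto
  hence "mform (2 * k + 4) (\<lambda>\<tau>. u * G \<tau>) b" using mform_cmult[OF G] by simp
  moreover have "\<exists>n>0. b n \<notin> Z_max p"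
  proof -
    obtain n where n: "b n \<notin> Z_max p" using ub(4) by blast
    have "b 0 = 0" using ub(2) by (simp add: h_def rc_coeff_def)
    hence "n \<noteq> 0" using n p by (metis Z_max_0)
    thus ?thesis using n by blast
  qed
  ultimately show ?thesis using ub(3) by blast
qed

section \<open>Class sums, with the constant coefficient in index 0\<close>

lemma class_sums_Z_max_nonconstant:
  assumes p: "prime p" and K: "finite K"
    and form: "\<And>k. k \<in> K \<Longrightarrow> jform k m (f k) (c k)"
    and integral: "\<And>k n x y. k \<in> K \<Longrightarrow> c k n x y \<in> Z_loc p"
    and sum0: "\<And>n x y. (\<Sum>k\<in>K. c k n x y) \<in> Z_max p"
    and nm: "0 < n \<or> 0 < m"
  shows "(\<Sum>k\<in>{k \<in> K. [k = a] (mod (int p - 1))}. c k n x y) \<in> Z_max p"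
proof -
  define \<kappa> where "\<kappa> = (\<Sum>k\<in>K. nat \<bar>k\<bar>)"
  interpret jacobi_family p m \<kappa> K f c
  proof
    fix k assume "k \<in> K"
    hence "nat \<bar>k\<bar> \<le> \<kappa>" unfolding \<kappa>_def using K by (intro member_le_sum) auto
    thus "0 \<le> k + int \<kappa>" by linarith
  qed (use assms in auto)
  show ?thesis by (rule class_sum_Z_max[OF sum0 nm])
qed

text \<open>In index 0 the family is multiplied by a form G of weight w that is nonconstant modulo
  p. All classes shift by w, and in a positive degree n1 where b(n1) is prime to p the product
  involves the constant class sum times b(n1); everything else there is already known to vanish
  modulo p.\<close>

lemma class_sums_Z_max:
  assumes p: "prime p" and K: "finite K"
    and form: "\<And>k. k \<in> K \<Longrightarrow> jform k m (f k) (c k)"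
    and integral: "\<And>k n x y. k \<in> K \<Longrightarrow> c k n x y \<in> Z_loc p"
    and sum0: "\<And>n x y. (\<Sum>k\<in>K. c k n x y) \<in> Z_max p"
  shows "(\<Sum>k\<in>{k \<in> K. [k = a] (mod (int p - 1))}. c k n x y) \<in> Z_max p"
proof (cases "0 < n \<or> 0 < m")
  case True
  show ?thesis by (rule class_sums_Z_max_nonconstant[OF assms True])
next
  case False
  hence n0: "n = 0" and m0: "m = 0" by auto
  define Ka where "Ka = {k \<in> K. [k = a] (mod (int p - 1))}"
  show ?thesis
  proof (rule ccontr)
    assume "\<not> ?thesis"
    hence nz: "(\<Sum>k\<in>Ka. c k 0 x y) \<notin> Z_max p" by (simp add: Ka_def n0)
    have "x = 0 \<and> y = 0"
    proof (rule ccontr)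
      assume "\<not> ?thesis"
      hence "c k 0 x y = 0" if "k \<in> K" for k
        using form[OF that] jsupp_coeff_0[of m "c k" x y] unfolding jform_def by blast
      hence "(\<Sum>k\<in>Ka. c k 0 x y) = 0" by (intro sum.neutral) (auto simp: Ka_def)
      thus False using nz p by simp
    qed
    hence xy: "x = 0" "y = 0" by auto
    \<comment> \<open>Otherwise constants come from weight 0 alone, and the class sum in degree 0 is
      either empty or the sum over the whole family.\<close>
    have "\<exists>k\<in>K. k \<noteq> 0 \<and> c k 0 0 0 \<noteq> 0"
    proof (rule ccontr)
      assume "\<not> ?thesis"
      hence z: "c k 0 0 0 = 0" if "k \<in> K" "k \<noteq> 0" for k using that by blast
      have "(\<Sum>k\<in>K. c k 0 0 0) = (\<Sum>k\<in>K \<inter> {0}. c k 0 0 0)"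
        using K z by (intro sum.mono_neutral_right) auto
      moreover have "(\<Sum>k\<in>Ka. c k 0 0 0) = (\<Sum>k\<in>Ka \<inter> {0}. c k 0 0 0)"
        using K z by (intro sum.mono_neutral_right) (auto simp: Ka_def)
      moreover have "Ka \<inter> {0} = K \<inter> {0} \<or> Ka \<inter> {0} = {}" by (auto simp: Ka_def)
      ultimately have "(\<Sum>k\<in>Ka. c k 0 0 0) = (\<Sum>k\<in>K. c k 0 0 0) \<or> (\<Sum>k\<in>Ka. c k 0 0 0) = 0"
        by (elim disjE) (simp_all only: sum.empty simp_thms)
      hence "(\<Sum>k\<in>Ka. c k 0 0 0) \<in> Z_max p" using sum0[of 0 0 0] Z_max_0[OF p] by metis
      thus False using nz by (simp add: xy)
    qed
    then obtain k0 where k0: "k0 \<in> K" "k0 \<noteq> 0" "c k0 0 0 0 \<noteq> 0" by blast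
    have mf: "mform k (f k 0 0) (\<lambda>n. c k n 0 0)" if "k \<in> K" for k
      using jform_0_imp_mform form[OF that] m0 by simp
    obtain w G b where G: "mform w G b" and b: "\<And>n. b n \<in> Z_loc p" and nb: "\<exists>n>0. b n \<notin> Z_max p"
      using nonconstant_mform_exists[OF p mf[OF k0(1)]] integral[OF k0(1)] k0 by blast
    obtain n1 where n1: "0 < n1" "b n1 \<notin> Z_max p" using nb by blast
    \<comment> \<open>The product family is indexed by its own weights k, hence the shift back to k
      - w.\<close>
    define c' where "c' = (\<lambda>k n x y. if x = (0::int) \<and> y = (0::int) then \<Sum>i\<le>n. c (k - w) i 0 0 * b (n - i) else 0)"
    define f' where "f' = (\<lambda>k (_::complex) (_::complex) \<tau>. f (k - w) 0 0 \<tau> * G \<tau>)"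
    define K' where "K' = (\<lambda>k. k + w) ` K"
    have sum_c': "(\<Sum>k\<in>(\<lambda>k. k + w) ` S. c' k n 0 0) = (\<Sum>i\<le>n. (\<Sum>k\<in>S. c k i 0 0) * b (n - i))" for S n
      by (subst sum.reindex) (auto simp: c'_def sum_distrib_right intro: sum.swap)
    let ?T = "\<Sum>i\<in>{..n1} - {0}. (\<Sum>k\<in>Ka. c k i 0 0) * b (n1 - i)"
    have "(\<Sum>k\<in>{k \<in> K'. [k = a + w] (mod (int p - 1))}. c' k n1 0 0) \<in> Z_max p"
    proof (rule class_sums_Z_max_nonconstant[OF p, where K = K' and m = 0 and f = f' and c = c'])
      show "finite K'" using K by (simp add: K'_def)
      show "jform k 0 (f' k) (c' k)" if k: "k \<in> K'" for k
      proof -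
        obtain l where l: "l \<in> K" "k = l + w" using k by (auto simp: K'_def)
        show ?thesis
          using mform_imp_jform[OF mform_mult[OF mf[OF l(1)] G]]
          unfolding f'_def c'_def l(2) add_diff_cancel_right' .
      qed
      show "c' k n x y \<in> Z_loc p" if "k \<in> K'" for k n x y
        unfolding c'_def using p integral b that by (auto simp: K'_def intro!: Z_loc_sum Z_loc_mult)
      show "(\<Sum>k\<in>K'. c' k n x y) \<in> Z_max p" for n x y
      proof (cases "x = 0 \<and> y = 0")
        case True
        have "(\<Sum>i\<le>n. (\<Sum>k\<in>K. c k i 0 0) * b (n - i)) \<in> Z_max p"
          by (rule Z_max_sum[OF p], rule Z_max_mult_right[OF p sum0 b])
        thus ?thesis using True sum_c'[of n K] by (simp add: K'_def)
      qed (use p in \<open>auto simp: c'_def\<close>)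
    qed (use n1(1) in simp)
    also have "{k \<in> K'. [k = a + w] (mod (int p - 1))} = (\<lambda>k. k + w) ` Ka"
      by (auto simp: K'_def Ka_def cong_add_rcancel)
    also have "(\<Sum>k\<in>(\<lambda>k. k + w) ` Ka. c' k n1 0 0) = (\<Sum>i\<le>n1. (\<Sum>k\<in>Ka. c k i 0 0) * b (n1 - i))"
      by (rule sum_c')
    also have "\<dots> = (\<Sum>k\<in>Ka. c k 0 0 0) * b n1 + ?T"
      by (subst sum.remove[of _ 0]) auto
    finally have A: "(\<Sum>k\<in>Ka. c k 0 0 0) * b n1 + ?T \<in> Z_max p" .
    have pos: "(\<Sum>k\<in>Ka. c k i 0 0) \<in> Z_max p" if "0 < i" for i
      unfolding Ka_def using that by (intro class_sums_Z_max_nonconstant[OF assms]) auto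
    have "?T \<in> Z_max p"
      by (rule Z_max_sum[OF p], rule Z_max_mult_right[OF p pos b]) auto
    hence "(\<Sum>k\<in>Ka. c k 0 0 0) * b n1 \<in> Z_max p"
      using A Z_max_diff[OF p A] by fastforce
    hence "(\<Sum>k\<in>Ka. c k 0 0 0) \<in> Z_max p \<or> b n1 \<in> Z_max p"
      using b p integral by (intro Z_max_prime) (auto simp: Ka_def)
    thus False using nz n1(2) xy by simp
  qed
qed

section \<open>Hermitian Jacobi forms\<close>

definition dual_point :: "int \<Rightarrow> int \<Rightarrow> complex" where
  "dual_point x y = (of_int x - \<i> * of_int y) / 2"

lemma gauss_dual_eq: "gauss_dual = range (\<lambda>(x, y). dual_point x y)"
proof (intro equalityI subsetI)
  fix r assume "r \<in> gauss_dual"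
  then obtain a b :: int where "r = \<i> / 2 * (of_int a + \<i> * of_int b)"
    by (auto simp: gauss_dual_def gauss_ints_def)
  hence "r = dual_point (- b) (- a)" by (simp add: dual_point_def complex_eq_iff)
  thus "r \<in> range (\<lambda>(x, y). dual_point x y)" by (auto intro: range_eqI[of _ _ "(- b, - a)"])
next
  fix r assume "r \<in> range (\<lambda>(x, y). dual_point x y)"
  then obtain x y where "r = dual_point x y" by auto
  hence "r = \<i> / 2 * (of_int (- y) + \<i> * of_int (- x))" by (simp add: dual_point_def complex_eq_iff)
  thus "r \<in> gauss_dual" unfolding gauss_dual_def gauss_ints_def by blast
qed

lemma dual_point_eq_iff: "dual_point x y = dual_point x' y' \<longleftrightarrow> x = x' \<and> y = y'"
  by (auto simp: dual_point_def complex_eq_iff)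

lemma dual_point_in [simp]: "dual_point x y \<in> gauss_dual"
  unfolding gauss_dual_eq by (rule range_eqI[of _ _ "(x, y)"]) simp

lemma gauss_dualE:
  assumes "r \<in> gauss_dual"
  obtains x y where "r = dual_point x y"
  using assms unfolding gauss_dual_eq by auto

text \<open>At z1 = \<alpha> \<tau> + \<beta> and z2 = cnj \<alpha> \<tau> + cnj \<beta> the
  exponent r z1 + cnj r z2 splits into two traces r w + cnj (r w), with w = \<alpha> and w =
  \<beta>, which are real inner products.\<close>

lemma fourier_expansion_has_sum:
  assumes c: "fourier_expansion \<phi> c" and \<tau>: "Im \<tau> > 0"
  shows "((\<lambda>(n, x, y). c n (dual_point x y) *
      e2pi (of_real (of_nat n + gi x y \<bullet> \<alpha>) * \<tau> + of_real (gi x y \<bullet> \<beta>))) has_sum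
     \<phi> (\<tau>, \<alpha> * \<tau> + \<beta>, cnj \<alpha> * \<tau> + cnj \<beta>)) UNIV"
proof -
  let ?z1 = "\<alpha> * \<tau> + \<beta>" and ?z2 = "cnj \<alpha> * \<tau> + cnj \<beta>"
  have bij: "bij_betw (\<lambda>(n::nat, x, y). (n, dual_point x y)) UNIV (UNIV \<times> gauss_dual)"
    unfolding bij_betw_def by (auto simp: inj_on_def dual_point_eq_iff image_iff elim!: gauss_dualE)
  have "((\<lambda>(n, r). c n r * e2pi \<tau> ^ n * e2pi (r * ?z1) * e2pi (cnj r * ?z2)) has_sum \<phi> (\<tau>, ?z1, ?z2)) (UNIV \<times> gauss_dual)"
    using c \<tau> unfolding fourier_expansion_def by (auto simp: upper_half_plane_def)
  hence "((\<lambda>i. (\<lambda>(n, r). c n r * e2pi \<tau> ^ n * e2pi (r * ?z1) * e2pi (cnj r * ?z2)) (case i of (n, x, y) \<Rightarrow> (n, dual_point x y)))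
     has_sum \<phi> (\<tau>, ?z1, ?z2)) UNIV"
    by (subst has_sum_reindex_bij_betw[OF bij])
  also have "(\<lambda>i. (\<lambda>(n, r). c n r * e2pi \<tau> ^ n * e2pi (r * ?z1) * e2pi (cnj r * ?z2)) (case i of (n, x, y) \<Rightarrow> (n, dual_point x y))) =
     (\<lambda>(n, x, y). c n (dual_point x y) * e2pi (of_real (of_nat n + gi x y \<bullet> \<alpha>) * \<tau> + of_real (gi x y \<bullet> \<beta>)))"
  proof (intro ext, clarify)
    fix n x y
    have re: "dual_point x y * w + cnj (dual_point x y) * cnj w = of_real (gi x y \<bullet> w)" for w
      by (simp add: dual_point_def complex_eq_iff inner_complex_def field_simps)
    have "of_nat n * \<tau> + dual_point x y * ?z1 + cnj (dual_point x y) * ?z2 =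
       of_nat n * \<tau> + (dual_point x y * \<alpha> + cnj (dual_point x y) * cnj \<alpha>) * \<tau> +
       (dual_point x y * \<beta> + cnj (dual_point x y) * cnj \<beta>)"
      by (simp add: algebra_simps)
    also have "\<dots> = of_real (of_nat n + gi x y \<bullet> \<alpha>) * \<tau> + of_real (gi x y \<bullet> \<beta>)"
      unfolding re by (simp add: algebra_simps)
    finally have X: "of_nat n * \<tau> + dual_point x y * ?z1 + cnj (dual_point x y) * ?z2 =
      of_real (of_nat n + gi x y \<bullet> \<alpha>) * \<tau> + of_real (gi x y \<bullet> \<beta>)" .
    have "e2pi \<tau> ^ n * e2pi (dual_point x y * ?z1) * e2pi (cnj (dual_point x y) * ?z2) =
        e2pi (of_nat n * \<tau> + dual_point x y * ?z1 + cnj (dual_point x y) * ?z2)"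
      unfolding e2pi_power by (simp only: e2pi_add)
    thus "c n (dual_point x y) * e2pi \<tau> ^ n * e2pi (dual_point x y * ?z1) * e2pi (cnj (dual_point x y) * ?z2) =
      c n (dual_point x y) * e2pi (of_real (of_nat n + gi x y \<bullet> \<alpha>) * \<tau> + of_real (gi x y \<bullet> \<beta>))"
      unfolding X by (simp only: mult.assoc)
  qed
  finally show ?thesis .
qed

text \<open>The points (\<tau>, \<beta>, cnj \<beta>) already separate the coefficients on the dual
  lattice; off it both families vanish by definition.\<close>

lemma fourier_expansion_unique:
  assumes c: "fourier_expansion \<phi> c" and c': "fourier_expansion \<phi> c'"
  shows "c = c'"
proof (intro ext)
  fix n r
  show "c n r = c' n r"
  proof (cases "r \<in> gauss_dual")
    case True
    then obtain x y where r: "r = dual_point x y" by (elim gauss_dualE)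
    have "c n (dual_point x y) - c' n (dual_point x y) = 0"
    proof (rule jsum_coeff_eq_0[of "\<lambda>n x y. c n (dual_point x y) - c' n (dual_point x y)"])
      fix \<beta> \<tau> :: complex assume \<tau>: "Im \<tau> > 0"
      have "((\<lambda>(n, x, y). c n (dual_point x y) * e2pi (of_nat n * \<tau> + of_real (gi x y \<bullet> \<beta>))) has_sum \<phi> (\<tau>, \<beta>, cnj \<beta>)) UNIV"
        "((\<lambda>(n, x, y). c' n (dual_point x y) * e2pi (of_nat n * \<tau> + of_real (gi x y \<bullet> \<beta>))) has_sum \<phi> (\<tau>, \<beta>, cnj \<beta>)) UNIV"
        using fourier_expansion_has_sum[OF c \<tau>, of 0 \<beta>] fourier_expansion_has_sum[OF c' \<tau>, of 0 \<beta>] by simp_all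
      from has_sum_add[OF this(1) has_sum_uminusI[OF this(2)]]
      show "((\<lambda>(n, x, y). (c n (dual_point x y) - c' n (dual_point x y)) * e2pi (of_nat n * \<tau> + of_real (gi x y \<bullet> \<beta>))) has_sum 0) UNIV"
        by (simp add: case_prod_unfold left_diff_distrib)
    qed
    thus ?thesis by (simp add: r)
  qed (use c c' in \<open>simp add: fourier_expansion_def\<close>)
qed

lemma fourier_coeff_eq: "fourier_expansion \<phi> c \<Longrightarrow> fourier_coeff \<phi> = c"
  unfolding fourier_coeff_def using fourier_expansion_unique by (intro the_equality) auto

lemma fourier_expansion_sum:
  assumes "\<And>k. k \<in> K \<Longrightarrow> fourier_expansion (\<phi> k) (c k)"
  shows "fourier_expansion (\<lambda>x. \<Sum>k\<in>K. \<phi> k x) (\<lambda>n r. \<Sum>k\<in>K. c k n r)"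
  unfolding fourier_expansion_def
proof (intro conjI allI ballI impI)
  fix n r assume "r \<notin> gauss_dual"
  thus "(\<Sum>k\<in>K. c k n r) = 0" using assms by (intro sum.neutral) (auto simp: fourier_expansion_def)
next
  fix \<tau> z1 z2 assume "\<tau> \<in> upper_half_plane"
  hence "((\<lambda>i. \<Sum>k\<in>K. case i of (n, r) \<Rightarrow> c k n r * e2pi \<tau> ^ n * e2pi (r * z1) * e2pi (cnj r * z2)) has_sum
        (\<Sum>k\<in>K. \<phi> k (\<tau>, z1, z2))) (UNIV \<times> gauss_dual)"
    using assms unfolding fourier_expansion_def by (intro has_sum_finite_sum) blast
  thus "((\<lambda>(n, r). (\<Sum>k\<in>K. c k n r) * e2pi \<tau> ^ n * e2pi (r * z1) * e2pi (cnj r * z2)) has_sum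
        (\<Sum>k\<in>K. \<phi> k (\<tau>, z1, z2))) (UNIV \<times> gauss_dual)"
    by (simp add: sum_distrib_right case_prod_unfold)
qed

lemma fourier_coeff_0: "fourier_coeff (\<lambda>_. 0) = (\<lambda>_ _. 0)"
  by (rule fourier_coeff_eq) (auto simp: fourier_expansion_def case_prod_unfold)

definition torsion_values ::
  "nat \<Rightarrow> (complex \<times> complex \<times> complex \<Rightarrow> complex) \<Rightarrow> jfunction" where
  "torsion_values m \<phi> \<alpha> \<beta> \<tau> = e2pi (of_real (of_nat m * (\<alpha> \<bullet> \<alpha>)) * \<tau> + of_real (of_nat m * (\<alpha> \<bullet> \<beta>))) *
     \<phi> (\<tau>, \<alpha> * \<tau> + \<beta>, cnj \<alpha> * \<tau> + cnj \<beta>)"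

lemma of_real_inner_complex: "(of_real (\<alpha> \<bullet> \<beta>) :: complex) = (\<alpha> * cnj \<beta> + cnj \<alpha> * \<beta>) / 2"
  by (simp add: complex_eq_iff inner_complex_def)

text \<open>The normalising factor of \<open>torsion_values\<close> absorbs the cocycle with
  exponent m c z1 z2 / (c \<tau> + d). This is the comparison of exponents, divided by 2 pi i
  m.\<close>

lemma torsion_exponent_identity:
  fixes a b c d :: int and \<alpha> \<beta> \<tau> :: complex
  assumes det: "a * d - b * c = 1" and j: "of_int c * \<tau> + of_int d \<noteq> 0"
  defines "\<alpha>' \<equiv> of_int a * \<alpha> + of_int c * \<beta>" and "\<beta>' \<equiv> of_int b * \<alpha> + of_int d * \<beta>"
  shows "of_real (\<alpha> \<bullet> \<alpha>) * (moebius a b c d \<tau>) + of_real (\<alpha> \<bullet> \<beta>) +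
     of_int c * (\<alpha>' * \<tau> + \<beta>') * (cnj \<alpha>' * \<tau> + cnj \<beta>') / (of_int c * \<tau> + of_int d) =
     of_real (\<alpha>' \<bullet> \<alpha>') * \<tau> + of_real (\<alpha>' \<bullet> \<beta>')"
proof -
  define A B where "A = cnj \<alpha>" and "B = cnj \<beta>"
  define a' b' c' d' :: complex where abcd: "a' = of_int a" "b' = of_int b" "c' = of_int c" "d' = of_int d"
  have det': "a' * d' - b' * c' = 1"
    unfolding abcd using det by (metis of_int_1 of_int_diff of_int_mult)
  define J where "J = c' * \<tau> + d'"
  have J: "J \<noteq> 0" using j by (simp add: J_def abcd)
  have cn: "cnj \<alpha>' = a' * A + c' * B" "cnj \<beta>' = b' * A + d' * B" "\<alpha>' = a' * \<alpha> + c' * \<beta>" "\<beta>' = b' * \<alpha> + d' * \<beta>"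
    by (simp_all add: \<alpha>'_def \<beta>'_def A_def B_def abcd)
  have "2 * \<alpha> * A * (a' * \<tau> + b') + (\<alpha> * B + A * \<beta>) * J + 2 * c' * (\<alpha>' * \<tau> + \<beta>') * (cnj \<alpha>' * \<tau> + cnj \<beta>') =
        (2 * \<alpha>' * cnj \<alpha>' * \<tau> + \<alpha>' * cnj \<beta>' + cnj \<alpha>' * \<beta>') * J"
  proof -
    \<comment> \<open>Multiplying the untransformed part by the determinant makes this a polynomial
      identity in independent variables.\<close>
    have "(a' * d' - b' * c') * (2 * \<alpha> * A * (a' * \<tau> + b') + (\<alpha> * B + A * \<beta>) * J) +
          2 * c' * (\<alpha>' * \<tau> + \<beta>') * (cnj \<alpha>' * \<tau> + cnj \<beta>') =
          (2 * \<alpha>' * cnj \<alpha>' * \<tau> + \<alpha>' * cnj \<beta>' + cnj \<alpha>' * \<beta>') * J"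
      unfolding cn(1,2) unfolding cn(3,4) J_def by (simp add: algebra_simps)
    thus ?thesis by (simp only: det' mult_1)
  qed
  hence "(2 * \<alpha> * A * (a' * \<tau> + b') + (\<alpha> * B + A * \<beta>) * J + 2 * c' * (\<alpha>' * \<tau> + \<beta>') * (cnj \<alpha>' * \<tau> + cnj \<beta>')) / (2 * J) =
        (2 * \<alpha>' * cnj \<alpha>' * \<tau> + \<alpha>' * cnj \<beta>' + cnj \<alpha>' * \<beta>') / 2"
    using J by (simp add: field_simps)
  moreover have "\<alpha> * A * ((a' * \<tau> + b') / J) + (\<alpha> * B + A * \<beta>) / 2 + c' * P * Q / J =
      (2 * \<alpha> * A * (a' * \<tau> + b') + (\<alpha> * B + A * \<beta>) * J + 2 * c' * P * Q) / (2 * J)" for P Q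
    using J by (simp add: field_simps)
  ultimately have "\<alpha> * A * ((a' * \<tau> + b') / J) + (\<alpha> * B + A * \<beta>) / 2 +
      c' * (\<alpha>' * \<tau> + \<beta>') * (cnj \<alpha>' * \<tau> + cnj \<beta>') / J =
      (2 * \<alpha>' * cnj \<alpha>' * \<tau> + \<alpha>' * cnj \<beta>' + cnj \<alpha>' * \<beta>') / 2"
    by (simp only:)
  also have "\<dots> = (\<alpha>' * cnj \<alpha>' + cnj \<alpha>' * \<alpha>') / 2 * \<tau> + (\<alpha>' * cnj \<beta>' + cnj \<alpha>' * \<beta>') / 2"
    by (simp add: field_simps)
  also have "\<alpha> * A = (\<alpha> * A + A * \<alpha>) / 2" by simp
  finally show ?thesis
    unfolding of_real_inner_complex abcd[symmetric] A_def[symmetric] B_def[symmetric] J_def[symmetric] .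
qed

lemma hermitian_jacobi_form_imp_jform:
  assumes \<phi>: "hermitian_jacobi_form \<delta> k m \<phi>"
  shows "jform k m (torsion_values m \<phi>) (\<lambda>n x y. fourier_coeff \<phi> n (dual_point x y))"
    and "fourier_expansion \<phi> (fourier_coeff \<phi>)"
proof -
  obtain c where c: "fourier_expansion \<phi> c" and supp: "\<And>n r. c n r \<noteq> 0 \<Longrightarrow> (cmod r)\<^sup>2 \<le> real m * real n"
    using \<phi> unfolding hermitian_jacobi_form_def by blast
  have fc: "fourier_coeff \<phi> = c" by (rule fourier_coeff_eq[OF c])
  show "fourier_expansion \<phi> (fourier_coeff \<phi>)" using c fc by simp
  show "jform k m (torsion_values m \<phi>) (\<lambda>n x y. fourier_coeff \<phi> n (dual_point x y))"
    unfolding jform_def fc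
  proof (intro conjI)
    show "jsupp m (\<lambda>n x y. c n (dual_point x y))"
      unfolding jsupp_def
    proof (intro allI impI)
      fix n x y assume "c n (dual_point x y) \<noteq> 0"
      hence "(cmod (dual_point x y))\<^sup>2 \<le> real m * real n" by (rule supp)
      hence "real_of_int (x\<^sup>2 + y\<^sup>2) \<le> real_of_int (4 * int m * int n)"
        by (simp add: cmod_power2 dual_point_def power_divide)
      thus "x\<^sup>2 + y\<^sup>2 \<le> 4 * int m * int n" by (simp only: of_int_le_iff)
    qed
    show "jsum m (\<lambda>n x y. c n (dual_point x y)) (torsion_values m \<phi>)"
      unfolding jsum_def
    proof (intro allI impI)
      fix \<alpha> \<beta> \<tau> :: complex assume \<tau>: "Im \<tau> > 0"
      let ?e = "\<lambda>n x y. e2pi (of_real (of_nat n + gi x y \<bullet> \<alpha>) * \<tau> + of_real (gi x y \<bullet> \<beta>))"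
      let ?u = "e2pi (of_real (of_nat m * (\<alpha> \<bullet> \<alpha>)) * \<tau> + of_real (of_nat m * (\<alpha> \<bullet> \<beta>)))"
      have "((\<lambda>i. ?u * (case i of (n, x, y) \<Rightarrow> c n (dual_point x y) *
          ?e n x y)) has_sum torsion_values m \<phi> \<alpha> \<beta> \<tau>) UNIV"
        unfolding torsion_values_def by (intro has_sum_cmult_right fourier_expansion_has_sum[OF c \<tau>])
      moreover have "?u * (case i of (n, x, y) \<Rightarrow> c n (dual_point x y) *
          ?e n x y) =
          (case i of (n, x, y) \<Rightarrow> c n (dual_point x y) * e2pi (jexp m n x y \<alpha> \<beta> \<tau>))" for i
      proof -
        obtain n x y where i: "i = (n, x, y)" by (cases i)
        have "jexp m n x y \<alpha> \<beta> \<tau> = (of_real (of_nat m * (\<alpha> \<bullet> \<alpha>)) * \<tau> + of_real (of_nat m * (\<alpha> \<bullet> \<beta>))) +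
            (of_real (of_nat n + gi x y \<bullet> \<alpha>) * \<tau> + of_real (gi x y \<bullet> \<beta>))"
          by (simp add: jexp_def algebra_simps)
        hence "e2pi (jexp m n x y \<alpha> \<beta> \<tau>) = ?u * ?e n x y"
          by (simp only: e2pi_add)
        thus ?thesis unfolding i prod.case by (simp only: mult_ac)
      qed
      ultimately show "((\<lambda>(n, x, y). c n (dual_point x y) * e2pi (jexp m n x y \<alpha> \<beta> \<tau>)) has_sum torsion_values m \<phi> \<alpha> \<beta> \<tau>) UNIV"
        by simp
    qed
    show "jmod k (torsion_values m \<phi>)"
      unfolding jmod_def
    proof (intro allI impI)
      fix a b c d :: int and \<alpha> \<beta> \<tau> :: complex
      assume det: "a * d - b * c = 1" and \<tau>: "Im \<tau> > 0"
      define j where "j = of_int c * \<tau> + of_int d"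
      define g where "g = (of_int a * \<tau> + of_int b) / j"
      define \<alpha>' where "\<alpha>' = of_int a * \<alpha> + of_int c * \<beta>"
      define \<beta>' where "\<beta>' = of_int b * \<alpha> + of_int d * \<beta>"
      define z1 where "z1 = \<alpha>' * \<tau> + \<beta>'"
      define z2 where "z2 = cnj \<alpha>' * \<tau> + cnj \<beta>'"
      have j0: "j \<noteq> 0" unfolding j_def by (rule automorphy_factor_nonzero[OF det \<tau>])
      \<comment> \<open>This relation dictates the row-vector action: \<alpha>' \<tau> + \<beta>' =
        \<alpha> (a \<tau> + b) + \<beta> (c \<tau> + d).\<close>
      have z: "z1 / j = \<alpha> * g + \<beta>" "z2 / j = cnj \<alpha> * g + cnj \<beta>"
        using j0 by (simp_all add: z1_def z2_def g_def \<alpha>'_def \<beta>'_def field_simps) (simp_all add: j_def algebra_simps)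
      let ?\<phi>g = "\<phi> (g, \<alpha> * g + \<beta>, cnj \<alpha> * g + cnj \<beta>)"
      \<comment> \<open>The transformation law is applied with the unit 1, where both parity
        characters have the value 1.\<close>
      have one: "(1::complex) \<in> gauss_units" by (simp add: gauss_units_def)
      have par: "parity_char \<delta> 1 = 1" by (cases \<delta>) auto
      have "parity_char \<delta> 1 * 1 powi (-k) * automorphy_factor c d \<tau> powi (-k)
             * exp (- (2 * of_real pi * \<i> * of_nat m * of_int c * z1 * z2 / (of_int c * \<tau> + of_int d)))
             * \<phi> ((of_int a * \<tau> + of_int b) / (of_int c * \<tau> + of_int d),
                   1 * z1 / (of_int c * \<tau> + of_int d), cnj 1 * z2 / (of_int c * \<tau> + of_int d))
           = \<phi> (\<tau>, z1, z2)"
        using \<phi> det \<tau> one unfolding hermitian_jacobi_form_def upper_half_plane_def by blast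
      hence "j powi (-k) * exp (- (2 * of_real pi * \<i> * of_nat m * of_int c * z1 * z2 / j)) * ?\<phi>g = \<phi> (\<tau>, z1, z2)"
        unfolding j_def[symmetric] g_def[symmetric] mult_1 complex_cnj_one z par by (simp add: power_int_1_left)
      moreover define X where "X = e2pi (of_nat m * (of_int c * z1 * z2 / j))"
      have X0: "X \<noteq> 0" by (simp add: X_def)
      have "exp (- (2 * of_real pi * \<i> * of_nat m * of_int c * z1 * z2 / j)) = inverse X"
        by (simp add: X_def e2pi_def exp_minus mult_ac)
      ultimately have "j powi (-k) * inverse X * ?\<phi>g = \<phi> (\<tau>, z1, z2)"
        by (simp only:)
      moreover have "j powi k * X * (j powi (-k) * inverse X * w) = w" for w
        using j0 X0 by (simp add: power_int_minus field_simps)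
      ultimately have "?\<phi>g = j powi k * X * \<phi> (\<tau>, z1, z2)"
        by metis
      hence "?\<phi>g = j powi k * e2pi (of_nat m * (of_int c * z1 * z2 / j)) * \<phi> (\<tau>, z1, z2)"
        by (simp only: X_def)
      hence "torsion_values m \<phi> \<alpha> \<beta> g = j powi k * (e2pi (of_real (of_nat m * (\<alpha> \<bullet> \<alpha>)) * g + of_real (of_nat m * (\<alpha> \<bullet> \<beta>)))
            * e2pi (of_nat m * (of_int c * z1 * z2 / j))) * \<phi> (\<tau>, z1, z2)"
        by (simp add: torsion_values_def)
      also have "e2pi (of_real (of_nat m * (\<alpha> \<bullet> \<alpha>)) * g + of_real (of_nat m * (\<alpha> \<bullet> \<beta>))) * e2pi (of_nat m * (of_int c * z1 * z2 / j)) =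
          e2pi (of_nat m * (of_real (\<alpha> \<bullet> \<alpha>) * g + of_real (\<alpha> \<bullet> \<beta>) + of_int c * z1 * z2 / j))"
        by (simp add: distrib_left mult.assoc flip: e2pi_add)
      also have "of_real (\<alpha> \<bullet> \<alpha>) * g + of_real (\<alpha> \<bullet> \<beta>) + of_int c * z1 * z2 / j = of_real (\<alpha>' \<bullet> \<alpha>') * \<tau> + of_real (\<alpha>' \<bullet> \<beta>')"
        using torsion_exponent_identity[OF det, of \<tau> \<alpha> \<beta>] j0
        unfolding g_def j_def z1_def z2_def \<alpha>'_def \<beta>'_def by blast
      finally have "torsion_values m \<phi> \<alpha> \<beta> g = j powi k * torsion_values m \<phi> \<alpha>' \<beta>' \<tau>"
        by (simp add: torsion_values_def z1_def z2_def distrib_left mult.assoc)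
      thus "torsion_values m \<phi> \<alpha> \<beta> (moebius a b c d \<tau>) =
         automorphy_factor c d \<tau> powi k * torsion_values m \<phi> (of_int a * \<alpha> + of_int c * \<beta>) (of_int b * \<alpha> + of_int d * \<beta>) \<tau>"
        by (simp add: g_def j_def \<alpha>'_def \<beta>'_def)
    qed
  qed
qed

section \<open>Comparison of indices and conclusion\<close>

lemma jform_uminus:
  assumes "jform k m f c"
  shows "jform k m (\<lambda>\<alpha> \<beta> \<tau>. - f \<alpha> \<beta> \<tau>) (\<lambda>n x y. - c n x y)"
  using assms unfolding jform_def jmod_def jsum_def jsupp_def
  by (auto simp: case_prod_unfold intro!: has_sum_uminusI)

text \<open>Translating a coefficient of \<open>d\<close> along the invariance of index \<open>m'\<close> leaves the support
  cone of index \<open>m\<close> if \<open>m < m'\<close>.\<close>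

lemma congruent_jforms_index_le:
  assumes p: "prime p" and f: "jform k m f c" and g: "jform k' m' g d"
    and cong: "\<And>n x y. c n x y - d n x y \<in> Z_max p" and nz: "c n x y \<notin> Z_max p"
  shows "m' \<le> m"
proof (rule ccontr)
  assume "\<not> m' \<le> m"
  hence mm: "int m' - int m \<ge> 1" by linarith
  have iff: "c n x y \<in> Z_max p \<longleftrightarrow> d n x y \<in> Z_max p" for n x y
    using Z_max_add_cancel[OF p cong[of n x y], of "d n x y"] by simp
  have "d n x y \<noteq> 0" using nz iff p by auto
  hence cone: "(n, x, y) \<in> jcone m'" using g unfolding jform_def jsupp_def jcone_def by auto
  \<comment> \<open>L > |x| gives m' L^2 + x L \<ge> L, and L > m n then makes 4 (m' - m) (m' L^2 +
    x L) exceed 4 m n, against the support bound of index m at the translated triple.\<close>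
  define L where "L = \<bar>x\<bar> + int m * int n + 1"
  define n' where "n' = nat (int n + int m' * L\<^sup>2 + x * L)"
  define x' where "x' = x + 2 * int m' * L"
  have n': "int n' = int n + int m' * L\<^sup>2 + x * L"
    using jcone_translate(1)[OF cone, of L] by (simp add: n'_def)
  have "d n' x' y = d n x y" unfolding n'_def x'_def by (rule jform_translate[OF g cone])
  hence "c n' x' y \<notin> Z_max p" using iff nz by metis
  hence "c n' x' y \<noteq> 0" using p by auto
  hence "x'\<^sup>2 + y\<^sup>2 \<le> 4 * int m * int n'" using f unfolding jform_def jsupp_def by blast
  hence "x'\<^sup>2 \<le> 4 * int m * int n'" using zero_le_power2[of y] by linarith
  hence ineq: "4 * (int m' - int m) * (int m' * L\<^sup>2 + x * L) + x\<^sup>2 \<le> 4 * int m * int n"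
    unfolding x'_def n' by (simp add: power2_eq_square algebra_simps)
  have L1: "L \<ge> 1" "L \<ge> \<bar>x\<bar> + 1" "L > int m * int n" by (simp_all add: L_def)
  have "L * 1 \<le> L * (L - \<bar>x\<bar>)" using L1 by (intro mult_left_mono) auto
  also have "\<dots> = L\<^sup>2 - \<bar>x\<bar> * L" by (simp add: power2_eq_square algebra_simps)
  also have "\<dots> \<le> int m' * L\<^sup>2 + x * L"
  proof -
    have "1 * L\<^sup>2 \<le> int m' * L\<^sup>2" using mm by (intro mult_right_mono) auto
    moreover have "- \<bar>x\<bar> * L \<le> x * L" using L1 by (intro mult_right_mono) auto
    ultimately show ?thesis by simp
  qed
  finally have b: "L \<le> int m' * L\<^sup>2 + x * L" by simp
  have "4 * 1 * L \<le> 4 * (int m' - int m) * (int m' * L\<^sup>2 + x * L)"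
    using mm b L1 by (intro mult_mono) auto
  hence "4 * L \<le> 4 * int m * int n" using ineq zero_le_power2[of x] by linarith
  thus False using L1(3) by simp
qed

lemma fourier_cong_iff:
  "fourier_cong p \<phi> \<psi> \<longleftrightarrow>
     (\<forall>n x y. fourier_coeff \<phi> n (dual_point x y) - fourier_coeff \<psi> n (dual_point x y) \<in> Z_max p)"
  unfolding fourier_cong_def Z_max_def by (metis dual_point_in gauss_dualE)

lemma HJ_locD:
  assumes "\<phi> \<in> HJ_loc p \<delta> k m"
  shows "jform k m (torsion_values m \<phi>) (\<lambda>n x y. fourier_coeff \<phi> n (dual_point x y))"
    and "fourier_expansion \<phi> (fourier_coeff \<phi>)" and "fourier_coeff \<phi> n (dual_point x y) \<in> Z_loc p"
  using assms hermitian_jacobi_form_imp_jform[of \<delta> k m \<phi>] by (auto simp: HJ_loc_def)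

theorem theorem3p1:
  fixes p :: nat
  assumes "prime p" and "p \<ge> 5"
  shows
    "(\<forall>(\<phi> :: complex \<times> complex \<times> complex \<Rightarrow> complex) \<psi> \<delta> \<delta>' k k' m m'.
        \<phi> \<in> HJ_loc p \<delta> k m \<longrightarrow> \<psi> \<in> HJ_loc p \<delta>' k' m' \<longrightarrow>
        \<not> fourier_cong p (\<lambda>_. 0) \<phi> \<longrightarrow> fourier_cong p \<phi> \<psi> \<longrightarrow>
        m = m' \<and> [k = k'] (mod (int p - 1))) \<and>
     (\<forall>m (K :: int set) (\<phi> :: int \<Rightarrow> complex \<times> complex \<times> complex \<Rightarrow> complex)
        (\<delta> :: int \<Rightarrow> parity).
        finite K \<longrightarrow> (\<forall>k \<in> K. \<phi> k \<in> HJ_loc p (\<delta> k) k m) \<longrightarrow>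
        fourier_cong p (\<lambda>x. \<Sum>k \<in> K. \<phi> k x) (\<lambda>_. 0) \<longrightarrow>
        (\<forall>a :: int. fourier_cong p
           (\<lambda>x. \<Sum>k \<in> {k \<in> K. [k = a] (mod (int p - 1))}. \<phi> k x) (\<lambda>_. 0)))"
proof (intro conjI allI impI)
  note p = assms(1)
  fix \<phi> \<psi> :: "complex \<times> complex \<times> complex \<Rightarrow> complex" and \<delta> \<delta>' k k' m m'
  assume \<phi>: "\<phi> \<in> HJ_loc p \<delta> k m" and \<psi>: "\<psi> \<in> HJ_loc p \<delta>' k' m'"
    and nz: "\<not> fourier_cong p (\<lambda>_. 0) \<phi>" and cong: "fourier_cong p \<phi> \<psi>"
  define c where "c = (\<lambda>n x y. fourier_coeff \<phi> n (dual_point x y))"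
  define d where "d = (\<lambda>n x y. fourier_coeff \<psi> n (dual_point x y))"
  have f: "jform k m (torsion_values m \<phi>) c" and g: "jform k' m' (torsion_values m' \<psi>) d"
    using HJ_locD(1)[OF \<phi>] HJ_locD(1)[OF \<psi>] by (simp_all add: c_def d_def)
  have cZ: "c n x y \<in> Z_loc p" and dZ: "d n x y \<in> Z_loc p" for n x y
    using HJ_locD(3)[OF \<phi>] HJ_locD(3)[OF \<psi>] by (simp_all add: c_def d_def)
  have cd: "c n x y - d n x y \<in> Z_max p" for n x y
    using cong by (simp add: fourier_cong_iff c_def d_def)
  have dc: "d n x y - c n x y \<in> Z_max p" for n x y
    using Z_max_minus[OF p cd[of n x y]] by simp
  obtain n x y where c_nz: "c n x y \<notin> Z_max p"
    using nz by (auto simp: fourier_cong_iff fourier_coeff_0 c_def Z_max_minus_iff[OF p])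
  have d_nz: "d n x y \<notin> Z_max p"
    using c_nz Z_max_add_cancel[OF p cd[of n x y], of "d n x y"] by simp
  show m: "m = m'"
    using congruent_jforms_index_le[OF p f g cd c_nz] congruent_jforms_index_le[OF p g f dc d_nz] by simp
  show "[k = k'] (mod (int p - 1))"
  proof (rule ccontr)
    assume ncong: "\<not> [k = k'] (mod (int p - 1))"
    hence kk: "k \<noteq> k'" by auto
    \<comment> \<open>The two forms become one family with weights k and k', the second negated,
      whose sum vanishes modulo p. Distinct classes would isolate the first form alone.\<close>
    define F where "F = (\<lambda>l. if l = k then torsion_values m \<phi> else (\<lambda>\<alpha> \<beta> \<tau>. - torsion_values m' \<psi> \<alpha> \<beta> \<tau>))"
    define C where "C = (\<lambda>l. if l = k then c else (\<lambda>n x y. - d n x y))"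
    have "(\<Sum>l\<in>{l \<in> {k, k'}. [l = k] (mod (int p - 1))}. C l n x y) \<in> Z_max p"
    proof (rule class_sums_Z_max[OF p])
      show "jform l m (F l) (C l)" if "l \<in> {k, k'}" for l
        using that f jform_uminus[OF g] kk by (auto simp: F_def C_def m)
      show "C l n x y \<in> Z_loc p" if "l \<in> {k, k'}" for l n x y
        using cZ dZ p by (auto simp: C_def)
      show "(\<Sum>l\<in>{k, k'}. C l n x y) \<in> Z_max p" for n x y
        using cd kk by (simp add: C_def)
    qed simp
    also have "{l \<in> {k, k'}. [l = k] (mod (int p - 1))} = {k}"
      using ncong by (auto simp: cong_sym_eq)
    finally show False using c_nz by (simp add: C_def)
  qed
next
  note p = assms(1)
  fix m and K :: "int set" and \<phi> :: "int \<Rightarrow> complex \<times> complex \<times> complex \<Rightarrow> complex" and \<delta> :: "int \<Rightarrow> parity" and a :: int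
  assume K: "finite K" and \<phi>: "\<forall>k\<in>K. \<phi> k \<in> HJ_loc p (\<delta> k) k m"
    and cong: "fourier_cong p (\<lambda>x. \<Sum>k\<in>K. \<phi> k x) (\<lambda>_. 0)"
  have coeff: "fourier_coeff (\<lambda>x. \<Sum>k\<in>S. \<phi> k x) = (\<lambda>n r. \<Sum>k\<in>S. fourier_coeff (\<phi> k) n r)" if "S \<subseteq> K" for S
    using \<phi> that by (intro fourier_coeff_eq fourier_expansion_sum HJ_locD(2)) auto
  have "(\<Sum>k\<in>{k \<in> K. [k = a] (mod (int p - 1))}. fourier_coeff (\<phi> k) n (dual_point x y)) \<in> Z_max p" for n x y
  proof (rule class_sums_Z_max[OF p K, where c = "\<lambda>k n x y. fourier_coeff (\<phi> k) n (dual_point x y)"])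
    show "jform k m (torsion_values m (\<phi> k)) (\<lambda>n x y. fourier_coeff (\<phi> k) n (dual_point x y))" if "k \<in> K" for k
      using HJ_locD(1) \<phi> that by blast
    show "fourier_coeff (\<phi> k) n (dual_point x y) \<in> Z_loc p" if "k \<in> K" for k n x y
      using HJ_locD(3) \<phi> that by blast
    show "(\<Sum>k\<in>K. fourier_coeff (\<phi> k) n (dual_point x y)) \<in> Z_max p" for n x y
      using cong by (simp add: fourier_cong_iff fourier_coeff_0 coeff)
  qed
  thus "fourier_cong p (\<lambda>x. \<Sum>k\<in>{k \<in> K. [k = a] (mod (int p - 1))}. \<phi> k x) (\<lambda>_. 0)"
    unfolding fourier_cong_iff fourier_coeff_0 by (subst coeff) auto
qed

end
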